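(* Let $l_1,l_2,m_1,m_2,n_1,n_2\in\mathbb{R}$ and consider the piecewise quadratic differential system $$\dot x=-y+l_jx^2+m_jxy+n_jy^2,\qquad \dot y=x(1-y),\qquad \text{if } (-1)^jy<0,\quad j=1,2$$ (so $j=1$ on $\{y>0\}$ and $j=2$ on $\{y<0\}$). The origin is a center if and only if one of the following conditions holds: \begin{itemize} \item[$(\mathcal H_1)$] $m_1=m_2=0$; \item[$(\mathcal H_2)$] $l_1-l_2=m_1-m_2=l_1+n_2=l_1+n_1=0$; \item[$(\mathcal H_3)$] $l_1+l_2+1=m_1-m_2=n_1+n_2-1=0$. \end{itemize}
   Context: The separation line is $\{y=0\}$. The origin is a center if some punctured neighborhood of it is filled with crossing periodic orbits surrounding the origin. Here a crossing periodic orbit is obtained by concatenating orbit arcs of the system in $\{y>0\}$ and of the system in $\{y<0\}$ at points of $\{y=0\}$ where both vector fields are transversal to this line and point to the same side. *)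

theory Defs
  imports "HOL-Analysis.Analysis"
begin

definition quad_field :: "real \<Rightarrow> real \<Rightarrow> real \<Rightarrow> real \<times> real \<Rightarrow> real \<times> real" where
  "quad_field l m n = (\<lambda>(x, y). (- y + l * x\<^sup>2 + m * x * y + n * y\<^sup>2, x * (1 - y)))"

definition upper_half :: "(real \<times> real) set" where
  "upper_half = {p. snd p > 0}"

definition lower_half :: "(real \<times> real) set" where
  "lower_half = {p. snd p < 0}"

definition separation_line :: "(real \<times> real) set" where
  "separation_line = {p. snd p = 0}"

text \<open>The vector field is total, so it also makes sense on the separation line; at the end points
  of the time interval the derivative is one-sided.\<close>

definition orbit_arc ::
  "(real \<times> real \<Rightarrow> real \<times> real) \<Rightarrow> (real \<times> real) set \<Rightarrow> (real \<Rightarrow> real \<times> real) \<Rightarrow> real \<Rightarrow> real \<Rightarrow> bool" where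
  "orbit_arc X S \<gamma> a b \<longleftrightarrow>
     a < b \<and>
     (\<forall>t\<in>{a..b}. (\<gamma> has_vector_derivative X (\<gamma> t)) (at t within {a..b})) \<and>
     (\<forall>t\<in>{a<..<b}. \<gamma> t \<in> S) \<and>
     \<gamma> a \<in> separation_line \<and> \<gamma> b \<in> separation_line"

text \<open>The product is positive iff both second components are nonzero (transversality to the
  line \<open>y = 0\<close>) and have the same sign (both fields point to the same side).\<close>

definition crossing_point ::
  "(real \<times> real \<Rightarrow> real \<times> real) \<Rightarrow> (real \<times> real \<Rightarrow> real \<times> real) \<Rightarrow> real \<times> real \<Rightarrow> bool" where
  "crossing_point X1 X2 p \<longleftrightarrow> p \<in> separation_line \<and> snd (X1 p) * snd (X2 p) > 0"

text \<open>\<open>X1\<close> governs the upper and \<open>X2\<close> the lower half plane. Orbits are point sets, so \<open>\<gamma>\<close>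
  may run through the orbit more than once.\<close>

definition crossing_periodic_orbit ::
  "(real \<times> real \<Rightarrow> real \<times> real) \<Rightarrow> (real \<times> real \<Rightarrow> real \<times> real) \<Rightarrow> (real \<times> real) set \<Rightarrow> bool" where
  "crossing_periodic_orbit X1 X2 \<Gamma> \<longleftrightarrow>
     (\<exists>(\<gamma> :: real \<Rightarrow> real \<times> real) (k :: nat) (\<tau> :: nat \<Rightarrow> real).
        k \<ge> 1 \<and>
        (\<forall>i<k. orbit_arc X1 upper_half \<gamma> (\<tau> i) (\<tau> (Suc i)) \<or>
               orbit_arc X2 lower_half \<gamma> (\<tau> i) (\<tau> (Suc i))) \<and>
        (\<forall>i\<le>k. crossing_point X1 X2 (\<gamma> (\<tau> i))) \<and>
        \<gamma> (\<tau> k) = \<gamma> (\<tau> 0) \<and>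
        \<Gamma> = \<gamma> ` {\<tau> 0..\<tau> k})"

text \<open>An orbit surrounds the origin if the origin lies in a bounded component of its
  complement.\<close>

definition origin_is_center ::
  "(real \<times> real \<Rightarrow> real \<times> real) \<Rightarrow> (real \<times> real \<Rightarrow> real \<times> real) \<Rightarrow> bool" where
  "origin_is_center X1 X2 \<longleftrightarrow>
     (\<exists>U. (0, 0) \<in> interior U \<and>
        (\<forall>p \<in> U - {(0, 0)}. \<exists>\<Gamma>. crossing_periodic_orbit X1 X2 \<Gamma> \<and> (0, 0) \<in> inside \<Gamma> \<and>
            p \<in> \<Gamma> \<and> \<Gamma> \<subseteq> U - {(0, 0)}))"

end

theory Submission
  imports Defs "HOL-Complex_Analysis.Complex_Analysis"
begin

text \<open>In the coordinates \<open>z = (1 - y)\<^bsup>l\<^esup> x\<close> and \<open>w\<close> with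
  \<open>w dw = (y - n y\<^sup>2) (1 - y)\<^bsup>2 l - 1\<^esup> dy\<close> each quadratic system becomes, up to a positive time factor,
  a Lienard system \<open>z' = m w \<psi>(w) z - w\<close>, \<open>w' = z\<close> with
  \<open>\<psi> = (1 - y)\<^bsup>- l\<^esup> / (1 - n y)\<close>. In polar coordinates the half-return map is strictly monotone in the
  function \<open>m w \<psi>(w)\<close>, and this function is analytic in \<open>w\<close>. Hence the origin is a center iff
  \<open>m1 \<psi>1(w) = m2 \<psi>2(- w)\<close> near \<open>w = 0\<close>: otherwise the difference has a constant sign for small
  \<open>w > 0\<close> and all turns around the origin expand, or all contract. The identity of the two functions is
  decided algebraically, because \<open>\<psi>' = w \<psi>\<^sup>3 ((l + n) / y - n (l + 1))\<close> recovers \<open>y\<close> from \<open>\<psi>\<close>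
  when \<open>l + n \<noteq> 0\<close>, and \<open>\<psi>\<^bsup>- 2\<^esup> = 1 + n (l + 1) w\<^sup>2\<close> when \<open>l + n = 0\<close>.\<close>

section \<open>Polar form of Lienard systems\<close>

text \<open>The obstacle is that no return map is at hand: a crossing periodic orbit may consist of
  many arcs, each with its own clock, and an arc that starts near the origin is not known a priori
  to stay where the Lienard coordinates exist. The remedy is to use the polar angle as the clock. On
  a half turn it runs from 0 to pi < 4 and |d ln r / d angle| \<le> 1/50, so the radius changes by
  less than a factor 3. This confines arcs to the chart and makes arcs with unrelated
  parametrizations comparable. The constants come from the bound 1/100 on f(v) = m v psi(v), reached
  by shrinking the neighborhood. Analyticity excludes what a merely smooth function could do, namely
  oscillate: it gives the difference of the two Lienard functions a sign to the right of 0. In the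
  converse direction one f governs both sides, so a single solution r of the polar equation yields
  both halves of a closed orbit. That orbit bounds the explicit open set radius < r(angle), so the
  origin is seen to lie inside it without the Jordan curve theorem.\<close>

lemma zero_of_differential_inequality:
  fixes D \<phi> D' \<phi>' :: "real \<Rightarrow> real"
  assumes ab: "a < b" and L: "0 \<le> L"
    and contD: "continuous_on {a..b} D" and contp: "continuous_on {a..b} \<phi>"
    and derD: "\<And>t. a < t \<Longrightarrow> t < b \<Longrightarrow> (D has_real_derivative D' t) (at t)"
    and derp: "\<And>t. a < t \<Longrightarrow> t < b \<Longrightarrow> (\<phi> has_real_derivative \<phi>' t) (at t)"
    and pos: "\<And>t. a < t \<Longrightarrow> t < b \<Longrightarrow> 0 \<le> \<phi>' t"
    and ineq: "\<And>t. a < t \<Longrightarrow> t < b \<Longrightarrow> D' t \<ge> - L * \<bar>D t\<bar> * \<phi>' t"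
    and end_le: "D b \<le> 0"
  shows "D a \<le> 0"
    and "t0 \<in> {a<..<b} \<Longrightarrow> D' t0 > - L * \<bar>D t0\<bar> * \<phi>' t0 \<Longrightarrow> D a < 0"
proof -
  have nonpos: "D t0 \<le> 0" if t0: "a \<le> t0" "t0 \<le> b" for t0
  proof (rule ccontr)
    assume "\<not> D t0 \<le> 0"
    then have D0: "D t0 > 0" by simp
    \<comment> \<open>From a point with D > 0, go to the first later time where D is no longer
      positive. Up to there |D| = D, so D exp (L \<phi>) is nondecreasing and cannot reach a value
      \<le> 0.\<close>
    let ?Z = "{t \<in> {t0..b}. D t \<le> 0}"
    have contD': "continuous_on {t0..b} D"
      using contD t0 by (auto intro: continuous_on_subset)
    have clZ: "closed ?Z"
      using continuous_closed_preimage[OF contD' closed_atLeastAtMost closed_atMost[of 0]]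
      by (simp add: vimage_def Int_def)
    have neZ: "b \<in> ?Z" using t0 end_le by auto
    have bdZ: "bdd_below ?Z" by (rule bdd_belowI[of _ t0]) auto
    define t1 where "t1 = Inf ?Z"
    have t1Z: "t1 \<in> ?Z" unfolding t1_def using closed_contains_Inf[OF _ bdZ clZ] neZ by blast
    have t01: "t0 < t1" using t1Z D0 by (cases "t0 = t1") auto
    have Dpos: "D t > 0" if "t0 \<le> t" "t < t1" for t
      using cInf_lower[OF _ bdZ, of t] that t1Z unfolding t1_def[symmetric] by force
    let ?E = "\<lambda>t. D t * exp (L * \<phi> t)"
    have "?E t0 \<le> ?E t1"
    proof (rule DERIV_nonneg_imp_increasing_open[of t0 t1 ?E])
      show "t0 \<le> t1" using t01 by simp
      show "continuous_on {t0..t1} ?E"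
        using t0 t1Z by (intro continuous_intros continuous_on_subset[OF contD] continuous_on_subset[OF contp]) auto
      fix t assume t: "t0 < t" "t < t1"
      have t': "a < t" "t < b" using t t0 t1Z by auto
      have d: "(?E has_real_derivative (D' t + L * \<phi>' t * D t) * exp (L * \<phi> t)) (at t)"
        by (auto intro!: derivative_eq_intros derD[OF t'] derp[OF t'] simp: algebra_simps)
      have "D' t + L * \<phi>' t * D t \<ge> 0"
        using ineq[OF t'] Dpos[of t] t by (simp add: algebra_simps)
      then show "\<exists>y. (?E has_real_derivative y) (at t) \<and> 0 \<le> y"
        using d by (intro exI[of _ "(D' t + L * \<phi>' t * D t) * exp (L * \<phi> t)"]) auto
    qed
    moreover have "?E t0 > 0" using D0 by simp
    moreover have "?E t1 \<le> 0" using t1Z by (simp add: mult_le_0_iff)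
    ultimately show False by linarith
  qed
  show "D a \<le> 0" using nonpos[of a] ab by simp
  \<comment> \<open>Now D \<le> 0 throughout, so |D| = - D and the integrating factor has the
    opposite sign. If D a were 0, the product would be squeezed to 0 on the whole interval and D' t0
    = 0, against strictness.\<close>
  let ?E = "\<lambda>t. D t * exp (- L * \<phi> t)"
  have mono: "?E t1 \<le> ?E t2" if "a \<le> t1" "t1 \<le> t2" "t2 \<le> b" for t1 t2
  proof (rule DERIV_nonneg_imp_increasing_open[of t1 t2 ?E])
    show "t1 \<le> t2" using that by simp
    show "continuous_on {t1..t2} ?E"
      using that by (intro continuous_intros continuous_on_subset[OF contD] continuous_on_subset[OF contp]) auto
    fix t assume t: "t1 < t" "t < t2"
    have t': "a < t" "t < b" using t that by auto
    have d: "(?E has_real_derivative (D' t - L * \<phi>' t * D t) * exp (- L * \<phi> t)) (at t)"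
      by (auto intro!: derivative_eq_intros derD[OF t'] derp[OF t'] simp: algebra_simps)
    have "D' t - L * \<phi>' t * D t \<ge> 0"
      using ineq[OF t'] nonpos[of t] t' by (simp add: algebra_simps)
    then show "\<exists>y. (?E has_real_derivative y) (at t) \<and> 0 \<le> y"
      using d by (intro exI[of _ "(D' t - L * \<phi>' t * D t) * exp (- L * \<phi> t)"]) auto
  qed
  assume t0: "t0 \<in> {a<..<b}" and strict: "D' t0 > - L * \<bar>D t0\<bar> * \<phi>' t0"
  show "D a < 0"
  proof (rule ccontr)
    assume "\<not> D a < 0"
    then have "0 \<le> ?E a" by simp
    have E0: "?E t = 0" if t: "a \<le> t" "t \<le> b" for t
    proof -
      have "?E a \<le> ?E t" "?E t \<le> ?E b" using t mono[of a t] mono[of t b] by simp_all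
      moreover have "?E b \<le> 0" using end_le by (simp add: mult_le_0_iff)
      ultimately show ?thesis using \<open>0 \<le> ?E a\<close> by linarith
    qed
    then have D0: "D t = 0" if "a \<le> t" "t \<le> b" for t using that by force
    have "(D has_real_derivative 0) (at t0)"
    proof (rule has_field_derivative_transform_within_open)
      show "((\<lambda>_. 0) has_real_derivative 0) (at t0)" by simp
      show "open {a<..<b}" by simp
    qed (use t0 D0 in auto)
    then have "D' t0 = 0" using derD[of t0] t0 DERIV_unique by auto
    then show False using strict D0[of t0] t0 by simp
  qed
qed

text \<open>dr/d\<phi> for the system z' = f(v) z - v, v' = z with z = r cos \<phi>, v = r sin
  \<phi>: there r' = r f cos^2 and \<phi>' = 1 - f sin cos.\<close>

definition polar_field :: "(real \<Rightarrow> real) \<Rightarrow> real \<Rightarrow> real \<Rightarrow> real" where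
  "polar_field f \<rho> \<phi> =
     \<rho> * (f (\<rho> * sin \<phi>) * (cos \<phi>)\<^sup>2 / (1 - f (\<rho> * sin \<phi>) * (sin \<phi> * cos \<phi>)))"

text \<open>With f 0 = 0 the Lipschitz condition gives |f| \<le> 1/100, which keeps the denominator
  of \<open>polar_field\<close> within 1/100 of 1. The interval is one-sided because both half
  planes are folded onto v \<ge> 0.\<close>

definition tame :: "real \<Rightarrow> real \<Rightarrow> (real \<Rightarrow> real) \<Rightarrow> bool" where
  "tame \<delta> B f \<longleftrightarrow> 0 < \<delta> \<and> 0 \<le> B \<and> B * \<delta> \<le> 1/100 \<and> f 0 = 0 \<and>
     (\<forall>v\<in>{0..\<delta>}. \<forall>w\<in>{0..\<delta>}. \<bar>f v - f w\<bar> \<le> B * \<bar>v - w\<bar>)"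

lemma tame_bound:
  assumes "tame \<delta> B f" "0 \<le> v" "v \<le> \<delta>"
  shows "\<bar>f v\<bar> \<le> B * v" "\<bar>f v\<bar> \<le> 1/100"
proof -
  have "\<forall>v\<in>{0..\<delta>}. \<forall>w\<in>{0..\<delta>}. \<bar>f v - f w\<bar> \<le> B * \<bar>v - w\<bar>" "v \<in> {0..\<delta>}" "0 \<in> {0..\<delta>}"
    using assms unfolding tame_def by auto
  then have "\<bar>f v - f 0\<bar> \<le> B * \<bar>v - 0\<bar>" by blast
  moreover have "f 0 = 0" using assms(1) by (simp add: tame_def)
  ultimately show 1: "\<bar>f v\<bar> \<le> B * v" using assms(2) by (metis abs_of_nonneg diff_zero)
  have "B * v \<le> B * \<delta>" using assms by (intro mult_left_mono) (auto simp: tame_def)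
  then show "\<bar>f v\<bar> \<le> 1/100" using 1 assms by (simp add: tame_def)
qed

lemma abs_sin_cos_le: "\<bar>sin x * cos x\<bar> \<le> (1::real)"
  using mult_mono[of "\<bar>sin x\<bar>" 1 "\<bar>cos x\<bar>" 1] by (simp add: abs_mult)

lemma denominator_bounds:
  fixes f :: real
  assumes "\<bar>f\<bar> \<le> 1/100"
  shows "99/100 \<le> 1 - f * (sin x * cos x)" "1 - f * (sin x * cos x) \<le> 101/100"
proof -
  have "\<bar>f * (sin x * cos x)\<bar> \<le> 1/100 * 1"
    unfolding abs_mult[of f] using assms abs_sin_cos_le by (intro mult_mono) auto
  then show "99/100 \<le> 1 - f * (sin x * cos x)" "1 - f * (sin x * cos x) \<le> 101/100" by linarith+
qed

text \<open>Monotone in \<open>f\<close>: the quotient has \<open>f\<close>-derivative \<open>cos\<^sup>2 / (1 - f sin cos)\<^sup>2\<close>.\<close>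

lemma angular_rate_diff:
  fixes f g x :: real
  assumes "\<bar>f\<bar> \<le> 1/100" "\<bar>g\<bar> \<le> 1/100"
  defines "P \<equiv> (\<lambda>f. f * (cos x)\<^sup>2 / (1 - f * (sin x * cos x)))"
  shows "P f - P g = (f - g) * ((cos x)\<^sup>2 / ((1 - f * (sin x * cos x)) * (1 - g * (sin x * cos x))))"
    and "\<bar>P f - P g\<bar> \<le> 2 * \<bar>f - g\<bar>"
proof -
  define u where "u = 1 - f * (sin x * cos x)"
  define w where "w = 1 - g * (sin x * cos x)"
  have u: "99/100 \<le> u" and w: "99/100 \<le> w"
    using denominator_bounds(1) assms unfolding u_def w_def by blast+
  show eq: "P f - P g = (f - g) * ((cos x)\<^sup>2 / ((1 - f * (sin x * cos x)) * (1 - g * (sin x * cos x))))"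
  proof -
    have "P f - P g = (f * (cos x)\<^sup>2 * w - g * (cos x)\<^sup>2 * u) / (u * w)"
      unfolding P_def u_def[symmetric] w_def[symmetric] using u w by (simp add: field_simps)
    also have "f * (cos x)\<^sup>2 * w - g * (cos x)\<^sup>2 * u = (f - g) * (cos x)\<^sup>2"
      unfolding u_def w_def by (simp add: algebra_simps)
    finally show ?thesis unfolding u_def w_def by simp
  qed
  have uw: "1/2 \<le> u * w" using mult_mono[OF u w] u by auto
  have c1: "(cos x)\<^sup>2 \<le> 1" by (simp add: abs_square_le_1)
  have "(cos x)\<^sup>2 / (u * w) \<le> 2" using uw c1 by (simp add: field_simps)
  moreover have "0 \<le> (cos x)\<^sup>2 / (u * w)" using uw by simp
  ultimately have "\<bar>f - g\<bar> * \<bar>(cos x)\<^sup>2 / (u * w)\<bar> \<le> \<bar>f - g\<bar> * 2"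
    by (intro mult_left_mono) auto
  then show "\<bar>P f - P g\<bar> \<le> 2 * \<bar>f - g\<bar>"
    unfolding eq u_def[symmetric] w_def[symmetric] abs_mult by simp
qed

lemma mult_sin_range:
  assumes "0 \<le> \<rho>" "\<rho> \<le> \<delta>" "0 \<le> \<phi>" "\<phi> \<le> pi"
  shows "0 \<le> \<rho> * sin \<phi>" "\<rho> * sin \<phi> \<le> \<delta>" "\<rho> * sin \<phi> \<le> \<rho>"
proof -
  have "\<rho> * sin \<phi> \<le> \<rho> * 1" using assms by (intro mult_left_mono) auto
  then show "\<rho> * sin \<phi> \<le> \<rho>" "\<rho> * sin \<phi> \<le> \<delta>" using assms by auto
  show "0 \<le> \<rho> * sin \<phi>" using assms by (simp add: sin_ge_zero)
qed

lemma polar_field_rate_bound: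
  assumes "\<bar>f (\<rho> * sin \<phi>)\<bar> \<le> c" "c \<le> 1/100" "0 \<le> \<rho>"
  shows "\<bar>polar_field f \<rho> \<phi>\<bar> \<le> 2 * c * \<rho>"
proof -
  have "\<bar>f (\<rho> * sin \<phi>) * (cos \<phi>)\<^sup>2 / (1 - f (\<rho> * sin \<phi>) * (sin \<phi> * cos \<phi>))\<bar> \<le> 2 * \<bar>f (\<rho> * sin \<phi>)\<bar>"
    using angular_rate_diff(2)[of "f (\<rho> * sin \<phi>)" 0 \<phi>] assms by simp
  also have "\<dots> \<le> 2 * c" using assms by simp
  finally have "\<rho> * \<bar>f (\<rho> * sin \<phi>) * (cos \<phi>)\<^sup>2 / (1 - f (\<rho> * sin \<phi>) * (sin \<phi> * cos \<phi>))\<bar> \<le> \<rho> * (2 * c)"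
    using assms(3) by (intro mult_left_mono) auto
  then show ?thesis unfolding polar_field_def abs_mult[of \<rho>] using assms(3) by (simp add: ac_simps)
qed

lemma polar_field_bound:
  assumes "tame \<delta> B f" "0 \<le> \<rho>" "\<rho> \<le> \<delta>" "0 \<le> \<phi>" "\<phi> \<le> pi"
  shows "\<bar>polar_field f \<rho> \<phi>\<bar> \<le> 2 * B * \<rho> * \<rho>"
proof -
  note r = mult_sin_range[OF assms(2-5)]
  have "\<bar>f (\<rho> * sin \<phi>)\<bar> \<le> B * (\<rho> * sin \<phi>)" using tame_bound(1)[OF assms(1)] r by blast
  also have "\<dots> \<le> B * \<rho>" using assms(1) r by (intro mult_left_mono) (auto simp: tame_def)
  finally have "\<bar>f (\<rho> * sin \<phi>)\<bar> \<le> B * \<rho>" .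
  moreover have "B * \<rho> \<le> B * \<delta>" using assms by (intro mult_left_mono) (auto simp: tame_def)
  then have "B * \<rho> \<le> 1/100" using assms(1) by (simp add: tame_def)
  ultimately show ?thesis using polar_field_rate_bound assms(2) by (metis mult.assoc)
qed

text \<open>The size of the angular quotient contributes 2/100 and the variation of f contributes 2
  B \<delta> \<le> 2/100; 1/20 rounds up the sum.\<close>

lemma polar_field_lipschitz:
  assumes "tame \<delta> B f" "0 \<le> \<rho>" "\<rho> \<le> \<delta>" "0 \<le> \<sigma>" "\<sigma> \<le> \<delta>" "0 \<le> \<phi>" "\<phi> \<le> pi"
  shows "\<bar>polar_field f \<rho> \<phi> - polar_field f \<sigma> \<phi>\<bar> \<le> 1/20 * \<bar>\<rho> - \<sigma>\<bar>"
proof -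
  define P where "P = (\<lambda>y. y * (cos \<phi>)\<^sup>2 / (1 - y * (sin \<phi> * cos \<phi>)))"
  let ?f = "f (\<rho> * sin \<phi>)" and ?g = "f (\<sigma> * sin \<phi>)"
  note r = mult_sin_range[OF assms(2,3,6,7)] and s = mult_sin_range[OF assms(4-7)]
  have B: "0 \<le> B" "B * \<delta> \<le> 1/100" "0 < \<delta>" using assms(1) by (auto simp: tame_def)
  have fb: "\<bar>?f\<bar> \<le> 1/100" "\<bar>?g\<bar> \<le> 1/100" using tame_bound(2)[OF assms(1)] r s by auto
  have "\<bar>?f - ?g\<bar> \<le> B * \<bar>\<rho> * sin \<phi> - \<sigma> * sin \<phi>\<bar>"
    using assms(1) r s unfolding tame_def by auto
  also have "\<bar>\<rho> * sin \<phi> - \<sigma> * sin \<phi>\<bar> = \<bar>\<rho> - \<sigma>\<bar> * \<bar>sin \<phi>\<bar>" by (simp add: abs_mult[symmetric] algebra_simps)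
  also have "B * (\<bar>\<rho> - \<sigma>\<bar> * \<bar>sin \<phi>\<bar>) \<le> B * (\<bar>\<rho> - \<sigma>\<bar> * 1)"
    using B by (intro mult_left_mono) auto
  finally have fd: "\<bar>?f - ?g\<bar> \<le> B * \<bar>\<rho> - \<sigma>\<bar>" by simp
  have Pd: "\<bar>P ?f - P ?g\<bar> \<le> 2 * (B * \<bar>\<rho> - \<sigma>\<bar>)"
    using order_trans[OF angular_rate_diff(2)[OF fb, of \<phi>] mult_left_mono[OF fd]] unfolding P_def by simp
  have Pf: "\<bar>P ?f\<bar> \<le> 2 * (1/100)"
    using order_trans[OF angular_rate_diff(2)[of ?f 0 \<phi>], of "2 * (1/100)"] fb unfolding P_def by simp
  have "polar_field f \<rho> \<phi> - polar_field f \<sigma> \<phi> = (\<rho> - \<sigma>) * P ?f + \<sigma> * (P ?f - P ?g)"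
  proof -
    have "polar_field f \<rho> \<phi> = \<rho> * P ?f" "polar_field f \<sigma> \<phi> = \<sigma> * P ?g"
      unfolding polar_field_def P_def by (rule refl)+
    then show ?thesis by (simp add: algebra_simps)
  qed
  also have "\<bar>\<dots>\<bar> \<le> \<bar>\<rho> - \<sigma>\<bar> * \<bar>P ?f\<bar> + \<sigma> * \<bar>P ?f - P ?g\<bar>"
    using assms(4) by (simp add: abs_mult[symmetric] order_trans[OF abs_triangle_ineq])
       (metis abs_mult abs_of_nonneg abs_triangle_ineq)
  also have "\<dots> \<le> \<bar>\<rho> - \<sigma>\<bar> * (2 * (1/100)) + \<delta> * (2 * (B * \<bar>\<rho> - \<sigma>\<bar>))"
    using Pf Pd assms B by (intro add_mono mult_mono) auto
  also have "\<dots> = \<bar>\<rho> - \<sigma>\<bar> * (2/100) + 2 * (B * \<delta>) * \<bar>\<rho> - \<sigma>\<bar>" by (simp add: algebra_simps)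
  also have "\<dots> \<le> \<bar>\<rho> - \<sigma>\<bar> * (2/100) + 2 * (1/100) * \<bar>\<rho> - \<sigma>\<bar>"
    using B by (intro add_left_mono mult_right_mono) auto
  also have "\<dots> \<le> 1/20 * \<bar>\<rho> - \<sigma>\<bar>" by simp
  finally show ?thesis .
qed

text \<open>The slope of the angular quotient in f is a positive multiple of cos^2, so strictness is
  lost at the angle pi/2.\<close>

lemma polar_field_mono:
  assumes "\<bar>f (\<rho> * sin \<phi>)\<bar> \<le> 1/100" "\<bar>g (\<rho> * sin \<phi>)\<bar> \<le> 1/100" "0 < \<rho>"
  shows "g (\<rho> * sin \<phi>) \<le> f (\<rho> * sin \<phi>) \<Longrightarrow> polar_field g \<rho> \<phi> \<le> polar_field f \<rho> \<phi>"
    and "g (\<rho> * sin \<phi>) < f (\<rho> * sin \<phi>) \<Longrightarrow> cos \<phi> \<noteq> 0 \<Longrightarrow> polar_field g \<rho> \<phi> < polar_field f \<rho> \<phi>"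
proof -
  let ?f = "f (\<rho> * sin \<phi>)" and ?g = "g (\<rho> * sin \<phi>)"
  define K where "K = (cos \<phi>)\<^sup>2 / ((1 - ?f * (sin \<phi> * cos \<phi>)) * (1 - ?g * (sin \<phi> * cos \<phi>)))"
  have eq: "polar_field f \<rho> \<phi> - polar_field g \<rho> \<phi> = \<rho> * ((?f - ?g) * K)"
    using angular_rate_diff(1)[OF assms(1,2), of \<phi>]
    unfolding polar_field_def K_def right_diff_distrib[of \<rho>, symmetric] by (rule arg_cong)
  have pos: "(1 - ?f * (sin \<phi> * cos \<phi>)) * (1 - ?g * (sin \<phi> * cos \<phi>)) > 0"
    using denominator_bounds(1)[OF assms(1)] denominator_bounds(1)[OF assms(2)]
    by (intro mult_pos_pos) (metis less_le_trans zero_less_divide_iff zero_less_numeral)+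
  have K0: "K \<ge> 0" unfolding K_def using pos by simp
  show "?g \<le> ?f \<Longrightarrow> polar_field g \<rho> \<phi> \<le> polar_field f \<rho> \<phi>"
    using eq K0 assms(3) by (smt (verit) mult_nonneg_nonneg)
  assume lt: "?g < ?f" and c: "cos \<phi> \<noteq> 0"
  have "K > 0" unfolding K_def using pos c by simp
  then show "polar_field g \<rho> \<phi> < polar_field f \<rho> \<phi>"
    using eq lt assms(3) by (smt (verit) mult_pos_pos)
qed

text \<open>The clock is arbitrary: dA/dt > 0 and dR/dA = \<open>polar_field\<close> are recorded,
  so that upper arcs and reflected, reversed lower arcs fall under one notion. Derivatives are asked
  for in the interior, where arccos is differentiable; at angles 0 and pi it is not.\<close>

definition polar_curve :: "(real \<Rightarrow> real) \<Rightarrow> (real \<Rightarrow> real) \<Rightarrow> (real \<Rightarrow> real) \<Rightarrow> real \<Rightarrow> real \<Rightarrow> bool" where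
  "polar_curve f R A a b \<longleftrightarrow> a < b \<and> continuous_on {a..b} R \<and> continuous_on {a..b} A \<and>
     (\<forall>t\<in>{a..b}. 0 < R t \<and> 0 \<le> A t \<and> A t \<le> pi) \<and>
     (\<forall>t\<in>{a<..<b}. 0 < A t \<and> A t < pi \<and>
        (\<exists>\<omega>>0. (A has_real_derivative \<omega>) (at t) \<and>
               (R has_real_derivative polar_field f (R t) (A t) * \<omega>) (at t)))"

lemma polar_curve_ratio:
  assumes pc: "polar_curve f R A a b"
    and small: "\<And>t. a < t \<Longrightarrow> t < b \<Longrightarrow> \<bar>f (R t * sin (A t))\<bar> \<le> 1/100"
  shows "R a \<le> 3 * R b" "R b \<le> 3 * R a"
proof -
  have ab: "a < b" and contR: "continuous_on {a..b} R" and contA: "continuous_on {a..b} A"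
    and rng: "\<And>t. t \<in> {a..b} \<Longrightarrow> 0 < R t \<and> 0 \<le> A t \<and> A t \<le> pi"
    using pc by (auto simp: polar_curve_def)
  \<comment> \<open>|d ln R / dA| \<le> 1/50, so A/50 + ln R and A/50 - ln R are both nondecreasing.
    The total angle is at most pi < 4, hence ln R varies by less than 1 < ln 3.\<close>
  have mono: "c * A a / 50 + s * ln (R a) \<le> c * A b / 50 + s * ln (R b)"
    if cs: "c = 1" "s = 1 \<or> s = -1" for c s :: real
  proof (rule DERIV_nonneg_imp_increasing_open[of a b "\<lambda>t. c * A t / 50 + s * ln (R t)"])
    show "a \<le> b" using ab by simp
    show "continuous_on {a..b} (\<lambda>t. c * A t / 50 + s * ln (R t))"
      using rng by (intro continuous_intros contA contR) force+
    fix t assume t: "a < t" "t < b"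
    then obtain \<omega> where \<omega>: "\<omega> > 0" and dA: "(A has_real_derivative \<omega>) (at t)"
      and dR: "(R has_real_derivative polar_field f (R t) (A t) * \<omega>) (at t)"
      using pc unfolding polar_curve_def by (metis greaterThanLessThan_iff)
    have Rt: "0 < R t" using rng t by auto
    have "\<bar>polar_field f (R t) (A t)\<bar> \<le> 2 * (1/100) * R t"
      using polar_field_rate_bound[of f "R t" "A t" "1/100"] small[OF t] Rt by simp
    then have "polar_field f (R t) (A t) / R t \<le> 1/50" "- (1/50) \<le> polar_field f (R t) (A t) / R t"
      using Rt by (auto simp: field_simps)
    then have "0 \<le> c / 50 + s * (polar_field f (R t) (A t) / R t)" using cs by auto
    then have "0 \<le> (c / 50 + s * (polar_field f (R t) (A t) / R t)) * \<omega>" using \<omega> by simp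
    moreover have "((\<lambda>t. c * A t / 50 + s * ln (R t)) has_real_derivative
        (c / 50 + s * (polar_field f (R t) (A t) / R t)) * \<omega>) (at t)"
      using Rt by (auto intro!: derivative_eq_intros dA dR simp: field_simps)
    ultimately show "\<exists>y. ((\<lambda>t. c * A t / 50 + s * ln (R t)) has_real_derivative y) (at t) \<and> 0 \<le> y"
      by blast
  qed
  have A: "0 \<le> A a" "A b \<le> pi" and R: "0 < R a" "0 < R b" using rng ab by auto
  have e3: "1 < ln (3::real)"
    using ln_less_cancel_iff[of "exp 1" 3] e_less_272 by simp
  have "ln (R a) - ln (R b) \<le> 1" "ln (R b) - ln (R a) \<le> 1"
    using mono[of 1 1] mono[of 1 "-1"] A pi_less_4 by auto
  then have "ln (R a) \<le> ln (3 * R b)" "ln (R b) \<le> ln (3 * R a)"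
    using e3 R by (auto simp: ln_mult)
  then show "R a \<le> 3 * R b" "R b \<le> 3 * R a" using R by auto
qed

definition polar_solution :: "(real \<Rightarrow> real) \<Rightarrow> real \<Rightarrow> (real \<Rightarrow> real) \<Rightarrow> bool" where
  "polar_solution f \<delta> r \<longleftrightarrow>
     (\<forall>\<phi>\<in>{0..pi}. 0 < r \<phi> \<and> r \<phi> \<le> \<delta> \<and>
        (r has_real_derivative polar_field f (r \<phi>) \<phi>) (at \<phi> within {0..pi}))"

lemma polar_solution_at:
  assumes "polar_solution f \<delta> r" "0 < \<phi>" "\<phi> < pi"
  shows "(r has_real_derivative polar_field f (r \<phi>) \<phi>) (at \<phi>)"
  using assms at_within_Icc_at[of 0 \<phi> pi] unfolding polar_solution_def
  by (metis atLeastAtMost_iff less_imp_le)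

lemma polar_solution_continuous:
  assumes "polar_solution f \<delta> r"
  shows "continuous_on {0..pi} r"
  using assms unfolding polar_solution_def
  by (meson DERIV_continuous continuous_on_eq_continuous_within)

text \<open>Inserting the angle A of the curve into r compares two radii at the same angle, whatever
  the clock of the curve. The Lipschitz bound for g then turns the difference into a case of
  \<open>zero_of_differential_inequality\<close>, with A in the place of \<phi>.\<close>

lemma polar_curve_difference:
  assumes pc: "polar_curve f R A a b" and sol: "polar_solution g \<delta> r" and tg: "tame \<delta> C g"
    and Rle: "\<And>t. t \<in> {a..b} \<Longrightarrow> R t < \<delta>"
  obtains w where "\<And>t. a < t \<Longrightarrow> t < b \<Longrightarrow> 0 < w t"
    "\<And>t. a < t \<Longrightarrow> t < b \<Longrightarrow> (A has_real_derivative w t) (at t)"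
    "\<And>t. a < t \<Longrightarrow> t < b \<Longrightarrow> ((\<lambda>t. R t - r (A t)) has_real_derivative
       (polar_field f (R t) (A t) - polar_field g (r (A t)) (A t)) * w t) (at t)"
    "continuous_on {a..b} (\<lambda>t. R t - r (A t))"
    "\<And>t. a < t \<Longrightarrow> t < b \<Longrightarrow>
       \<bar>polar_field g (R t) (A t) - polar_field g (r (A t)) (A t)\<bar> \<le> 1/20 * \<bar>R t - r (A t)\<bar>"
proof -
  have contR: "continuous_on {a..b} R" and contA: "continuous_on {a..b} A"
    and rng: "\<And>t. t \<in> {a..b} \<Longrightarrow> 0 < R t \<and> 0 \<le> A t \<and> A t \<le> pi"
    and rng': "\<And>t. t \<in> {a<..<b} \<Longrightarrow> 0 < A t \<and> A t < pi"
    using pc by (auto simp: polar_curve_def)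
  have "\<forall>t. \<exists>\<omega>. t \<in> {a<..<b} \<longrightarrow> \<omega> > 0 \<and> (A has_real_derivative \<omega>) (at t) \<and>
               (R has_real_derivative polar_field f (R t) (A t) * \<omega>) (at t)"
    using pc unfolding polar_curve_def by meson
  then obtain w where w: "\<And>t. t \<in> {a<..<b} \<Longrightarrow> w t > 0 \<and> (A has_real_derivative w t) (at t) \<and>
               (R has_real_derivative polar_field f (R t) (A t) * w t) (at t)"
    by metis
  show ?thesis
  proof (rule that[of w])
    fix t assume "a < t" "t < b"
    then have t: "t \<in> {a<..<b}" "t \<in> {a..b}" by auto
    show "0 < w t" "(A has_real_derivative w t) (at t)" using w[OF t(1)] by auto
    have "((\<lambda>t. r (A t)) has_real_derivative polar_field g (r (A t)) (A t) * w t) (at t)"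
      by (rule DERIV_chain2[OF polar_solution_at[OF sol]]) (use w[OF t(1)] rng'[OF t(1)] in auto)
    then show "((\<lambda>t. R t - r (A t)) has_real_derivative
       (polar_field f (R t) (A t) - polar_field g (r (A t)) (A t)) * w t) (at t)"
      using w[OF t(1)] by (auto intro!: derivative_eq_intros simp: algebra_simps)
    show "\<bar>polar_field g (R t) (A t) - polar_field g (r (A t)) (A t)\<bar> \<le> 1/20 * \<bar>R t - r (A t)\<bar>"
      using rng[OF t(2)] Rle[OF t(2)] sol unfolding polar_solution_def
      by (intro polar_field_lipschitz[OF tg]) (auto intro: less_imp_le)
  next
    show "continuous_on {a..b} (\<lambda>t. R t - r (A t))"
      by (intro continuous_intros contR continuous_on_compose2[OF polar_solution_continuous[OF sol] contA])
         (use rng in auto)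
  qed
qed

text \<open>A larger f makes the radius grow faster with the angle. Read backwards from the end: the
  curve that ends no farther out must have started strictly farther in.\<close>

lemma polar_comparison:
  assumes pc: "polar_curve f R A a b" and sol: "polar_solution g \<delta> r"
    and tf: "tame \<delta> B f" and tg: "tame \<delta> C g"
    and less: "\<And>v. 0 < v \<Longrightarrow> v < \<delta> \<Longrightarrow> g v < f v"
    and Rle: "\<And>t. t \<in> {a..b} \<Longrightarrow> R t < \<delta>"
    and end_le: "R b \<le> r (A b)"
  shows "R a < r (A a)"
proof -
  have ab: "a < b" and contA: "continuous_on {a..b} A"
    and rng: "\<And>t. t \<in> {a..b} \<Longrightarrow> 0 < R t \<and> 0 \<le> A t \<and> A t \<le> pi"
    and rng': "\<And>t. t \<in> {a<..<b} \<Longrightarrow> 0 < A t \<and> A t < pi"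
    using pc by (auto simp: polar_curve_def)
  obtain w where w: "\<And>t. a < t \<Longrightarrow> t < b \<Longrightarrow> 0 < w t"
    and derA: "\<And>t. a < t \<Longrightarrow> t < b \<Longrightarrow> (A has_real_derivative w t) (at t)"
    and derD: "\<And>t. a < t \<Longrightarrow> t < b \<Longrightarrow> ((\<lambda>t. R t - r (A t)) has_real_derivative
       (polar_field f (R t) (A t) - polar_field g (r (A t)) (A t)) * w t) (at t)"
    and contD: "continuous_on {a..b} (\<lambda>t. R t - r (A t))"
    and lip: "\<And>t. a < t \<Longrightarrow> t < b \<Longrightarrow>
       \<bar>polar_field g (R t) (A t) - polar_field g (r (A t)) (A t)\<bar> \<le> 1/20 * \<bar>R t - r (A t)\<bar>"
    by (rule polar_curve_difference[OF pc sol tg Rle], assumption, rule that)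
  have range: "0 < R t * sin (A t)" "R t * sin (A t) < \<delta>" if "a < t" "t < b" for t
  proof -
    have t: "t \<in> {a<..<b}" "t \<in> {a..b}" using that by auto
    have "R t * sin (A t) \<le> R t * 1" using rng[OF t(2)] by (intro mult_left_mono) auto
    then show "R t * sin (A t) < \<delta>" using Rle[OF t(2)] by simp
    show "0 < R t * sin (A t)" using rng[OF t(2)] rng'[OF t(1)] by (simp add: sin_gt_zero)
  qed
  have bounds: "\<bar>f (R t * sin (A t))\<bar> \<le> 1/100" "\<bar>g (R t * sin (A t))\<bar> \<le> 1/100" "0 < R t"
    if "a < t" "t < b" for t
    using range[OF that] tame_bound(2)[OF tf] tame_bound(2)[OF tg] rng[of t] that by auto
  have mono: "polar_field g (R t) (A t) \<le> polar_field f (R t) (A t)" if "a < t" "t < b" for t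
    by (rule polar_field_mono(1)[of f "R t" "A t" g, OF bounds[OF that] less_imp_le[OF less[OF range[OF that]]]])
  have ineq: "- (1/20) * \<bar>R t - r (A t)\<bar> * w t \<le> (polar_field f (R t) (A t) - polar_field g (r (A t)) (A t)) * w t"
    if t: "a < t" "t < b" for t
  proof (rule mult_right_mono)
    show "- (1/20) * \<bar>R t - r (A t)\<bar> \<le> polar_field f (R t) (A t) - polar_field g (r (A t)) (A t)"
      using lip[OF t] mono[OF t] by linarith
  qed (use w[OF t] in simp)
  \<comment> \<open>Strict growth fails where cos (A t) = 0. Two times are tried; A is strictly
    increasing, so at most one of them can have the angle pi/2.\<close>
  define t1 where "t1 = (a + b) / 2"
  define t2 where "t2 = (3 * a + b) / 4"
  have t12: "a < t1" "t1 < b" "a < t2" "t2 < b" "t2 < t1" using ab by (auto simp: t1_def t2_def field_simps)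
  have "A t2 < A t1"
  proof (rule DERIV_pos_imp_increasing_open[OF t12(5)])
    show "\<exists>y. (A has_real_derivative y) (at x) \<and> y > 0" if "t2 < x" "x < t1" for x
      using w[of x] derA[of x] that t12 by auto
    show "continuous_on {t2..t1} A" using contA t12 by (auto intro: continuous_on_subset)
  qed
  moreover have "A t1 = A t2" if "cos (A t1) = 0" "cos (A t2) = 0"
    using that cos_inj_pi[of "A t1" "A t2"] rng[of t1] rng[of t2] t12 by auto
  ultimately have "cos (A t1) \<noteq> 0 \<or> cos (A t2) \<noteq> 0" by auto
  then obtain t0 where t0: "a < t0" "t0 < b" "cos (A t0) \<noteq> 0" using t12 by blast
  have "polar_field g (R t0) (A t0) < polar_field f (R t0) (A t0)"
    by (rule polar_field_mono(2)[of f "R t0" "A t0" g, OF bounds[OF t0(1,2)] less[OF range[OF t0(1,2)]] t0(3)])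
  then have "- (1/20) * \<bar>R t0 - r (A t0)\<bar> < polar_field f (R t0) (A t0) - polar_field g (r (A t0)) (A t0)"
    using lip[OF t0(1,2)] by linarith
  then have "- (1/20) * \<bar>R t0 - r (A t0)\<bar> * w t0 < (polar_field f (R t0) (A t0) - polar_field g (r (A t0)) (A t0)) * w t0"
    using w[OF t0(1,2)] by (rule mult_strict_right_mono)
  then have "R a - r (A a) < 0"
    by (intro zero_of_differential_inequality(2)[OF ab _ contD contA derD derA, of "1/20" t0])
       (use w ineq end_le t0 in \<open>auto simp: less_imp_le\<close>)
  then show ?thesis by simp
qed

text \<open>For the same f, the order at the end angle is kept at the starting angle: the
  differential inequality applies to r o A - R, its error term being the Lipschitz bound
  alone.\<close>

lemma polar_curve_above_solution:
  assumes pc: "polar_curve f R A a b" and sol: "polar_solution f \<delta> r" and tf: "tame \<delta> B f"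
    and Rle: "\<And>t. t \<in> {a..b} \<Longrightarrow> R t < \<delta>"
    and end_le: "r (A b) \<le> R b"
  shows "r (A a) \<le> R a"
proof -
  have ab: "a < b" and contA: "continuous_on {a..b} A" using pc by (auto simp: polar_curve_def)
  obtain w where w: "\<And>t. a < t \<Longrightarrow> t < b \<Longrightarrow> 0 < w t"
    and derA: "\<And>t. a < t \<Longrightarrow> t < b \<Longrightarrow> (A has_real_derivative w t) (at t)"
    and derD: "\<And>t. a < t \<Longrightarrow> t < b \<Longrightarrow> ((\<lambda>t. R t - r (A t)) has_real_derivative
       (polar_field f (R t) (A t) - polar_field f (r (A t)) (A t)) * w t) (at t)"
    and contD: "continuous_on {a..b} (\<lambda>t. R t - r (A t))"
    and lip: "\<And>t. a < t \<Longrightarrow> t < b \<Longrightarrow>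
       \<bar>polar_field f (R t) (A t) - polar_field f (r (A t)) (A t)\<bar> \<le> 1/20 * \<bar>R t - r (A t)\<bar>"
    by (rule polar_curve_difference[OF pc sol tf Rle], assumption, rule that)
  have ineq: "- (1/20) * \<bar>- (R t - r (A t))\<bar> * w t
      \<le> - ((polar_field f (R t) (A t) - polar_field f (r (A t)) (A t)) * w t)" if t: "a < t" "t < b" for t
  proof -
    have "- (1/20) * \<bar>- (R t - r (A t))\<bar> \<le> - (polar_field f (R t) (A t) - polar_field f (r (A t)) (A t))"
      unfolding abs_minus_cancel using lip[OF t] by linarith
    then show ?thesis
      unfolding mult_minus_left[symmetric] using w[OF t] by (intro mult_right_mono) auto
  qed
  have "- (R a - r (A a)) \<le> 0"
    by (rule zero_of_differential_inequality(1)[OF ab _ continuous_on_minus[OF contD] contA DERIV_minus[OF derD] derA, of "1/20"])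
       (use w ineq end_le in \<open>auto simp: less_imp_le\<close>)
  then show ?thesis by simp
qed

section \<open>Existence of polar solutions over a whole half turn\<close>

lemma continuous_polar_field:
  fixes r p :: "real \<Rightarrow> real"
  assumes t: "tame \<delta> B f"
    and cr: "continuous_on S r" and cp: "continuous_on S p"
    and rng: "\<And>s. s \<in> S \<Longrightarrow> 0 \<le> r s \<and> r s \<le> \<delta> \<and> 0 \<le> p s \<and> p s \<le> pi"
  shows "continuous_on S (\<lambda>s. polar_field f (r s) (p s))"
proof -
  have "B-lipschitz_on {0..\<delta>} f"
    using t by (auto simp: tame_def lipschitz_on_def dist_real_def)
  then have cf: "continuous_on {0..\<delta>} f" by (rule lipschitz_on_continuous_on)
  have r: "r s * sin (p s) \<in> {0..\<delta>}" if "s \<in> S" for s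
    using mult_sin_range[of "r s" \<delta> "p s"] rng[OF that] by auto
  have sc: "continuous_on S (\<lambda>s. sin (p s))" "continuous_on S (\<lambda>s. cos (p s))"
    using continuous_on_sin[OF cp] continuous_on_cos[OF cp] .
  have cfr: "continuous_on S (\<lambda>s. f (r s * sin (p s)))"
    by (intro continuous_on_compose2[OF cf] continuous_intros cr sc) (use r in auto)
  have ne: "1 - f (r s * sin (p s)) * (sin (p s) * cos (p s)) \<noteq> 0" if "s \<in> S" for s
    using denominator_bounds(1)[of "f (r s * sin (p s))" "p s"] tame_bound(2)[OF t, of "r s * sin (p s)"] r[OF that]
    by auto
  show ?thesis
    unfolding polar_field_def using ne by (intro continuous_intros cfr cr sc) auto
qed

text \<open>For \<open>B * \<delta> \<le> 1/100\<close> the Picard operator is a contraction on all of \<open>[0, \<pi>]\<close>, whatever the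
  angle at which the initial value is prescribed.\<close>

lemma polar_solution_exists:
  assumes t: "tame \<delta> B f" and r0: "0 < r0" "r0 \<le> \<delta> / 2" and p0: "0 \<le> p0" "p0 \<le> pi"
  obtains r where "polar_solution f \<delta> r" "r p0 = r0"
    "\<And>\<phi>. \<phi> \<in> {0..pi} \<Longrightarrow> r0 / 2 \<le> r \<phi>" "\<And>\<phi>. \<phi> \<in> {0..pi} \<Longrightarrow> r \<phi> \<le> 3 / 2 * r0"
proof -
  have \<delta>: "0 < \<delta>" "0 \<le> B" "B * \<delta> \<le> 1/100" using t by (auto simp: tame_def)
  \<comment> \<open>Clamping the radius to [0, \<delta>] and the angle to [0, pi] lets the operator
    act on all bounded continuous functions on the real line. The bounds below show that the clamp
    on the radius is inactive at the fixed point.\<close>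
  define k where "k = (\<lambda>x. max 0 (min \<delta> x))"
  define q where "q = (\<lambda>x::real. max 0 (min pi x))"
  have k: "0 \<le> k x" "k x \<le> \<delta>" "\<bar>k x - k y\<bar> \<le> \<bar>x - y\<bar>" "k x \<le> \<bar>x\<bar>" for x y
    using \<delta> by (auto simp: k_def)
  have q: "0 \<le> q x" "q x \<le> pi" "q x \<in> {0..pi}" for x by (auto simp: q_def)
  define F where "F = (\<lambda>u s. polar_field f (k (u s)) s)"
  have Fcont: "continuous_on {0..pi} (F u)" if "continuous_on UNIV u" for u
    unfolding F_def k_def
    by (intro continuous_polar_field[OF t] continuous_intros continuous_on_subset[OF that]) (use \<delta> in auto)
  have Fint: "F u integrable_on {0..x}" if "continuous_on UNIV u" "x \<le> pi" for u x
    by (rule integrable_continuous_interval, rule continuous_on_subset[OF Fcont[OF that(1)]]) (use that in auto)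
  define I where "I = (\<lambda>u x. integral {0..x} (F u))"
  have Ider: "(I u has_real_derivative F u x) (at x within {0..pi})"
    if "continuous_on UNIV u" "x \<in> {0..pi}" for u x
    unfolding I_def by (rule integral_has_real_derivative[OF Fcont[OF that(1)] that(2)])
  have Icont: "continuous_on {0..pi} (I u)" if "continuous_on UNIV u" for u
    using Ider[OF that] by (meson DERIV_continuous continuous_on_eq_continuous_within)
  have Idiff: "\<bar>(I u x - I u y) - (I w x - I w y)\<bar> \<le> M * \<bar>x - y\<bar>"
    if u: "continuous_on UNIV u" "continuous_on UNIV w" and xy: "x \<in> {0..pi}" "y \<in> {0..pi}"
      and M: "\<And>s. s \<in> {0..pi} \<Longrightarrow> \<bar>F u s - F w s\<bar> \<le> M" for u w x y M
  proof -
    have "norm ((I u x - I w x) - (I u y - I w y)) \<le> M * norm (x - y)"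
    proof (rule field_differentiable_bound[of "{0..pi}" "\<lambda>x. I u x - I w x" "\<lambda>s. F u s - F w s"])
      show "((\<lambda>x. I u x - I w x) has_field_derivative F u z - F w z) (at z within {0..pi})"
        if "z \<in> {0..pi}" for z
        by (intro DERIV_diff Ider u that)
    qed (use xy M in auto)
    then show ?thesis by (simp add: algebra_simps)
  qed
  define P where "P = (\<lambda>u x. r0 + (I u (q x) - I u p0))"
  have Pcont: "continuous_on UNIV (P u)" if "continuous_on UNIV u" for u
    unfolding P_def
    by (intro continuous_intros continuous_on_compose2[OF Icont[OF that]])
       (auto simp: q_def intro!: continuous_intros)
  have F0: "F (\<lambda>_. 0) s = 0" for s unfolding F_def k_def polar_field_def using \<delta> by simp
  have I0: "I (\<lambda>_. 0) x = 0" for x unfolding I_def F0 by simp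
  have p0': "p0 \<in> {0..pi}" using p0 by simp
  have dist_q: "\<bar>q x - p0\<bar> \<le> 4" for x using q[of x] p0 pi_less_4 by auto
  have Fbound: "\<bar>F u s\<bar> \<le> 1/50 * M" if "\<bar>u s\<bar> \<le> M" "s \<in> {0..pi}" for u s M
  proof -
    have "\<bar>F u s\<bar> \<le> 2 * B * k (u s) * k (u s)"
      unfolding F_def by (intro polar_field_bound[OF t]) (use that k in auto)
    also have "\<dots> = 2 * (B * k (u s)) * k (u s)" by simp
    also have "\<dots> \<le> 2 * (B * \<delta>) * M"
      using k[of "u s"] that \<delta> by (intro mult_mono mult_left_mono mult_nonneg_nonneg) auto
    also have "\<dots> \<le> 2 * (1/100) * M" using that \<delta> by (intro mult_right_mono) auto
    finally show ?thesis by simp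
  qed
  \<comment> \<open>Comparison with the zero function, on which F vanishes. At the fixed point u it
    yields norm u \<le> r0 + 4/50 norm u, hence norm u \<le> 2 r0 and |r - r0| \<le> 8/50 r0 < r0 /
    2.\<close>
  have Pclose: "\<bar>P u x - r0\<bar> \<le> 4/50 * M" if u: "continuous_on UNIV u" and M: "\<And>s. \<bar>u s\<bar> \<le> M" for u x M
  proof -
    have M0: "0 \<le> M" using M[of 0] by linarith
    have "\<bar>(I u (q x) - I u p0) - (I (\<lambda>_. 0) (q x) - I (\<lambda>_. 0) p0)\<bar> \<le> (1/50 * M) * \<bar>q x - p0\<bar>"
      by (rule Idiff[OF u _ q(3) p0']) (use Fbound M F0 in auto)
    also have "\<dots> \<le> (1/50 * M) * 4" using M0 dist_q[of x] by (intro mult_left_mono) auto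
    finally show ?thesis by (simp add: I0 P_def)
  qed
  have Pb: "P (apply_bcontfun u) \<in> bcontfun" for u
  proof (rule bcontfun_normI)
    show "continuous_on UNIV (P (apply_bcontfun u))" by (intro Pcont continuous_on_apply_bcontfun)
    show "norm (P (apply_bcontfun u) x) \<le> r0 + 4/50 * norm u" for x
    proof -
      have "\<bar>P (apply_bcontfun u) x - r0\<bar> \<le> 4/50 * norm u"
        using norm_bounded[of u] by (intro Pclose continuous_on_apply_bcontfun) auto
      then have "\<bar>P (apply_bcontfun u) x\<bar> \<le> r0 + 4/50 * norm u" using r0(1) by arith
      then show ?thesis by simp
    qed
  qed
  define T where "T = (\<lambda>u. Bcontfun (P (apply_bcontfun u)))"
  have T: "apply_bcontfun (T u) = P (apply_bcontfun u)" for u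
    unfolding T_def by (rule Bcontfun_inverse[OF Pb])
  have "dist (T u) (T w) \<le> 1/2 * dist u w" for u w
  proof (rule dist_bound)
    fix x
    have "\<bar>F (apply_bcontfun u) s - F (apply_bcontfun w) s\<bar> \<le> 1/20 * dist u w" if s: "s \<in> {0..pi}" for s
    proof -
      have "\<bar>F (apply_bcontfun u) s - F (apply_bcontfun w) s\<bar> \<le> 1/20 * \<bar>k (apply_bcontfun u s) - k (apply_bcontfun w s)\<bar>"
        unfolding F_def using k s by (intro polar_field_lipschitz[OF t]) auto
      also have "\<dots> \<le> 1/20 * dist (apply_bcontfun u s) (apply_bcontfun w s)"
        using k by (auto simp: dist_real_def)
      also have "\<dots> \<le> 1/20 * dist u w" using dist_bounded[of u s w] by simp
      finally show ?thesis .
    qed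
    then have "\<bar>(I (apply_bcontfun u) (q x) - I (apply_bcontfun u) p0) -
       (I (apply_bcontfun w) (q x) - I (apply_bcontfun w) p0)\<bar> \<le> (1/20 * dist u w) * \<bar>q x - p0\<bar>"
      by (intro Idiff continuous_on_apply_bcontfun q p0')
    also have "\<dots> \<le> (1/20 * dist u w) * 4" using dist_q[of x] by (intro mult_left_mono) auto
    also have "\<dots> \<le> 1/2 * dist u w" by (simp add: field_simps)
    finally show "dist (apply_bcontfun (T u) x) (apply_bcontfun (T w) x) \<le> 1/2 * dist u w"
      unfolding T P_def dist_real_def by simp
  qed
  then obtain u where u: "T u = u"
    using banach_fix_type[of "1/2" T] by auto
  define r where "r = apply_bcontfun u"
  have fix_r: "r x = P r x" for x unfolding r_def using T[of u] u by simp
  have rcont: "continuous_on UNIV r" unfolding r_def by simp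
  have close: "\<bar>r x - r0\<bar> \<le> 4/50 * norm u" for x
    using Pclose[OF rcont, of "norm u" x] norm_bounded[of u] fix_r[of x] unfolding r_def by auto
  have "norm u \<le> r0 + 4/50 * norm u"
  proof (rule norm_bound)
    show "norm (apply_bcontfun u x) \<le> r0 + 4/50 * norm u" for x
    proof -
      have "\<bar>r x\<bar> \<le> r0 + 4/50 * norm u" using close[of x] r0(1) by arith
      then show ?thesis unfolding r_def by simp
    qed
  qed
  then have nu: "norm u \<le> 2 * r0" using r0(1) by linarith
  have bounds: "r0 / 2 \<le> r x" "r x \<le> 3 / 2 * r0" for x
    using close[of x] nu r0(1) by arith+
  have eqr: "r x = r0 + (I r x - I r p0)" if "x \<in> {0..pi}" for x
  proof -
    have "q x = x" using that unfolding q_def by auto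
    then show ?thesis using fix_r[of x] unfolding P_def by simp
  qed
  have der: "(r has_real_derivative polar_field f (r x) x) (at x within {0..pi})" if x: "x \<in> {0..pi}" for x
  proof (rule has_field_derivative_transform_within[OF _ zero_less_one x])
    show "\<And>y. y \<in> {0..pi} \<Longrightarrow> dist y x < 1 \<Longrightarrow> r0 + (I r y - I r p0) = r y" using eqr by simp
    have "k (r x) = r x" using bounds[of x] r0 by (auto simp: k_def)
    then have "F r x = polar_field f (r x) x" by (simp add: F_def)
    then show "((\<lambda>y. r0 + (I r y - I r p0)) has_real_derivative polar_field f (r x) x) (at x within {0..pi})"
      using Ider[OF rcont x] by (auto intro!: derivative_eq_intros)
  qed
  show ?thesis
  proof (rule that[of r])
    show "polar_solution f \<delta> r"
      unfolding polar_solution_def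
    proof (intro ballI conjI)
      fix \<phi> assume "\<phi> \<in> {0..pi}"
      show "0 < r \<phi>" "r \<phi> \<le> \<delta>" using bounds[of \<phi>] r0 by auto
    qed (rule der)
    show "r p0 = r0" using eqr[OF p0'] by simp
  qed (use bounds in auto)
qed

section \<open>Lienard coordinates for the half systems\<close>

definition polar_radius :: "(real \<Rightarrow> real) \<Rightarrow> (real \<Rightarrow> real) \<Rightarrow> real \<Rightarrow> real" where
  "polar_radius z v t = sqrt ((z t)\<^sup>2 + (v t)\<^sup>2)"

text \<open>On v \<ge> 0 the angle is determined by its cosine, so arccos is a continuous branch on
  the closed half plane without the origin.\<close>

definition polar_angle :: "(real \<Rightarrow> real) \<Rightarrow> (real \<Rightarrow> real) \<Rightarrow> real \<Rightarrow> real" where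
  "polar_angle z v t = arccos (z t / polar_radius z v t)"

text \<open>The factor \<mu> > 0 absorbs any change of time and cancels in dR/dA; the bound on f
  makes the angle increase.\<close>

lemma lienard_polar_curve:
  fixes z v f :: "real \<Rightarrow> real"
  assumes ab: "a < b" and cz: "continuous_on {a..b} z" and cv: "continuous_on {a..b} v"
    and v0: "\<And>t. t \<in> {a..b} \<Longrightarrow> 0 \<le> v t"
    and ne: "\<And>t. t \<in> {a..b} \<Longrightarrow> z t \<noteq> 0 \<or> v t \<noteq> 0"
    and vpos: "\<And>t. t \<in> {a<..<b} \<Longrightarrow> 0 < v t"
    and small: "\<And>t. t \<in> {a<..<b} \<Longrightarrow> \<bar>f (v t)\<bar> \<le> 1/100"
    and der: "\<And>t. t \<in> {a<..<b} \<Longrightarrow> \<exists>\<mu>>0. (z has_real_derivative \<mu> * (f (v t) * z t - v t)) (at t) \<and>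
       (v has_real_derivative \<mu> * z t) (at t)"
  defines "R \<equiv> polar_radius z v" and "A \<equiv> polar_angle z v"
  shows "polar_curve f R A a b"
    and "\<And>t. t \<in> {a..b} \<Longrightarrow> z t = R t * cos (A t)"
    and "\<And>t. t \<in> {a..b} \<Longrightarrow> v t = R t * sin (A t)"
proof -
  have R_def: "R = (\<lambda>t. sqrt ((z t)\<^sup>2 + (v t)\<^sup>2))" and A_def: "A = (\<lambda>t. arccos (z t / R t))"
    by (auto simp: assms polar_radius_def polar_angle_def fun_eq_iff)
  have Rpos: "0 < R t" if "t \<in> {a..b}" for t
    using ne[OF that] by (auto simp: R_def sum_power2_gt_zero_iff)
  have Rsq: "(R t)\<^sup>2 = (z t)\<^sup>2 + (v t)\<^sup>2" for t by (simp add: R_def)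
  have zR: "- 1 \<le> z t / R t" "z t / R t \<le> 1" if "t \<in> {a..b}" for t
  proof -
    have "\<bar>z t\<bar> \<le> R t" unfolding R_def by (rule real_sqrt_ge_abs1)
    then have "z t \<le> R t" "- R t \<le> z t" by auto
    then show "- 1 \<le> z t / R t" "z t / R t \<le> 1" using Rpos[OF that] by (auto simp: field_simps)
  qed
  have cosA: "cos (A t) = z t / R t" if "t \<in> {a..b}" for t
    unfolding A_def using zR[OF that] by (intro cos_arccos) auto
  have root: "sqrt (1 - (z t / R t)\<^sup>2) = v t / R t" if "t \<in> {a..b}" for t
  proof -
    have "1 - (z t / R t)\<^sup>2 = (v t / R t)\<^sup>2"
    proof -
      have "(z t / R t)\<^sup>2 + (v t / R t)\<^sup>2 = 1"
        unfolding power_divide add_divide_distrib[symmetric] Rsq[symmetric] using Rpos[OF that] by simp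
      then show ?thesis by simp
    qed
    then show ?thesis using Rpos[OF that] v0[OF that] by simp
  qed
  have sinA: "sin (A t) = v t / R t" if "t \<in> {a..b}" for t
    unfolding A_def using root[OF that] zR[OF that] by (subst sin_arccos_abs) auto
  show "\<And>t. t \<in> {a..b} \<Longrightarrow> z t = R t * cos (A t)"
    using cosA Rpos by (metis less_irrefl nonzero_mult_div_cancel_left times_divide_eq_right)
  show vR: "\<And>t. t \<in> {a..b} \<Longrightarrow> v t = R t * sin (A t)"
    using sinA Rpos by (metis less_irrefl nonzero_mult_div_cancel_left times_divide_eq_right)
  have cR: "continuous_on {a..b} R" unfolding R_def by (intro continuous_intros cz cv)
  have cA: "continuous_on {a..b} A"
    unfolding A_def using zR Rpos
    by (intro continuous_on_arccos continuous_on_divide cz cR) (auto simp: less_imp_neq[symmetric] order_less_imp_not_eq2)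
  have interior: "0 < A t \<and> A t < pi \<and> (\<exists>\<omega>>0. (A has_real_derivative \<omega>) (at t) \<and>
               (R has_real_derivative polar_field f (R t) (A t) * \<omega>) (at t))"
    if t: "t \<in> {a<..<b}" for t
  proof -
    have t': "t \<in> {a..b}" using t by auto
    obtain \<mu> where \<mu>: "\<mu> > 0"
      and dz: "(z has_real_derivative \<mu> * (f (v t) * z t - v t)) (at t)"
      and dv: "(v has_real_derivative \<mu> * z t) (at t)"
      using der[OF t] by blast
    define r where "r = R t"
    define F where "F = f (v t)"
    define x where "x = z t"
    define y where "y = v t"
    have r: "0 < r" "r\<^sup>2 = x\<^sup>2 + y\<^sup>2" and y: "0 < y"
      using Rpos[OF t'] Rsq[of t] vpos[OF t] unfolding r_def x_def y_def by auto
    have zr: "-1 < x / r" "x / r < 1"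
    proof -
      have "x\<^sup>2 < r\<^sup>2" using r(2) y by simp
      then have "\<bar>x\<bar> < r" using r(1) by (simp add: abs_square_less_1 power2_less_imp_less)
      then show "-1 < x / r" "x / r < 1" using r(1) by (auto simp: field_simps)
    qed
    have dR: "(R has_real_derivative \<mu> * F * x\<^sup>2 / r) (at t)"
    proof -
      have p: "0 < (z t)\<^sup>2 + (v t)\<^sup>2" using y unfolding y_def by (simp add: sum_power2_gt_zero_iff)
      have "(R has_real_derivative (2 * z t * (\<mu> * (f (v t) * z t - v t)) + 2 * v t * (\<mu> * z t)) *
           (inverse (sqrt ((z t)\<^sup>2 + (v t)\<^sup>2)) / 2)) (at t)"
        unfolding R_def using p by (auto intro!: derivative_eq_intros dz dv)
      moreover have "(2 * z t * (\<mu> * (f (v t) * z t - v t)) + 2 * v t * (\<mu> * z t)) *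
           (inverse (sqrt ((z t)\<^sup>2 + (v t)\<^sup>2)) / 2) = \<mu> * F * x\<^sup>2 / r"
        unfolding r_def R_def F_def x_def by (simp add: field_simps power2_eq_square)
      ultimately show ?thesis by simp
    qed
    define \<omega> where "\<omega> = \<mu> * (1 - F * (y / r * (x / r)))"
    have dA: "(A has_real_derivative \<omega>) (at t)"
    proof -
      have "((\<lambda>t. z t / R t) has_real_derivative
          (\<mu> * (F * x - y) * r - x * (\<mu> * F * x\<^sup>2 / r)) / (r * r)) (at t)"
        using r(1) unfolding r_def x_def y_def F_def
        by (auto intro!: derivative_eq_intros dz dR[unfolded r_def x_def F_def])
      then have "(A has_real_derivative (inverse (- sqrt (1 - (x / r)\<^sup>2))) *
          ((\<mu> * (F * x - y) * r - x * (\<mu> * F * x\<^sup>2 / r)) / (r * r))) (at t)"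
        unfolding A_def using zr unfolding x_def r_def
        by (intro DERIV_chain2[OF DERIV_arccos])
      moreover have "sqrt (1 - (x / r)\<^sup>2) = y / r" using root[OF t'] unfolding x_def y_def r_def .
      moreover have "(inverse (- (y / r))) * ((\<mu> * (F * x - y) * r - x * (\<mu> * F * x\<^sup>2 / r)) / (r * r)) = \<omega>"
      proof -
        have "(\<mu> * (F * x - y) * r - x * (\<mu> * F * x\<^sup>2 / r)) = \<mu> * ((F * x - y) * r\<^sup>2 - F * x * x\<^sup>2) / r"
          using r(1) by (simp add: field_simps power2_eq_square)
        also have "(F * x - y) * r\<^sup>2 - F * x * x\<^sup>2 = y * (F * x * y - r\<^sup>2)"
          unfolding r(2) by (simp add: algebra_simps power2_eq_square)
        finally show ?thesis unfolding \<omega>_def using r(1) y by (simp add: field_simps power2_eq_square)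
      qed
      ultimately show ?thesis by simp
    qed
    have cs: "cos (A t) = x / r" "sin (A t) = y / r"
      using cosA[OF t'] sinA[OF t'] unfolding x_def y_def r_def by auto
    have den: "0 < 1 - F * (y / r * (x / r))"
      using denominator_bounds(1)[OF small[OF t], of "A t"] unfolding cs F_def by linarith
    then have \<omega>: "\<omega> > 0" unfolding \<omega>_def using \<mu> by simp
    have "polar_field f (R t) (A t) * \<omega> = \<mu> * F * x\<^sup>2 / r"
    proof -
      have "polar_field f (R t) (A t) = r * (F * (x / r)\<^sup>2 / (1 - F * (y / r * (x / r))))"
        unfolding polar_field_def vR[OF t', symmetric] unfolding cs F_def r_def by simp
      then have "polar_field f (R t) (A t) * \<omega> = r * (F * (x / r)\<^sup>2) * \<mu>"
      proof -
        define q where "q = 1 - F * (y / r * (x / r))"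
        assume *: "polar_field f (R t) (A t) = r * (F * (x / r)\<^sup>2 / (1 - F * (y / r * (x / r))))"
        show ?thesis using den unfolding * \<omega>_def q_def[symmetric] by simp
      qed
      also have "\<dots> = \<mu> * F * x\<^sup>2 / r" using r(1) by (simp add: field_simps power2_eq_square)
      finally show ?thesis .
    qed
    moreover have "0 < A t" "A t < pi"
      using arccos_lt_bounded[of "x / r"] zr unfolding A_def x_def r_def by auto
    ultimately show ?thesis using dA dR \<omega> by auto
  qed
  show "polar_curve f R A a b"
    unfolding polar_curve_def
  proof (intro conjI ballI)
    fix t assume t: "t \<in> {a..b}"
    show "0 < R t" by (rule Rpos[OF t])
    show "0 \<le> A t" "A t \<le> pi" using zR[OF t] unfolding A_def by (auto intro: arccos_lbound arccos_ubound)
  qed (use ab cR cA interior in auto)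
qed

text \<open>Arcs in the upper half plane are the case \<open>s = 1\<close>. Arcs in the lower half plane are the case \<open>s = -1\<close>
  after the reflection \<open>H = - y\<close> and time reversal, so that \<open>H > 0\<close> and the motion goes from positive to
  negative \<open>X\<close> in both cases.\<close>

definition half_arc ::
  "real \<Rightarrow> real \<Rightarrow> real \<Rightarrow> real \<Rightarrow> (real \<Rightarrow> real) \<Rightarrow> (real \<Rightarrow> real) \<Rightarrow> real \<Rightarrow> real \<Rightarrow> bool" where
  "half_arc s l m n X H a b \<longleftrightarrow> a < b \<and> continuous_on {a..b} X \<and> continuous_on {a..b} H \<and>
     H a = 0 \<and> H b = 0 \<and> X a \<noteq> 0 \<and> X b \<noteq> 0 \<and>
     (\<forall>t\<in>{a<..<b}. 0 < H t \<and>
        (X has_real_derivative - H t + s * l * (X t)\<^sup>2 + m * X t * H t + s * n * (H t)\<^sup>2) (at t) \<and>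
        (H has_real_derivative X t * (1 - s * H t)) (at t))"

text \<open>The symmetry (x, y, t) -> (- x, y, - t) of the half system, which changes m into - m and
  nothing else. It turns statements about the start of an arc into statements about its end.\<close>

lemma half_arc_reverse:
  assumes "half_arc s l m n X H a b"
  shows "half_arc s l (- m) n (\<lambda>t. - X (a + b - t)) (\<lambda>t. H (a + b - t)) a b"
proof -
  have "continuous_on {a..b} (\<lambda>t. X (a + b - t))" "continuous_on {a..b} (\<lambda>t. H (a + b - t))"
    using assms unfolding half_arc_def
    by (auto intro!: continuous_on_compose2[of "{a..b}" X] continuous_on_compose2[of "{a..b}" H] continuous_intros)
  moreover have "0 < H (a + b - t) \<and>
      ((\<lambda>t. - X (a + b - t)) has_real_derivative - H (a + b - t) + s * l * (- X (a + b - t))\<^sup>2 +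
          - m * - X (a + b - t) * H (a + b - t) + s * n * (H (a + b - t))\<^sup>2) (at t) \<and>
      ((\<lambda>t. H (a + b - t)) has_real_derivative - X (a + b - t) * (1 - s * H (a + b - t))) (at t)"
    if t: "t \<in> {a<..<b}" for t
  proof -
    let ?t = "a + b - t"
    have t': "?t \<in> {a<..<b}" using t by auto
    have dX: "(X has_real_derivative - H ?t + s * l * (X ?t)\<^sup>2 + m * X ?t * H ?t + s * n * (H ?t)\<^sup>2) (at ?t)"
      and dH: "(H has_real_derivative X ?t * (1 - s * H ?t)) (at ?t)" and p: "0 < H ?t"
      using assms t' unfolding half_arc_def by auto
    have i: "((\<lambda>t. a + b - t) has_real_derivative -1) (at t)" by (auto intro!: derivative_eq_intros)
    have "((\<lambda>t. - X (a + b - t)) has_real_derivative - H ?t + s * l * (- X ?t)\<^sup>2 +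
          - m * - X ?t * H ?t + s * n * (H ?t)\<^sup>2) (at t)"
      by (rule DERIV_cong[OF DERIV_minus[OF DERIV_chain2[OF dX i]]]) simp
    then show ?thesis
      using p DERIV_chain2[OF dH i] by simp
  qed
  ultimately show ?thesis using assms unfolding half_arc_def by (auto intro: continuous_on_minus)
qed

text \<open>\<open>Y\<close> gives the height \<open>h = s y\<close> as a function of the Lienard coordinate \<open>v = s w\<close>; \<open>Yd\<close> is its derivative.\<close>

locale half_chart =
  fixes s l n d :: real and Y Yd :: "real \<Rightarrow> real"
  assumes s: "s = 1 \<or> s = -1" and d: "0 < d" and Y0: "Y 0 = 0"
    and Y_deriv: "\<And>v. \<bar>v\<bar> < d \<Longrightarrow> (Y has_real_derivative Yd v) (at v)"
    and Yd_cont: "continuous_on {- d<..<d} Yd"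
    and Yd_pos: "\<And>v. \<bar>v\<bar> < d \<Longrightarrow> 0 < Yd v"
    and Y_small: "\<And>v. \<bar>v\<bar> < d \<Longrightarrow> \<bar>Y v\<bar> \<le> 1/2 \<and> \<bar>n * Y v\<bar> \<le> 1/2"
    and Y_eq: "\<And>v. \<bar>v\<bar> < d \<Longrightarrow> Y v * (1 - n * s * Y v) * (1 - s * Y v) powr (2 * l - 1) * Yd v = v"
begin

definition psi :: "real \<Rightarrow> real" where
  "psi v = (1 - s * Y v) powr (- l) / (1 - n * s * Y v)"

lemma Y_mono: "- d < v \<Longrightarrow> v < w \<Longrightarrow> w < d \<Longrightarrow> Y v < Y w"
proof (rule DERIV_pos_imp_increasing[of v w Y])
  fix x assume "- d < v" "v < w" "w < d" "v \<le> x" "x \<le> w"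
  then have "\<bar>x\<bar> < d" by auto
  then show "\<exists>y. (Y has_real_derivative y) (at x) \<and> 0 < y" using Y_deriv Yd_pos by blast
qed

lemma Y_pos: "0 < v \<Longrightarrow> v < d \<Longrightarrow> 0 < Y v"
  using Y_mono[of 0 v] Y0 d by simp

lemma Y_inj: "inj_on Y {- d<..<d}"
  using Y_mono by (force intro!: linorder_inj_onI)

lemma Y_cont: "continuous_on {- d<..<d} Y"
  by (rule continuous_at_imp_continuous_on) (use Y_deriv DERIV_isCont in \<open>fastforce simp: abs_less_iff\<close>)

lemma factors_pos:
  assumes "\<bar>v\<bar> < d"
  shows "1/2 \<le> 1 - s * Y v" "1/2 \<le> 1 - n * s * Y v"
proof -
  have "\<bar>n * s * Y v\<bar> = \<bar>n * Y v\<bar>" using s by auto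
  then show "1/2 \<le> 1 - s * Y v" "1/2 \<le> 1 - n * s * Y v" using Y_small[OF assms] s by auto
qed

definition V :: "real \<Rightarrow> real" where "V = inv_into {- d<..<d} Y"

lemma V_Y: "- d < v \<Longrightarrow> v < d \<Longrightarrow> V (Y v) = v"
  unfolding V_def by (rule inv_into_f_f[OF Y_inj]) auto

lemma in_range_Y:
  assumes "0 \<le> h" "h \<le> Y w" "w < d" "0 < w"
  obtains v where "0 \<le> v" "v \<le> w" "h = Y v"
proof -
  have "continuous_on {0..w} Y"
    using assms d by (intro continuous_on_subset[OF Y_cont]) auto
  then show ?thesis using IVT'[of Y 0 h w] assms Y0 that by auto
qed

lemma V_deriv:
  assumes "\<bar>v\<bar> < d"
  shows "(V has_real_derivative 1 / Yd v) (at (Y v))"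
proof -
  have "(V has_real_derivative inverse (Yd v)) (at (Y v))"
  proof (rule has_field_derivative_inverse_strong[of Y "Yd v" v "{- d<..<d}" V])
    show "(Y has_real_derivative Yd v) (at v)" by (rule Y_deriv[OF assms])
    show "continuous_on {- d<..<d} Y" by (rule Y_cont)
    show "\<And>z. z \<in> {- d<..<d} \<Longrightarrow> V (Y z) = z" using V_Y by auto
  qed (use assms Yd_pos[OF assms] in auto)
  then show ?thesis by (simp add: inverse_eq_divide)
qed

lemma psi_pos: "\<bar>v\<bar> < d \<Longrightarrow> 0 < psi v"
  using factors_pos[of v] unfolding psi_def by simp

text \<open>The time factor forced by v' = lam z: with z = (1 - s h)^l x, the equation h' = x (1 - s
  h) gives v' = x (1 - s h) / Yd.\<close>

definition lam :: "real \<Rightarrow> real" where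
  "lam v = (1 - s * Y v) powr (1 - l) / Yd v"

lemma lam_pos: "\<bar>v\<bar> < d \<Longrightarrow> 0 < lam v"
  using factors_pos[of v] Yd_pos[of v] unfolding lam_def by simp

text \<open>The terms v, z and m v psi z of the Lienard field, multiplied by \<open>lam\<close> and
  expressed in x and h. The exponents match: (1 - l) + (2 l - 1) = l in the first identity, on which
  the third one rests.\<close>

lemma lam_identities: 
  assumes v: "\<bar>v\<bar> < d"
  shows "lam v * v = Y v * (1 - n * s * Y v) * (1 - s * Y v) powr l"
    and "lam v * ((1 - s * Y v) powr l * x) = x * (1 - s * Y v) / Yd v"
    and "lam v * (m * v * psi v * ((1 - s * Y v) powr l * x)) = (1 - s * Y v) powr l * (m * x * Y v)"
proof -
  note p = factors_pos[OF v] and q = Yd_pos[OF v]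
  have "lam v * v = (1 - s * Y v) powr (1 - l) / Yd v * (Y v * (1 - n * s * Y v) * (1 - s * Y v) powr (2 * l - 1) * Yd v)"
    using Y_eq[OF v] by (simp add: lam_def)
  also have "\<dots> = Y v * (1 - n * s * Y v) * ((1 - s * Y v) powr (1 - l) * (1 - s * Y v) powr (2 * l - 1))"
    using q by simp
  also have "(1 - s * Y v) powr (1 - l) * (1 - s * Y v) powr (2 * l - 1) = (1 - s * Y v) powr l"
    using p by (simp add: powr_add[symmetric])
  finally show 1: "lam v * v = Y v * (1 - n * s * Y v) * (1 - s * Y v) powr l" .
  have "(1 - s * Y v) powr (1 - l) * (1 - s * Y v) powr l = 1 - s * Y v"
    using p by (simp add: powr_add[symmetric])
  then show "lam v * ((1 - s * Y v) powr l * x) = x * (1 - s * Y v) / Yd v"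
    unfolding lam_def by (metis (no_types, lifting) mult.assoc mult.commute times_divide_eq_left)
  have pl: "(1 - s * Y v) powr (- l) * (1 - s * Y v) powr l = 1"
    using p by (simp add: powr_add[symmetric])
  have "lam v * (m * v * psi v * ((1 - s * Y v) powr l * x)) =
        m * x * psi v * (1 - s * Y v) powr l * (lam v * v)" by simp
  also have "\<dots> = m * x * Y v * (1 - s * Y v) powr l * ((1 - s * Y v) powr (- l) * (1 - s * Y v) powr l)"
    unfolding 1 psi_def using p by simp
  finally show "lam v * (m * v * psi v * ((1 - s * Y v) powr l * x)) = (1 - s * Y v) powr l * (m * x * Y v)"
    unfolding pl by simp
qed

text \<open>The square of \<open>V\<close> is \<open>2 \<integral> h (1 - n s h) (1 - s h)\<^bsup>2 l - 1\<^esup> dh\<close>, so that the coordinates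
  \<open>z = (1 - s h)\<^bsup>l\<^esup> x\<close>, \<open>v = V h\<close> bring the field to Lienard form up to the factor \<open>lam\<close>.\<close>

lemma half_arc_lienard_deriv:
  assumes ha: "half_arc s l m n X H a b" and t: "t \<in> {a<..<b}" and H: "H t = Y v" and v: "\<bar>v\<bar> < d"
  defines "z \<equiv> (\<lambda>t. (1 - s * H t) powr l * X t)"
  shows "(z has_real_derivative lam v * (m * v * psi v * z t - v)) (at t)"
    and "((\<lambda>t. V (H t)) has_real_derivative lam v * z t) (at t)"
proof -
  have dX: "(X has_real_derivative - H t + s * l * (X t)\<^sup>2 + m * X t * H t + s * n * (H t)\<^sup>2) (at t)"
    and dH: "(H has_real_derivative X t * (1 - s * H t)) (at t)"
    using ha t unfolding half_arc_def by auto
  note p = factors_pos[OF v, folded H]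
  have "((\<lambda>t. V (H t)) has_real_derivative 1 / Yd v * (X t * (1 - s * H t))) (at t)"
    by (rule DERIV_chain2[OF _ dH]) (use V_deriv[OF v] H in simp)
  then show "((\<lambda>t. V (H t)) has_real_derivative lam v * z t) (at t)"
    unfolding z_def H lam_identities(2)[OF v] by simp
  have ss: "s * s = 1" using s by auto
  have "(z has_real_derivative l * (1 - s * H t) powr (l - 1) * (- s * (X t * (1 - s * H t))) * X t +
     (- H t + s * l * (X t)\<^sup>2 + m * X t * H t + s * n * (H t)\<^sup>2) * (1 - s * H t) powr l) (at t)"
    unfolding z_def using p by (auto intro!: derivative_eq_intros dX dH)
  \<comment> \<open>The factor (1 - s H)^l in z is chosen for this step: its derivative contributes
    - s l X^2 (1 - s H)^l, which cancels the term quadratic in X.\<close>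
  moreover have "(1 - s * H t) powr (l - 1) * (1 - s * H t) = (1 - s * H t) powr l"
    using p powr_mult_base[of "1 - s * H t" "l - 1"] by (simp add: mult.commute)
  then have "l * (1 - s * H t) powr (l - 1) * (- s * (X t * (1 - s * H t))) * X t +
     (- H t + s * l * (X t)\<^sup>2 + m * X t * H t + s * n * (H t)\<^sup>2) * (1 - s * H t) powr l
     = (1 - s * H t) powr l * (m * X t * H t - H t * (1 - n * s * H t))"
  proof -
    assume e: "(1 - s * H t) powr (l - 1) * (1 - s * H t) = (1 - s * H t) powr l"
    have lhs: "l * (1 - s * H t) powr (l - 1) * (- s * (X t * (1 - s * H t))) * X t =
      - l * s * (X t)\<^sup>2 * ((1 - s * H t) powr (l - 1) * (1 - s * H t))"
      by (simp only: power2_eq_square mult_ac minus_mult_left[symmetric] mult_minus_right)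
    show ?thesis unfolding lhs e by (simp add: algebra_simps power2_eq_square)
  qed
  also have "\<dots> = lam v * (m * v * psi v * z t - v)"
    unfolding right_diff_distrib[of "lam v"] z_def H lam_identities(1,3)[OF v] by (simp add: algebra_simps)
  ultimately show "(z has_real_derivative lam v * (m * v * psi v * z t - v)) (at t)" by simp
qed

definition z_along :: "(real \<Rightarrow> real) \<Rightarrow> (real \<Rightarrow> real) \<Rightarrow> real \<Rightarrow> real" where
  "z_along X H t = (1 - s * H t) powr l * X t"

text \<open>Stated on subintervals, because the confinement argument applies it up to the first exit
  time from the chart. At the ends of the arc v = 0, but there X \<noteq> 0 gives z \<noteq> 0, so
  the radius never vanishes.\<close>

lemma half_arc_polar_curve:
  assumes ha: "half_arc s l m n X H a b" and tm: "tame w B (\<lambda>v. m * v * psi v)" and w: "w < d"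
    and ab: "a \<le> a'" "a' < b'" "b' \<le> b" and conf: "\<And>t. t \<in> {a'..b'} \<Longrightarrow> H t \<le> Y w"
  defines "z \<equiv> z_along X H"
  defines "R \<equiv> polar_radius z (\<lambda>t. V (H t))" and "A \<equiv> polar_angle z (\<lambda>t. V (H t))"
  shows "polar_curve (\<lambda>v. m * v * psi v) R A a' b'"
    and "R a' \<le> 3 * R b'" "R b' \<le> 3 * R a'"
proof -
  let ?f = "\<lambda>v. m * v * psi v"
  have z_def: "z = (\<lambda>t. (1 - s * H t) powr l * X t)" by (simp add: assms z_along_def fun_eq_iff)
  have w0: "0 < w" using tm by (simp add: tame_def)
  have curve_x: "continuous_on {a'..b'} X" and curve_h: "continuous_on {a'..b'} H"
    using ha ab unfolding half_arc_def by (auto intro: continuous_on_subset)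
  have H0: "0 \<le> H t \<and> (t \<noteq> a \<longrightarrow> t \<noteq> b \<longrightarrow> 0 < H t)" if "t \<in> {a'..b'}" for t
    using ha ab that unfolding half_arc_def
    by (cases "t = a \<or> t = b") (auto simp: less_imp_le)
  have ex: "\<exists>v. 0 \<le> v \<and> v \<le> w \<and> H t = Y v" if "t \<in> {a'..b'}" for t
    using in_range_Y[of "H t" w] H0[OF that] conf[OF that] w w0 by metis
  have vr: "0 \<le> V (H t) \<and> V (H t) \<le> w \<and> H t = Y (V (H t))" if "t \<in> {a'..b'}" for t
    using ex[OF that] V_Y w d by (metis dual_order.strict_trans2 le_minus_iff less_le_not_le linorder_not_less neg_0_le_iff_le order_less_le_trans)
  have p: "1/2 \<le> 1 - s * H t" if "t \<in> {a'..b'}" for t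
    using factors_pos(1)[of "V (H t)"] vr[OF that] w by (metis abs_of_nonneg le_less_trans)
  have cz: "continuous_on {a'..b'} z"
    unfolding z_def by (intro continuous_intros curve_x curve_h) (use p in force)
  have cV: "continuous_on {a'..b'} (\<lambda>t. V (H t))"
  proof (rule continuous_on_compose2[OF _ curve_h])
    show "continuous_on (Y ` {0..w}) V"
    proof (rule continuous_at_imp_continuous_on, clarify)
      fix v assume "v \<in> {0..w}"
      then have "\<bar>v\<bar> < d" using w by auto
      then show "isCont V (Y v)" using V_deriv DERIV_isCont by blast
    qed
    show "H ` {a'..b'} \<subseteq> Y ` {0..w}" using ex by force
  qed
  have Xne: "X a \<noteq> 0" "X b \<noteq> 0" using ha by (auto simp: half_arc_def)
  have Vpos: "0 < V (H t)" if "t \<in> {a'..b'}" "t \<noteq> a" "t \<noteq> b" for t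
    using vr[OF that(1)] H0[OF that(1)] that Y0 by (metis less_eq_real_def less_irrefl)
  have small: "\<bar>?f (V (H t))\<bar> \<le> 1/100" if "t \<in> {a'..b'}" for t
    using tame_bound(2)[OF tm, of "V (H t)"] vr[OF that] by simp
  note L = lienard_polar_curve[of a' b' z "\<lambda>t. V (H t)" ?f, folded R_def A_def]
  have asms: "a' < b'" "continuous_on {a'..b'} z" "continuous_on {a'..b'} (\<lambda>t. V (H t))"
    "\<And>t. t \<in> {a'..b'} \<Longrightarrow> 0 \<le> V (H t)"
    "\<And>t. t \<in> {a'..b'} \<Longrightarrow> z t \<noteq> 0 \<or> V (H t) \<noteq> 0"
    "\<And>t. t \<in> {a'<..<b'} \<Longrightarrow> 0 < V (H t)"
    "\<And>t. t \<in> {a'<..<b'} \<Longrightarrow> \<bar>?f (V (H t))\<bar> \<le> 1/100"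
    "\<And>t. t \<in> {a'<..<b'} \<Longrightarrow> \<exists>\<mu>>0. (z has_real_derivative \<mu> * (?f (V (H t)) * z t - V (H t))) (at t) \<and>
       ((\<lambda>t. V (H t)) has_real_derivative \<mu> * z t) (at t)"
  proof -
    show "z t \<noteq> 0 \<or> V (H t) \<noteq> 0" if t: "t \<in> {a'..b'}" for t
    proof (cases "t = a \<or> t = b")
      case True
      then show ?thesis using Xne p[OF t] by (auto simp: z_def)
    qed (use Vpos[OF t] in auto)
    fix t assume t: "t \<in> {a'<..<b'}"
    then have t': "t \<in> {a'..b'}" "t \<noteq> a" "t \<noteq> b" "t \<in> {a<..<b}" using ab by auto
    show "0 < V (H t)" by (rule Vpos[OF t'(1-3)])
    show "\<bar>?f (V (H t))\<bar> \<le> 1/100" by (rule small[OF t'(1)])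
    have v: "\<bar>V (H t)\<bar> < d" "H t = Y (V (H t))" using vr[OF t'(1)] w by auto
    show "\<exists>\<mu>>0. (z has_real_derivative \<mu> * (?f (V (H t)) * z t - V (H t))) (at t) \<and>
       ((\<lambda>t. V (H t)) has_real_derivative \<mu> * z t) (at t)"
      using half_arc_lienard_deriv[OF ha t'(4) v(2,1)] lam_pos[OF v(1)] unfolding z_def by blast
  qed (use ab cz cV vr in auto)
  show pc: "polar_curve ?f R A a' b'" by (rule L(1)[OF asms])
  have "\<bar>?f (R t * sin (A t))\<bar> \<le> 1/100" if "a' < t" "t < b'" for t
    using L(3)[OF asms, of t] small[of t] that by simp
  then show "R a' \<le> 3 * R b'" "R b' \<le> 3 * R a'"
    using polar_curve_ratio[OF pc] by auto
qed

text \<open>At a first time with H = \<open>Y w\<close> one has v = w, so the radius is at least w;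
  yet it is at most 3 times the initial radius, which is |X a| because H a = 0.\<close>

lemma half_arc_confined_start:
  assumes ha: "half_arc s l m n X H a b" and tm: "tame w B (\<lambda>v. m * v * psi v)" and w: "w < d"
    and start: "3 * \<bar>X a\<bar> < w" and t: "t \<in> {a..b}"
  shows "H t < Y w"
proof (rule ccontr)
  assume "\<not> H t < Y w"
  have w0: "0 < w" using tm by (simp add: tame_def)
  have curve_h: "continuous_on {a..b} H" and ends: "H a = 0" "a < b" using ha by (auto simp: half_arc_def)
  let ?Z = "{t \<in> {a..b}. Y w \<le> H t}"
  have clZ: "closed ?Z"
    using continuous_closed_preimage[OF curve_h closed_atLeastAtMost closed_atLeast[of "Y w"]]
    by (simp add: vimage_def Int_def)
  have neZ: "?Z \<noteq> {}" using t \<open>\<not> H t < Y w\<close> by auto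
  have bdZ: "bdd_below ?Z" by (rule bdd_belowI[of _ a]) auto
  define t1 where "t1 = Inf ?Z"
  have t1Z: "t1 \<in> ?Z" unfolding t1_def by (rule closed_contains_Inf[OF neZ bdZ clZ])
  have below: "H x < Y w" if "a \<le> x" "x < t1" for x
    using cInf_lower[OF _ bdZ, of x] that t1Z unfolding t1_def[symmetric] by force
  have Yw: "0 < Y w" using Y_pos w w0 by simp
  have at1: "a < t1" using t1Z ends Yw by (cases "t1 = a") auto
  obtain t2 where t2: "a \<le> t2" "t2 \<le> t1" "H t2 = Y w"
    using IVT'[of H a "Y w" t1] t1Z ends Yw at1 continuous_on_subset[OF curve_h, of "{a..t1}"] by auto
  have Ht1: "H t1 = Y w" using t2 below[of t2] by force
  have conf: "H x \<le> Y w" if "x \<in> {a..t1}" for x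
    using that below[of x] Ht1 by (cases "x = t1") auto
  have "sqrt (((1 - s * H t1) powr l * X t1)\<^sup>2 + (V (H t1))\<^sup>2)
      \<le> 3 * sqrt (((1 - s * H a) powr l * X a)\<^sup>2 + (V (H a))\<^sup>2)"
    using half_arc_polar_curve(3)[OF ha tm w order_refl at1 _ conf] t1Z by (simp add: polar_radius_def z_along_def)
  also have "V (H a) = 0" using V_Y[of 0] Y0 d ends by simp
  also have "V (H t1) = w" using V_Y[of w] Ht1 w w0 by simp
  also have "3 * sqrt (((1 - s * H a) powr l * X a)\<^sup>2 + 0\<^sup>2) = 3 * \<bar>X a\<bar>" using ends by simp
  finally have "sqrt (((1 - s * H t1) powr l * X t1)\<^sup>2 + w\<^sup>2) \<le> 3 * \<bar>X a\<bar>" .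
  moreover have "w \<le> sqrt (((1 - s * H t1) powr l * X t1)\<^sup>2 + w\<^sup>2)"
    by (rule real_sqrt_ge_abs2[THEN order_trans[OF abs_ge_self]])
  ultimately show False using start by linarith
qed

lemma tame_uminus: "tame w B (\<lambda>v. m * v * psi v) \<Longrightarrow> tame w B (\<lambda>v. - m * v * psi v)"
  unfolding tame_def by (auto simp: abs_minus_commute)

lemma half_arc_confined_end:
  assumes ha: "half_arc s l m n X H a b" and tm: "tame w B (\<lambda>v. m * v * psi v)" and w: "w < d"
    and "end": "3 * \<bar>X b\<bar> < w" and t: "t \<in> {a..b}"
  shows "H t < Y w"
  using half_arc_confined_start[OF half_arc_reverse[OF ha] tame_uminus[OF tm] w, of "a + b - t"] "end" t
  by simp

text \<open>Smallness of one end, whichever it is, suffices: all radii along the arc agree up to a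
  factor 3, and 9 allows for using this factor twice.\<close>

lemma half_arc_polar:
  assumes ha: "half_arc s l m n X H a b" and tm: "tame w B (\<lambda>v. m * v * psi v)" and w: "w < d"
    and small: "9 * \<bar>X a\<bar> < w \<or> 9 * \<bar>X b\<bar> < w" and sgn: "0 < X a" "X b < 0"
  obtains R A where "polar_curve (\<lambda>v. m * v * psi v) R A a b"
    "A a = 0" "A b = pi" "R a = X a" "R b = - X b" "\<And>t. t \<in> {a..b} \<Longrightarrow> R t < w"
    "X a \<le> 3 * - X b" "- X b \<le> 3 * X a"
proof -
  have ends: "H a = 0" "H b = 0" and ab: "a < b" using ha by (auto simp: half_arc_def)
  have "H t < Y w" if "t \<in> {a..b}" for t
    using small half_arc_confined_start[OF ha tm w _ that] half_arc_confined_end[OF ha tm w _ that] by auto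
  then have conf: "H t \<le> Y w" if "t \<in> {a..b}" for t using that by (simp add: less_imp_le)
  define R where "R = polar_radius (z_along X H) (\<lambda>t. V (H t))"
  define A where "A = polar_angle (z_along X H) (\<lambda>t. V (H t))"
  note P = half_arc_polar_curve[OF ha tm w, folded R_def A_def]
  have V0: "V 0 = 0" using V_Y[of 0] Y0 d by simp
  have RX: "R a = X a" "R b = - X b" "A a = 0" "A b = pi"
    using sgn unfolding A_def R_def by (auto simp: ends V0 z_along_def polar_radius_def polar_angle_def)
  have ratio: "X a \<le> 3 * - X b" "- X b \<le> 3 * X a"
    using P(2,3)[of a b] RX ab conf by auto
  show ?thesis
  proof (rule that[of R A])
    show "polar_curve (\<lambda>v. m * v * psi v) R A a b" using P(1)[of a b] ab conf by auto
    show "R t < w" if t: "t \<in> {a..b}" for t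
    proof -
      have "R t \<le> 3 * R a" using P(3)[of a t] t conf RX sgn by (cases "t = a") auto
      moreover have "R t \<le> 3 * R b" using P(2)[of t b] t conf RX sgn by (cases "t = b") auto
      ultimately show ?thesis using small RX sgn ratio by auto
    qed
  qed (use RX ratio in auto)
qed

end

text \<open>The two curves live on unrelated time intervals, so they are compared through the
  solution r for g that has the common radius at angle pi: the first curve starts strictly below r
  0, the second at r 0 or above.\<close>

lemma turn_comparison:
  assumes c1: "polar_curve f R1 A1 a1 b1" "A1 a1 = 0" "A1 b1 = pi" "\<And>t. t \<in> {a1..b1} \<Longrightarrow> R1 t < w"
    and c2: "polar_curve g R2 A2 a2 b2" "A2 a2 = 0" "A2 b2 = pi" "\<And>t. t \<in> {a2..b2} \<Longrightarrow> R2 t < w"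
    and tf: "tame w B f" and tg: "tame w C g"
    and "end": "R1 b1 = R2 b2" "R1 b1 \<le> w / 2"
    and less: "\<And>v. 0 < v \<Longrightarrow> v < w \<Longrightarrow> g v < f v"
  shows "R1 a1 < R2 a2"
proof -
  have "0 < R1 b1" using c1(1) by (auto simp: polar_curve_def)
  then obtain r where r: "polar_solution g w r" "r pi = R1 b1"
    using polar_solution_exists[OF tg _ "end"(2), of pi] by (metis order_refl pi_ge_zero)
  have "R1 a1 < r (A1 a1)"
    by (rule polar_comparison[OF c1(1) r(1) tf tg less c1(4)]) (use r(2) c1 in auto)
  moreover have "r (A2 a2) \<le> R2 a2"
    by (rule polar_curve_above_solution[OF c2(1) r(1) tg c2(4)]) (use r(2) c2 "end" in auto)
  ultimately show ?thesis using c1 c2 by simp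
qed

section \<open>Analyticity of the coordinates\<close>

text \<open>With \<open>Q\<close> the primitive of \<open>2 z q z\<close> vanishing at \<open>0\<close>, the function \<open>Y\<close> is the inverse of the analytic
  square root of \<open>Q\<close>.\<close>

lemma holomorphic_square_root_inverse:
  fixes q :: "complex \<Rightarrow> complex" and qr :: "real \<Rightarrow> real"
  assumes r0: "0 < r0" and holq: "q holomorphic_on ball 0 r0"
    and qr: "\<And>y. \<bar>y\<bar> < r0 \<Longrightarrow> q (of_real y) = of_real (qr y)"
    and qpos: "\<And>y. \<bar>y\<bar> < r0 \<Longrightarrow> 0 < qr y"
  obtains d Y Yd G where "0 < d" "Y 0 = 0"
    "\<And>v. \<bar>v\<bar> < d \<Longrightarrow> (Y has_real_derivative Yd v) (at v)"
    "continuous_on {- d<..<d} Yd" "\<And>v. \<bar>v\<bar> < d \<Longrightarrow> 0 < Yd v" "\<And>v. \<bar>v\<bar> < d \<Longrightarrow> \<bar>Y v\<bar> < r0"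
    "\<And>v. \<bar>v\<bar> < d \<Longrightarrow> Y v * qr (Y v) * Yd v = v"
    "G holomorphic_on ball 0 d" "\<And>v. \<bar>v\<bar> < d \<Longrightarrow> G (complex_of_real v) = complex_of_real (Y v)"
proof -
  let ?B = "ball (0::complex) r0"
  have h2: "(\<lambda>z. 2 * z * q z) holomorphic_on ?B" by (intro holomorphic_intros holq)
  obtain Q0 where Q0: "\<And>z. z \<in> ?B \<Longrightarrow> (Q0 has_field_derivative 2 * z * q z) (at z within ?B)"
    using holomorphic_convex_primitive'[OF convex_ball open_ball h2] by blast
  define Q where "Q = (\<lambda>z. Q0 z - Q0 0)"
  have Qd: "(Q has_field_derivative 2 * z * q z) (at z)" if "z \<in> ?B" for z
    unfolding Q_def using Q0[OF that] at_within_open[OF that open_ball]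
    by (auto intro!: derivative_eq_intros)
  have holQ: "Q holomorphic_on ?B"
    unfolding holomorphic_on_open[OF open_ball] using Qd by blast
  have dQ: "deriv Q z = 2 * z * q z" if "z \<in> ?B" for z using Qd[OF that] by (rule DERIV_imp_deriv)
  have qd: "(q has_field_derivative deriv q 0) (at 0)"
    using holomorphic_derivI[OF holq open_ball, of 0] r0 by simp
  have "((\<lambda>z. 2 * z * q z) has_field_derivative 2 * q 0) (at 0)"
    by (auto intro!: derivative_eq_intros qd)
  then have "(deriv Q has_field_derivative 2 * q 0) (at 0)"
    by (rule has_field_derivative_transform_within_open[where S = "?B"]) (use r0 dQ in auto)
  then have ddQ: "deriv (deriv Q) 0 = 2 * q 0" by (rule DERIV_imp_deriv)
  have q0: "q 0 \<noteq> 0" using qr[of 0] qpos[of 0] r0 by simp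
  have d2: "(deriv ^^ 2) Q 0 \<noteq> 0" using ddQ q0 by (simp add: numeral_2_eq_2)
  have d1: "(deriv ^^ i) Q 0 = 0" if "0 < i" "i < 2" for i
  proof -
    have "i = 1" using that by simp
    then show ?thesis using dQ[of 0] r0 by simp
  qed
  \<comment> \<open>Q' z = 2 z q z with q 0 \<noteq> 0, so Q has a double zero at 0 and is the
    square of z g z with g holomorphic and nonvanishing.\<close>
  obtain g r1 where g: "0 < r1" "g holomorphic_on ball 0 r1"
      "\<And>w. w \<in> ball 0 r1 \<Longrightarrow> Q w - Q 0 = ((w - 0) * g w) ^ 2"
      "\<And>w. w \<in> ball 0 r1 \<Longrightarrow> g w \<noteq> 0"
    by (rule holomorphic_factor_order_of_zero_strong[OF holQ open_ball _ _ d2 d1]) (use r0 in auto)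
  have Q00: "Q 0 = 0" by (simp add: Q_def)
  define r2 where "r2 = min r0 r1"
  have r2: "0 < r2" "r2 \<le> r0" "r2 \<le> r1" using r0 g(1) by (auto simp: r2_def)

  define A where "A = (\<lambda>y. Re (Q (of_real y)))"
  have Qy: "((\<lambda>y. Q (of_real y)) has_vector_derivative of_real (2 * y * qr y)) (at y)" if "\<bar>y\<bar> < r0" for y :: real
    using has_vector_derivative_real_field[OF Qd[of "of_real y"]] that qr[OF that] by simp
  have Ad: "(A has_real_derivative 2 * y * qr y) (at y)" if "\<bar>y\<bar> < r0" for y
    using bounded_linear.has_vector_derivative[OF bounded_linear_Re Qy[OF that]]
    unfolding A_def has_real_derivative_iff_has_vector_derivative by simp
  have Imd: "((\<lambda>y. Im (Q (of_real y))) has_real_derivative 0) (at y)" if "\<bar>y\<bar> < r0" for y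
    using bounded_linear.has_vector_derivative[OF bounded_linear_Im Qy[OF that]]
    unfolding has_real_derivative_iff_has_vector_derivative by simp
  have Im0: "Im (Q (of_real y)) = 0" if "\<bar>y\<bar> < r0" for y
  proof -
    have "((\<lambda>y. Im (Q (of_real y))) has_field_derivative 0) (at x within {- r0<..<r0})"
      if "x \<in> {- r0<..<r0}" for x
      using Imd[of x] that by (auto intro: has_field_derivative_at_within simp: abs_less_iff)
    then obtain c where c: "\<And>x. x \<in> {- r0<..<r0} \<Longrightarrow> Im (Q (of_real x)) = c"
      using has_field_derivative_zero_constant[of "{- r0<..<r0}" "\<lambda>y. Im (Q (of_real y))"]
        convex_real_interval(8) by blast
    show ?thesis using c[of y] c[of 0] that r0 Q00 by (simp add: abs_less_iff)
  qed
  have QA: "Q (of_real y) = of_real (A y)" if "\<bar>y\<bar> < r0" for y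
    using Im0[OF that] by (simp add: A_def complex_eq_iff)
  have A0: "A 0 = 0" by (simp add: A_def Q00)
  have Apos: "0 < A y" if "\<bar>y\<bar> < r0" "y \<noteq> 0" for y
  proof (cases "0 < y")
    case True
    have "A 0 < A y"
    proof (rule DERIV_pos_imp_increasing_open[OF True])
      show "continuous_on {0..y} A"
        using that True by (intro continuous_at_imp_continuous_on ballI DERIV_isCont[OF Ad]) auto
      fix x assume x: "0 < x" "x < y"
      then show "\<exists>D. (A has_real_derivative D) (at x) \<and> D > 0"
        using Ad[of x] qpos[of x] that by (intro exI[of _ "2 * x * qr x"]) auto
    qed
    then show ?thesis using A0 by simp
  next
    case False
    then have y: "y < 0" using that by simp
    have "A 0 < A y"
    proof (rule DERIV_neg_imp_decreasing_open[OF y])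
      show "continuous_on {y..0} A"
        using that y by (intro continuous_at_imp_continuous_on ballI DERIV_isCont[OF Ad]) auto
      fix x assume x: "y < x" "x < 0"
      then show "\<exists>D. (A has_real_derivative D) (at x) \<and> D < 0"
        using Ad[of x] qpos[of x] that by (intro exI[of _ "2 * x * qr x"]) (auto simp: mult_less_0_iff)
    qed
    then show ?thesis using A0 by simp
  qed
  \<comment> \<open>On the real axis g^2 = A y / y^2 > 0, which forces g to be real there. The value
    at 0 is treated below as a limit along r2 / (k + 2).\<close>
  have greal: "Im (g (of_real y)) = 0 \<and> Re (g (of_real y)) \<noteq> 0" if y: "\<bar>y\<bar> < r2" "y \<noteq> 0" for y
  proof -
    have yb: "complex_of_real y \<in> ball 0 r1" "\<bar>y\<bar> < r0" using y r2 by auto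
    have "of_real (A y) = (of_real y * g (of_real y))\<^sup>2"
      using g(3)[OF yb(1)] QA[OF yb(2)] Q00 by simp
    then have "of_real (A y / y\<^sup>2) = (g (of_real y))\<^sup>2"
      using y by (simp add: power_mult_distrib)
    then have sq: "(g (of_real y))\<^sup>2 = of_real (A y / y\<^sup>2)" by (rule sym)
    have pos: "0 < A y / y\<^sup>2" using Apos[OF yb(2) y(2)] y by simp
    have e: "(Re (g (of_real y)))\<^sup>2 - (Im (g (of_real y)))\<^sup>2 = A y / y\<^sup>2"
      "2 * Re (g (of_real y)) * Im (g (of_real y)) = 0"
      using arg_cong[OF sq, of Re] arg_cong[OF sq, of Im]
      unfolding Re_power2 Im_power2 Re_complex_of_real Im_complex_of_real by blast+
    have "Re (g (of_real y)) \<noteq> 0"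
    proof
      assume "Re (g (of_real y)) = 0"
      then have "A y / y\<^sup>2 = - (Im (g (of_real y)))\<^sup>2" using e(1) by simp
      then show False using pos zero_le_power2[of "Im (g (of_real y))"] by linarith
    qed
    then show ?thesis using e(2) by simp
  qed
  have contg: "isCont g 0"
    using continuous_on_interior[OF holomorphic_on_imp_continuous_on[OF g(2)], of 0] g(1) by simp
  have seq: "(\<lambda>k. r2 / (real k + 2)) \<longlonglongrightarrow> 0" by real_asymp
  have seq': "(\<lambda>k. complex_of_real (r2 / (real k + 2))) \<longlonglongrightarrow> 0"
    using tendsto_of_real[OF seq, where 'a = complex] by (simp only: of_real_0)
  have "(\<lambda>k. g (of_real (r2 / (real k + 2)))) \<longlonglongrightarrow> g 0"
    by (rule isCont_tendsto_compose[OF contg seq'])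
  then have lim: "(\<lambda>k. Im (g (of_real (r2 / (real k + 2))))) \<longlonglongrightarrow> Im (g 0)" by (rule tendsto_Im)
  have zero: "Im (g (of_real (r2 / (real k + 2)))) = 0" for k
  proof -
    have "r2 / (real k + 2) < r2 / 1" using r2(1) by (intro divide_strict_left_mono) auto
    then have "\<bar>r2 / (real k + 2)\<bar> < r2" "r2 / (real k + 2) \<noteq> 0" using r2(1) by auto
    then show ?thesis using greal by blast
  qed
  have Img0: "Im (g 0) = 0" using lim unfolding zero LIMSEQ_const_iff by (rule sym)
  have Reg0: "Re (g 0) \<noteq> 0" using g(4)[of 0] g(1) Img0 by (simp add: complex_eq_iff)

  \<comment> \<open>The sign for which the square root W z = z h z has positive derivative at 0, so
    that its inverse Y is increasing.\<close>
  define e where "e = sgn (Re (g 0))"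
  have e: "e = 1 \<or> e = -1" "e * Re (g 0) > 0" "e * e = 1" "e\<^sup>2 = 1"
    using Reg0 by (auto simp: e_def sgn_if)
  define h where "h = (\<lambda>z. of_real e * g z)"
  have holh: "h holomorphic_on ball 0 r1" unfolding h_def by (intro holomorphic_intros g(2))
  have "isCont (\<lambda>z. Re (h z)) 0"
    unfolding h_def by (intro continuous_Re continuous_mult continuous_const contg)
  then have Reh_lim: "((\<lambda>z. Re (h z)) \<longlongrightarrow> Re (h 0)) (nhds 0)"
    by (simp add: isCont_def tendsto_at_iff_tendsto_nhds[of "\<lambda>z. Re (h z)"])
  have Reh0: "0 < Re (h 0)" using e(2) by (simp add: h_def)
  have "\<forall>\<^sub>F z in nhds 0. 0 < Re (h z)" by (rule order_tendstoD(1)[OF Reh_lim Reh0])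
  then obtain r3 where r3: "0 < r3" "\<And>z. dist z 0 < r3 \<Longrightarrow> 0 < Re (h z)"
    unfolding eventually_nhds_metric by metis
  define W where "W = (\<lambda>z. z * h z)"
  have holW: "W holomorphic_on ball 0 r1" unfolding W_def by (intro holomorphic_intros holh)
  have hd: "(h has_field_derivative deriv h 0) (at 0)"
    using holomorphic_derivI[OF holh open_ball, of 0] g(1) by simp
  have "(W has_field_derivative h 0) (at 0)"
    unfolding W_def by (auto intro!: derivative_eq_intros hd)
  then have dW: "deriv W 0 = h 0" by (rule DERIV_imp_deriv)
  have h0: "h 0 \<noteq> 0" using Reh0 by auto
  have Wsq: "(W z)\<^sup>2 = Q z" if "z \<in> ball 0 r1" for z
    using g(3)[OF that] Q00 e(4) unfolding W_def h_def
    by (simp add: power_mult_distrib flip: of_real_power)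
  have dW0: "deriv W 0 \<noteq> 0" "0 \<in> ball (0::complex) r1" using dW h0 g(1) by auto
  obtain r4 where r4: "r4 > 0" "ball (0::complex) r4 \<subseteq> ball 0 r1" "open (W ` ball 0 r4)" "inj_on W (ball 0 r4)"
    by (rule has_complex_derivative_locally_invertible[OF holW dW0(2) open_ball dW0(1)])
  obtain G where G: "G holomorphic_on (W ` ball 0 r4)"
      "\<And>z. z \<in> ball 0 r4 \<Longrightarrow> deriv W z * deriv G (W z) = 1"
      "\<And>z. z \<in> ball 0 r4 \<Longrightarrow> G (W z) = z"
    using holomorphic_has_inverse[OF holomorphic_on_subset[OF holW r4(2)] open_ball r4(4)] by blast
  define \<epsilon> where "\<epsilon> = Min {r2, r3, r4} / 2"
  have \<epsilon>: "0 < \<epsilon>" "\<epsilon> < r2" "\<epsilon> < r3" "\<epsilon> < r4" using r2 r3(1) r4(1) by (auto simp: \<epsilon>_def min_def)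
  define w where "w = (\<lambda>y. y * Re (h (of_real y)))"
  have Ww: "W (of_real y) = of_real (w y)" if "\<bar>y\<bar> \<le> \<epsilon>" for y
  proof (cases "y = 0")
    case False
    then have "Im (h (of_real y)) = 0" using greal[of y] that \<epsilon> by (simp add: h_def)
    then show ?thesis by (simp add: W_def w_def complex_eq_iff)
  qed (simp add: W_def w_def)
  have hpos: "0 < Re (h (of_real y))" if "\<bar>y\<bar> \<le> \<epsilon>" for y using r3(2)[of "of_real y"] that \<epsilon> by simp
  have wcont: "continuous_on {-\<epsilon>..\<epsilon>} w"
    unfolding w_def
    by (intro continuous_intros continuous_on_compose2[OF holomorphic_on_imp_continuous_on[OF holh]])
       (use \<epsilon> r2 in auto)
  have wp: "0 < w \<epsilon>" "w (- \<epsilon>) < 0" using hpos[of \<epsilon>] hpos[of "-\<epsilon>"] \<epsilon>(1) by (auto simp: w_def mult_less_0_iff)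
  have "0 \<in> W ` ball 0 r4" using r4(1) by (intro image_eqI[of _ _ 0]) (auto simp: W_def)
  then obtain d0 where d0: "0 < d0" "ball 0 d0 \<subseteq> W ` ball 0 r4" using r4(3) open_contains_ball by blast
  \<comment> \<open>Small enough that G is defined on the ball and that every real v with |v| < d is
    a value w y with |y| \<le> \<epsilon>, by the intermediate value theorem.\<close>
  define d where "d = Min {d0, w \<epsilon>, - w (- \<epsilon>)}"
  have d: "0 < d" "d \<le> d0" "d \<le> w \<epsilon>" "d \<le> - w (- \<epsilon>)" using d0(1) wp by (auto simp: d_def)
  have holG: "G holomorphic_on ball 0 d" using G(1) d0(2) d(2) by (meson holomorphic_on_subset order_trans subset_ball)
  define Y where "Y = (\<lambda>v. Re (G (of_real v)))"
  define Yd where "Yd = (\<lambda>v. Re (deriv G (of_real v)))"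
  have GY: "G (of_real v) = of_real (Y v) \<and> \<bar>Y v\<bar> \<le> \<epsilon> \<and> w (Y v) = v" if v: "\<bar>v\<bar> < d" for v
  proof -
    have "w (-\<epsilon>) \<le> v" "v \<le> w \<epsilon>" using v d by (auto simp: abs_less_iff)
    then obtain y where y: "-\<epsilon> \<le> y" "y \<le> \<epsilon>" "w y = v"
      using IVT'[of w "-\<epsilon>" v \<epsilon>] wcont \<epsilon>(1) by auto
    then have "G (of_real v) = of_real y"
      using Ww[of y] G(3)[of "of_real y"] \<epsilon> by auto
    then show ?thesis using y by (auto simp: Y_def)
  qed
  have Yder: "(Y has_real_derivative Yd v) (at v)" if "\<bar>v\<bar> < d" for v
  proof -
    have "(G has_field_derivative deriv G (of_real v)) (at (of_real v))"
      using holomorphic_derivI[OF holG open_ball, of "of_real v"] that by simp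
    from bounded_linear.has_vector_derivative[OF bounded_linear_Re has_vector_derivative_real_field[OF this]]
    show ?thesis unfolding Y_def Yd_def has_real_derivative_iff_has_vector_derivative by simp
  qed
  have Ydc: "continuous_on {- d<..<d} Yd"
    unfolding Yd_def
    by (intro continuous_intros continuous_on_compose2[OF holomorphic_on_imp_continuous_on[OF holomorphic_deriv[OF holG open_ball]]])
       auto
  have Y0: "Y 0 = 0"
    using GY[of 0] hpos[of "Y 0"] d(1) by (auto simp: w_def)
  \<comment> \<open>Y inverts the square root of Q, so A (Y u) = u^2; differentiating this gives the
    equation.\<close>
  have eq: "Y v * qr (Y v) * Yd v = v" if v: "\<bar>v\<bar> < d" for v
  proof -
    have AY: "A (Y u) = u\<^sup>2" if "\<bar>u\<bar> < d" for u
    proof -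
      note G1 = GY[OF that]
      have "of_real (Y u) \<in> ball (0::complex) r1" "\<bar>Y u\<bar> < r0" using G1 \<epsilon> r2 by auto
      then have "of_real (A (Y u)) = (W (of_real (Y u)))\<^sup>2" using Wsq QA by simp
      also have "\<dots> = of_real (u\<^sup>2)" using Ww[of "Y u"] G1 by simp
      finally show ?thesis using of_real_eq_iff by blast
    qed
    have "\<bar>Y v\<bar> < r0" using GY[OF v] \<epsilon> r2 by auto
    then have 1: "((\<lambda>u. A (Y u)) has_real_derivative 2 * Y v * qr (Y v) * Yd v) (at v)"
      by (intro DERIV_chain2[OF Ad Yder[OF v]])
    have "((\<lambda>u. u\<^sup>2) has_real_derivative 2 * v) (at v)" by (auto intro!: derivative_eq_intros)
    then have "((\<lambda>u. A (Y u)) has_real_derivative 2 * v) (at v)"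
      by (rule has_field_derivative_transform_within_open[where S = "{- d<..<d}"])
         (use AY v in \<open>auto simp: abs_less_iff\<close>)
    from DERIV_unique[OF 1 this] show ?thesis by simp
  qed
  \<comment> \<open>At 0 the derivative of the inverse function is 1 / h 0. Elsewhere w (Y v) = v
    and \<open>eq\<close> give Re h = qr Yd at Y v, where both Re h and qr are positive.\<close>
  have Ydpos: "0 < Yd v" if v: "\<bar>v\<bar> < d" for v
  proof (cases "v = 0")
    case True
    have "h 0 * deriv G 0 = 1" using G(2)[of 0] r4(1) dW by (simp add: W_def)
    then have "Re (h 0) * Re (deriv G 0) - Im (h 0) * Im (deriv G 0) = 1"
      by (simp flip: times_complex.sel(1))
    moreover have "Im (h 0) = 0" using Img0 by (simp add: h_def)
    ultimately have "Re (h 0) * Re (deriv G 0) = 1" by simp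
    then have "0 < Re (deriv G 0)" using Reh0 by (metis zero_less_mult_pos zero_less_one)
    then show ?thesis using True by (simp add: Yd_def)
  next
    case False
    note G1 = GY[OF v]
    have hp: "0 < Re (h (of_real (Y v)))" using hpos G1 by blast
    have q: "0 < qr (Y v)" using qpos[of "Y v"] G1 \<epsilon> r2 by auto
    have Yn: "Y v \<noteq> 0" using G1 False by (auto simp: w_def)
    have "Y v * Re (h (of_real (Y v))) = Y v * qr (Y v) * Yd v" using G1 eq[OF v] unfolding w_def by simp
    then have "Re (h (of_real (Y v))) = qr (Y v) * Yd v" using Yn by simp
    then show ?thesis using hp q by (metis zero_less_mult_pos)
  qed
  show ?thesis
  proof (rule that[of d Y Yd G])
    show "\<bar>Y v\<bar> < r0" if "\<bar>v\<bar> < d" for v using GY[OF that] \<epsilon> r2 by linarith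
    show "G (complex_of_real v) = complex_of_real (Y v)" if "\<bar>v\<bar> < d" for v using GY[OF that] by blast
  qed (fact d(1) Y0 Yder Ydc Ydpos eq holG)+
qed

lemma half_chart_exists:
  fixes s l n :: real
  assumes s: "s = 1 \<or> s = -1"
  obtains d Y Yd G where "half_chart s l n d Y Yd" "G holomorphic_on ball 0 d"
    "\<And>v. \<bar>v\<bar> < d \<Longrightarrow> G (complex_of_real v) = complex_of_real (Y v)"
proof -
  \<comment> \<open>For |y| < r0 both 1 - s y and 1 - n s y are at least 1/2.\<close>
  define r0 where "r0 = 1 / (2 * (\<bar>n\<bar> + 1))"
  have r0: "0 < r0" "r0 \<le> 1/2" by (auto simp: r0_def field_simps)
  have nr0: "\<bar>n\<bar> * r0 \<le> 1/2" by (auto simp: r0_def field_simps)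
  define q where "q = (\<lambda>z::complex. (1 - of_real (n * s) * z) * (1 - of_real s * z) powr of_real (2 * l - 1))"
  define qr where "qr = (\<lambda>y. (1 - n * s * y) * (1 - s * y) powr (2 * l - 1))"
  have half: "1/2 \<le> 1 - s * y \<and> 1/2 \<le> 1 - n * s * y \<and> \<bar>n * y\<bar> \<le> 1/2 \<and> \<bar>y\<bar> \<le> 1/2" if "\<bar>y\<bar> < r0" for y
  proof -
    have "\<bar>n * y\<bar> \<le> \<bar>n\<bar> * r0" unfolding abs_mult using that by (intro mult_left_mono) auto
    then have "\<bar>n * y\<bar> \<le> 1/2" using nr0 by linarith
    then show ?thesis using that r0(2) s by auto
  qed
  have nonp: "1 - of_real s * z \<notin> \<real>\<^sub>\<le>\<^sub>0" if "z \<in> ball 0 r0" for z :: complex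
  proof -
    have "\<bar>Re z\<bar> < 1" using that r0(2) abs_Re_le_cmod[of z] by auto
    then have "0 < Re (1 - of_real s * z)" using s by auto
    then show ?thesis by (auto simp: complex_nonpos_Reals_iff)
  qed
  have holq: "q holomorphic_on ball 0 r0"
    unfolding q_def using nonp by (intro holomorphic_intros) auto
  have qr: "q (of_real y) = of_real (qr y)" if "\<bar>y\<bar> < r0" for y
  proof -
    have "(1 - of_real s * of_real y) powr complex_of_real (2 * l - 1) = of_real ((1 - s * y) powr (2 * l - 1))"
      using half[OF that] powr_of_real[of "1 - s * y" "2 * l - 1"] by simp
    then show ?thesis by (simp add: q_def qr_def)
  qed
  have qpos: "0 < qr y" if "\<bar>y\<bar> < r0" for y
    unfolding qr_def using half[OF that] by auto
  obtain d Y Yd G where dY: "0 < d" "Y 0 = 0"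
    "\<And>v. \<bar>v\<bar> < d \<Longrightarrow> (Y has_real_derivative Yd v) (at v)"
    "continuous_on {- d<..<d} Yd" "\<And>v. \<bar>v\<bar> < d \<Longrightarrow> 0 < Yd v" "\<And>v. \<bar>v\<bar> < d \<Longrightarrow> \<bar>Y v\<bar> < r0"
    "\<And>v. \<bar>v\<bar> < d \<Longrightarrow> Y v * qr (Y v) * Yd v = v"
    "G holomorphic_on ball 0 d" "\<And>v. \<bar>v\<bar> < d \<Longrightarrow> G (complex_of_real v) = complex_of_real (Y v)"
    using holomorphic_square_root_inverse[OF r0(1) holq qr qpos] by metis
  have "half_chart s l n d Y Yd"
  proof
    show "\<bar>Y v\<bar> \<le> 1 / 2 \<and> \<bar>n * Y v\<bar> \<le> 1 / 2" if "\<bar>v\<bar> < d" for v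
      using half dY(6)[OF that] by blast
    show "Y v * (1 - n * s * Y v) * (1 - s * Y v) powr (2 * l - 1) * Yd v = v" if "\<bar>v\<bar> < d" for v
      using dY(7)[OF that] by (simp add: qr_def mult.assoc)
  qed (use s dY in auto)
  then show ?thesis using that dY(8,9) by blast
qed

section \<open>Derivative, tameness and complex extension of \<open>psi\<close>\<close>

context half_chart
begin

text \<open>\<open>Y_eq\<close> with the power (1 - s Y)^(2 l - 1) absorbed into psi^2. No exponent
  depending on l remains visible, which makes the later comparison of two charts algebraic.\<close>

lemma Y_Yd_psi:
  assumes v: "\<bar>v\<bar> < d"
  shows "Y v * Yd v = v * (psi v)\<^sup>2 * ((1 - s * Y v) * (1 - n * s * Y v))"
proof -
  define p where "p = 1 - s * Y v"
  define q where "q = 1 - n * s * Y v"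
  have pq: "0 < p" "0 < q" using factors_pos[OF v] by (auto simp: p_def q_def)
  have 1: "p powr (2 * l - 1) * (p powr (- l) * p powr (- l)) * p = 1"
    using pq by (simp add: powr_add[symmetric] powr_mult_base mult.commute[of _ p])
  have "v * (psi v)\<^sup>2 * (p * q) = Y v * q * p powr (2 * l - 1) * Yd v * (p powr (- l) / q)\<^sup>2 * (p * q)"
    using Y_eq[OF v] unfolding psi_def p_def[symmetric] q_def[symmetric] by simp
  also have "\<dots> = Y v * Yd v * (p powr (2 * l - 1) * (p powr (- l) * p powr (- l)) * p)"
    using pq by (simp add: power2_eq_square field_simps)
  finally have "v * (psi v)\<^sup>2 * (p * q) = Y v * Yd v" unfolding 1 by (simp only: mult_1_right)
  then show ?thesis by (simp only: p_def q_def)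
qed

text \<open>From the logarithmic derivative s Yd (l / (1 - s Y) + n / (1 - n s Y)), put over a
  common denominator. For v \<noteq> 0, \<open>Y_Yd_psi\<close> turns it into v psi^3 s (l + n - n
  (l + 1) s Y) / Y.\<close>

definition psi' :: "real \<Rightarrow> real" where
  "psi' v = psi v * (s * (l + n - n * (l + 1) * s * Y v)) / ((1 - s * Y v) * (1 - n * s * Y v)) * Yd v"

lemma psi_deriv:
  assumes v: "\<bar>v\<bar> < d"
  shows "(psi has_real_derivative psi' v) (at v)"
proof -
  define p where "p = 1 - s * Y v"
  define q where "q = 1 - n * s * Y v"
  have pq: "0 < p" "0 < q" using factors_pos[OF v] by (auto simp: p_def q_def)
  have "(psi has_real_derivative ((- l) * p powr (- l - 1) * (- s * Yd v) * q - p powr (- l) * (- n * s * Yd v)) / (q * q)) (at v)"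
    unfolding psi_def[abs_def] p_def q_def
    using pq unfolding p_def q_def
    by (auto intro!: derivative_eq_intros Y_deriv[OF v])
  moreover have "((- l) * p powr (- l - 1) * (- s * Yd v) * q - p powr (- l) * (- n * s * Yd v)) / (q * q) = psi' v"
  proof -
    have e: "p powr (- l - 1) = p powr (- l) / p" using pq by (simp add: powr_diff)
    have sum: "l * q + n * p = l + n - n * (l + 1) * s * Y v" by (simp add: p_def q_def algebra_simps)
    have "((- l) * p powr (- l - 1) * (- s * Yd v) * q - p powr (- l) * (- n * s * Yd v)) / (q * q)
        = p powr (- l) / q * (s * (l * q + n * p)) / (p * q) * Yd v"
      unfolding e using pq by (simp add: field_simps)
    also have "\<dots> = p powr (- l) / q * (s * (l + n - n * (l + 1) * s * Y v)) / (p * q) * Yd v"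
      unfolding sum ..
    finally show ?thesis unfolding psi'_def psi_def p_def q_def .
  qed
  ultimately show ?thesis by simp
qed

lemma psi_0: "psi 0 = 1" by (simp add: psi_def Y0)

text \<open>\<open>Y_eq\<close> reads 0 = 0 at v = 0. Divided by v, it becomes (Yd 0)^2 = 1 in the
  limit, and Yd is positive.\<close>

lemma Yd_0: "Yd 0 = 1"
proof -
  have q: "((\<lambda>v. Y v / v) \<longlongrightarrow> Yd 0) (at 0)"
    using Y_deriv[of 0] d Y0 by (simp add: has_field_derivative_iff)
  have cp: "isCont (\<lambda>v. (1 - n * s * Y v) * (1 - s * Y v) powr (2 * l - 1) * Yd v) 0"
  proof -
    have "isCont Y 0" using Y_deriv[of 0] d DERIV_isCont by auto
    moreover have "isCont Yd 0" using continuous_on_interior[OF Yd_cont, of 0] d by simp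
    ultimately show ?thesis using Y0 by (intro continuous_intros) auto
  qed
  then have "((\<lambda>v. (1 - n * s * Y v) * (1 - s * Y v) powr (2 * l - 1) * Yd v) \<longlongrightarrow> Yd 0) (at 0)"
    using Y0 by (simp add: isCont_def)
  from tendsto_mult[OF q this]
  have lim: "((\<lambda>v. Y v / v * ((1 - n * s * Y v) * (1 - s * Y v) powr (2 * l - 1) * Yd v)) \<longlongrightarrow> Yd 0 * Yd 0) (at 0)" .
  have ev: "\<forall>\<^sub>F v in at 0. Y v / v * ((1 - n * s * Y v) * (1 - s * Y v) powr (2 * l - 1) * Yd v) = 1"
    unfolding eventually_at
  proof (intro exI[of _ d] conjI ballI impI)
    fix v :: real assume "v \<noteq> 0 \<and> dist v 0 < d"
    then show "Y v / v * ((1 - n * s * Y v) * (1 - s * Y v) powr (2 * l - 1) * Yd v) = 1"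
      using Y_eq[of v] by (simp add: field_simps)
  qed (use d in auto)
  have "((\<lambda>v::real. 1::real) \<longlongrightarrow> Yd 0 * Yd 0) (at 0)"
    using lim unfolding tendsto_cong[OF ev] .
  then have "Yd 0 * Yd 0 = 1" by (simp add: tendsto_const_iff)
  then have "Yd 0 = 1 \<or> Yd 0 = -1" by (simp only: square_eq_1_iff)
  then show ?thesis using Yd_pos[of 0] d by auto
qed

lemma psi_cont: "continuous_on {- d<..<d} psi"
  by (rule continuous_at_imp_continuous_on) (use psi_deriv DERIV_isCont in \<open>fastforce simp: abs_less_iff\<close>)

lemma psi'_cont: "continuous_on {- d<..<d} psi'"
proof -
  have "(1 - s * Y v) * (1 - n * s * Y v) \<noteq> 0" if "v \<in> {- d<..<d}" for v
    using factors_pos[of v] that by (auto simp: abs_less_iff)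
  then show ?thesis
    unfolding psi'_def[abs_def] by (intro continuous_intros psi_cont Y_cont Yd_cont) auto
qed

text \<open>B bounds the derivative of m v psi v on [0, d/2], and w \<le> 1 / (100 (B + 1)) makes B
  w small. The conclusion covers all smaller u, so that two charts can agree on one radius.\<close>

lemma tame_lienard:
  obtains B w where "0 < w" "w < d" "\<And>u. 0 < u \<Longrightarrow> u \<le> w \<Longrightarrow> tame u B (\<lambda>v. m * v * psi v)"
proof -
  let ?f' = "\<lambda>v. m * psi v + m * v * psi' v"
  have fder: "((\<lambda>v. m * v * psi v) has_real_derivative ?f' v) (at v)" if "\<bar>v\<bar> < d" for v
    by (auto intro!: derivative_eq_intros psi_deriv[OF that] simp: algebra_simps)
  have "continuous_on {0..d/2} ?f'"
    using d by (intro continuous_intros continuous_on_subset[OF psi_cont] continuous_on_subset[OF psi'_cont]) auto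
  then have "compact (?f' ` {0..d/2})" by (intro compact_continuous_image) auto
  then obtain B where B: "\<And>v. v \<in> {0..d/2} \<Longrightarrow> \<bar>?f' v\<bar> \<le> B"
    using compact_imp_bounded bounded_iff by (metis (no_types, lifting) image_eqI real_norm_def)
  have B0: "0 \<le> B" using B[of 0] d by force
  define w where "w = min (d/2) (1 / (100 * (B + 1)))"
  have w: "0 < w" "w \<le> d/2" "w < d" using d B0 by (auto simp: w_def)
  have Bw: "B * w \<le> 1/100"
  proof -
    have "B * w \<le> B * (1 / (100 * (B + 1)))" using B0 by (intro mult_left_mono) (auto simp: w_def)
    also have "\<dots> \<le> 1/100" using B0 by (simp add: field_simps)
    finally show ?thesis .
  qed
  show ?thesis
  proof (rule that[OF w(1,3)])
    fix u assume u: "0 < u" "u \<le> w"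
    have "\<bar>m * x * psi x - m * y * psi y\<bar> \<le> B * \<bar>x - y\<bar>" if "x \<in> {0..u}" "y \<in> {0..u}" for x y
    proof -
      have "norm (m * x * psi x - m * y * psi y) \<le> B * norm (x - y)"
      proof (rule field_differentiable_bound[of "{0..d/2}" _ ?f'])
        show "((\<lambda>v. m * v * psi v) has_field_derivative ?f' z) (at z within {0..d/2})" if "z \<in> {0..d/2}" for z
          using fder[of z] that d by (auto intro: has_field_derivative_at_within)
      qed (use that u w B in auto)
      then show ?thesis by simp
    qed
    moreover have "B * u \<le> 1/100" using mult_left_mono[OF u(2) B0] Bw by linarith
    ultimately show "tame u B (\<lambda>v. m * v * psi v)" unfolding tame_def using u B0 by auto
  qed
qed

lemma psi_holomorphic_extension:
  assumes G: "G holomorphic_on ball 0 d" "\<And>v. \<bar>v\<bar> < d \<Longrightarrow> G (complex_of_real v) = complex_of_real (Y v)"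
  obtains e P where "0 < e" "e \<le> d" "P holomorphic_on ball 0 e"
    "\<And>v. \<bar>v\<bar> < e \<Longrightarrow> P (complex_of_real v) = complex_of_real (psi v)"
proof -
  have "isCont G 0"
    using continuous_on_interior[OF holomorphic_on_imp_continuous_on[OF G(1)], of 0] d by simp
  moreover have "G 0 = 0" using G(2)[of 0] d Y0 by simp
  ultimately have lim: "(G \<longlongrightarrow> 0) (nhds 0)"
    by (metis isCont_def tendsto_at_iff_tendsto_nhds)
  \<comment> \<open>|G| < 1 keeps 1 - s G in the right half plane, off the branch cut of the power;
    |n G| < 1 keeps the denominator away from 0.\<close>
  define \<rho> where "\<rho> = 1 / (\<bar>n\<bar> + 1)"
  have \<rho>: "0 < \<rho>" by (simp add: \<rho>_def)
  have "\<forall>\<^sub>F z in nhds 0. dist (G z) 0 < \<rho>" by (rule tendstoD[OF lim \<rho>])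
  then obtain e0 where e0: "0 < e0" "\<And>z. dist z 0 < e0 \<Longrightarrow> dist (G z) 0 < \<rho>"
    unfolding eventually_nhds_metric by metis
  define e where "e = min e0 d"
  have e: "0 < e" "e \<le> d" "e \<le> e0" using e0(1) d by (auto simp: e_def)
  have Gsm: "norm (G z) < 1 \<and> norm (of_real n * G z) < 1" if "z \<in> ball 0 e" for z
  proof -
    have "norm (G z) < \<rho>" using e0(2)[of z] that e by simp
    moreover have "\<rho> \<le> 1" "\<bar>n\<bar> * \<rho> < 1" by (auto simp: \<rho>_def field_simps)
    moreover have "norm (of_real n * G z) \<le> \<bar>n\<bar> * \<rho>"
      unfolding norm_mult using \<open>norm (G z) < \<rho>\<close> by (auto intro!: mult_mono)
    ultimately show ?thesis by linarith
  qed
  have nonp: "1 - of_real s * G z \<notin> \<real>\<^sub>\<le>\<^sub>0" if "z \<in> ball 0 e" for z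
  proof -
    have "\<bar>Re (G z)\<bar> < 1" using Gsm[OF that] abs_Re_le_cmod[of "G z"] by linarith
    then have "0 < Re (1 - of_real s * G z)" using s by auto
    then show ?thesis by (auto simp: complex_nonpos_Reals_iff)
  qed
  have ne: "1 - of_real (n * s) * G z \<noteq> 0" if "z \<in> ball 0 e" for z
  proof
    assume "1 - of_real (n * s) * G z = 0"
    then have "norm (of_real (n * s) * G z) = 1" by (metis eq_iff_diff_eq_0 norm_one)
    moreover have "norm (of_real (n * s) * G z) = norm (of_real n * G z)"
      using s by (auto simp: norm_mult)
    ultimately show False using Gsm[OF that] by simp
  qed
  have holG: "G holomorphic_on ball 0 e" using G(1) e by (meson holomorphic_on_subset subset_ball)
  define P where "P = (\<lambda>z. (1 - of_real s * G z) powr of_real (- l) / (1 - of_real (n * s) * G z))"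
  show ?thesis
  proof (rule that[OF e(1,2), of P])
    show "P holomorphic_on ball 0 e"
      unfolding P_def by (intro holomorphic_intros holG) (use nonp ne in auto)
    show "P (complex_of_real v) = complex_of_real (psi v)" if "\<bar>v\<bar> < e" for v
    proof -
      have v: "\<bar>v\<bar> < d" using that e by simp
      have "(1 - of_real s * of_real (Y v)) powr complex_of_real (- l) = of_real ((1 - s * Y v) powr (- l))"
        using factors_pos[OF v] powr_of_real[of "1 - s * Y v" "- l"] by simp
      then show ?thesis unfolding P_def psi_def G(2)[OF v] by simp
    qed
  qed
qed

end

text \<open>If zeros of F accumulate at 0 from the right, the identity theorem makes F vanish on
  both sides of 0, which is what a comparison of derivatives at 0 requires. Otherwise F has no zero
  on some interval (0, e) and keeps its sign there.\<close>

lemma analytic_sign_trichotomy: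
  fixes F :: "real \<Rightarrow> real"
  assumes d: "0 < d" and hol: "P holomorphic_on ball 0 d"
    and ext: "\<And>v. \<bar>v\<bar> < d \<Longrightarrow> P (complex_of_real v) = complex_of_real (F v)"
  obtains e where "0 < e" "e \<le> d"
    "(\<forall>v. \<bar>v\<bar> < e \<longrightarrow> F v = 0) \<or> (\<forall>v. 0 < v \<longrightarrow> v < e \<longrightarrow> 0 < F v) \<or> (\<forall>v. 0 < v \<longrightarrow> v < e \<longrightarrow> F v < 0)"
proof (cases "(0::complex) islimpt {of_real v |v. 0 < v \<and> v < d \<and> F v = 0}")
  case True
  have "P w = 0" if "w \<in> ball 0 d" for w
    by (rule analytic_continuation[OF hol open_ball connected_ball _ _ True _ that])
       (use ext d in auto)
  then have "F v = 0" if "\<bar>v\<bar> < d" for v using ext[OF that] that by simp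
  then show ?thesis using that[of d] d by blast
next
  case False
  then obtain e0 where e0: "0 < e0" "\<forall>x\<in>{of_real v |v. 0 < v \<and> v < d \<and> F v = 0}. x \<noteq> 0 \<longrightarrow> \<not> dist x (0::complex) < e0"
    unfolding islimpt_approachable by blast
  define e where "e = min e0 d"
  have e: "0 < e" "e \<le> d" "e \<le> e0" using e0 d by (auto simp: e_def)
  have ne: "F v \<noteq> 0" if "0 < v" "v < e" for v
  proof
    assume "F v = 0"
    then have "complex_of_real v \<in> {of_real v |v. 0 < v \<and> v < d \<and> F v = 0}" using that e by auto
    then show False using e0(2) that e by force
  qed
  have cont: "continuous_on {0<..<e} F"
  proof -
    have "continuous_on {0<..<e} (\<lambda>v. Re (P (of_real v)))"
      by (intro continuous_intros continuous_on_compose2[OF holomorphic_on_imp_continuous_on[OF hol]])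
         (use e in auto)
    then show ?thesis by (rule continuous_on_eq) (use ext e in auto)
  qed
  have conn: "connected (F ` {0<..<e})" by (rule connected_continuous_image[OF cont]) simp
  have "(\<forall>v. 0 < v \<longrightarrow> v < e \<longrightarrow> 0 < F v) \<or> (\<forall>v. 0 < v \<longrightarrow> v < e \<longrightarrow> F v < 0)"
  proof (rule ccontr)
    assume "\<not> ?thesis"
    then obtain u w where uw: "0 < u" "u < e" "F u \<le> 0" "0 < w" "w < e" "0 \<le> F w" by force
    have "0 \<in> F ` {0<..<e}"
      by (rule connected_contains_Icc[OF conn, of "F u" "F w", THEN subsetD]) (use uw in auto)
    then show False using ne by force
  qed
  then show ?thesis using that[of e] e by blast
qed

section \<open>Coincidence of the two Lienard functions\<close>

lemma cubic_coefficients_zero: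
  fixes a1 a2 a3 :: real
  assumes "infinite T" "\<And>t. t \<in> T \<Longrightarrow> a1 * t + a2 * t\<^sup>2 + a3 * t ^ 3 = 0"
  shows "a1 = 0 \<and> a2 = 0 \<and> a3 = 0"
proof -
  have "poly [:0, a1, a2, a3:] t = 0" if "t \<in> T" for t
    using assms(2)[OF that] by (simp add: power2_eq_square power3_eq_cube algebra_simps)
  then have "T \<subseteq> {t. poly [:0, a1, a2, a3:] t = 0}" by blast
  then have "infinite {t. poly [:0, a1, a2, a3:] t = 0}" using assms(1) infinite_super by blast
  then have "[:0, a1, a2, a3:] = 0" using poly_roots_finite by blast
  then show ?thesis by simp
qed

locale chart_pair = A: half_chart 1 l1 n1 d1 Y1 Yd1 + B: half_chart "-1" l2 n2 d2 Y2 Yd2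
  for l1 n1 d1 Y1 Yd1 l2 n2 d2 Y2 Yd2
begin

text \<open>With \<open>S = l1 + n1\<close> nonzero, \<open>1 / Y2 = 1 / Y1 - k\<close> for a constant \<open>k\<close>; comparing the differentials then
  gives a polynomial identity in \<open>Y1\<close>, whose coefficients leave only \<open>k = 1\<close>.\<close>

lemma parameters_of_psi_eq:
  assumes e: "0 < e" "e \<le> d1" "e \<le> d2" and eq: "\<And>v. \<bar>v\<bar> < e \<Longrightarrow> A.psi v = B.psi v"
  shows "(l1 - l2 = 0 \<and> l1 + n2 = 0 \<and> l1 + n1 = 0) \<or> (l1 + l2 + 1 = 0 \<and> n1 + n2 - 1 = 0)"
proof -
  have lt: "\<bar>v\<bar> < d1" "\<bar>v\<bar> < d2" if "\<bar>v\<bar> < e" for v using that e by auto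
  have deq: "A.psi' v = B.psi' v" if v: "\<bar>v\<bar> < e" for v
  proof -
    have "(A.psi has_real_derivative B.psi' v) (at v)"
      by (rule has_field_derivative_transform_within_open[OF B.psi_deriv[OF lt(2)[OF v]], of "{-e<..<e}"])
         (use v eq in \<open>auto simp: abs_less_iff\<close>)
    then show ?thesis using A.psi_deriv[OF lt(1)[OF v]] DERIV_unique by blast
  qed
  define S where "S = l1 + n1"
  \<comment> \<open>Equality of the derivatives at v = 0, where psi' 0 = s (l + n).\<close>
  have S2: "l2 + n2 = - S"
    using deq[of 0] e by (simp add: A.psi'_def B.psi'_def A.psi_0 B.psi_0 A.Y0 B.Y0 A.Yd_0 B.Yd_0 S_def)
  define c1 where "c1 = n1 * (l1 + 1)"
  define c2 where "c2 = n2 * (l2 + 1)"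
  have rel: "(S - c1 * Y1 v) * Y2 v = (S - c2 * Y2 v) * Y1 v"
    and pos: "0 < Y1 v" "0 < Y2 v"
    and Yrel: "Y1 v * Yd1 v * ((1 + Y2 v) * (1 + n2 * Y2 v)) = Y2 v * Yd2 v * ((1 - Y1 v) * (1 - n1 * Y1 v))"
    if v: "0 < v" "v < e" for v
  proof -
    have v': "\<bar>v\<bar> < e" "\<bar>v\<bar> < d1" "\<bar>v\<bar> < d2" using v e by auto
    show p: "0 < Y1 v" "0 < Y2 v" using A.Y_pos B.Y_pos v v' by auto
    define E1 where "E1 = (1 - Y1 v) * (1 - n1 * Y1 v)"
    define E2 where "E2 = (1 + Y2 v) * (1 + n2 * Y2 v)"
    define K where "K = v * (A.psi v)\<^sup>2"
    have E: "0 < E1" "0 < E2"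
      using A.factors_pos[OF v'(2)] B.factors_pos[OF v'(3)] unfolding E1_def E2_def
      by (auto intro!: mult_pos_pos)
    have ps: "0 < A.psi v" by (rule A.psi_pos[OF v'(2)])
    have K: "0 < K" using ps v by (simp add: K_def)
    have a1: "Y1 v * Yd1 v = K * E1" and a2: "Y2 v * Yd2 v = K * E2"
      using A.Y_Yd_psi[OF v'(2)] B.Y_Yd_psi[OF v'(3)] unfolding eq[OF v'(1)] K_def E1_def E2_def by simp_all
    show "Y1 v * Yd1 v * ((1 + Y2 v) * (1 + n2 * Y2 v)) = Y2 v * Yd2 v * ((1 - Y1 v) * (1 - n1 * Y1 v))"
      unfolding a1 a2 E1_def[symmetric] E2_def[symmetric] by simp
    \<comment> \<open>Both derivatives share the factor psi, and Yd = K E / Y with the same K = v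
      psi^2 on both sides. After cancelling, only an algebraic relation between Y1 and Y2 is
      left.\<close>
    have "A.psi v * ((S - c1 * Y1 v) / E1 * Yd1 v) = A.psi v * ((S - c2 * Y2 v) / E2 * Yd2 v)"
    proof -
      have "1 * (l1 + n1 - n1 * (l1 + 1) * 1 * Y1 v) = S - c1 * Y1 v" by (simp add: S_def c1_def)
      moreover have "(1 - 1 * Y1 v) * (1 - n1 * 1 * Y1 v) = E1" by (simp add: E1_def)
      ultimately have "A.psi' v = A.psi v * (S - c1 * Y1 v) / E1 * Yd1 v" unfolding A.psi'_def by (simp only:)
      moreover have "-1 * (l2 + n2 - n2 * (l2 + 1) * -1 * Y2 v) = S - c2 * Y2 v"
        unfolding S2 c2_def by simp
      moreover have "(1 - -1 * Y2 v) * (1 - n2 * -1 * Y2 v) = E2" by (simp add: E2_def)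
      ultimately have "B.psi' v = B.psi v * (S - c2 * Y2 v) / E2 * Yd2 v" unfolding B.psi'_def by (simp only:)
      then show ?thesis
        using \<open>A.psi' v = A.psi v * (S - c1 * Y1 v) / E1 * Yd1 v\<close>
        unfolding deq[OF v'(1)] eq[OF v'(1)] by (simp only: times_divide_eq_right times_divide_eq_left mult.assoc)
    qed
    then have "(S - c1 * Y1 v) / E1 * Yd1 v = (S - c2 * Y2 v) / E2 * Yd2 v"
      using ps by (simp only: mult_left_cancel[OF less_imp_neq[OF ps, symmetric]])
    moreover have "Yd1 v = K * E1 / Y1 v" "Yd2 v = K * E2 / Y2 v" unfolding a1[symmetric] a2[symmetric] using p by simp_all
    ultimately have "(S - c1 * Y1 v) / E1 * (K * E1 / Y1 v) = (S - c2 * Y2 v) / E2 * (K * E2 / Y2 v)" by simp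
    moreover have "(S - c1 * Y1 v) / E1 * (K * E1 / Y1 v) = K * ((S - c1 * Y1 v) / Y1 v)"
      "(S - c2 * Y2 v) / E2 * (K * E2 / Y2 v) = K * ((S - c2 * Y2 v) / Y2 v)"
      using E by simp_all
    ultimately have "K * ((S - c1 * Y1 v) / Y1 v) = K * ((S - c2 * Y2 v) / Y2 v)" by (simp only:)
    then have "(S - c1 * Y1 v) / Y1 v = (S - c2 * Y2 v) / Y2 v"
      by (simp only: mult_left_cancel[OF less_imp_neq[OF K, symmetric]])
    then show "(S - c1 * Y1 v) * Y2 v = (S - c2 * Y2 v) * Y1 v" using frac_eq_eq[of "Y1 v" "Y2 v"] p by auto
  qed
  show ?thesis
  proof (cases "S = 0")
    case True
    have v: "0 < e/2" "e/2 < e" using e by auto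
    have "c1 = c2" using rel[OF v] pos[OF v] True by simp
    moreover have "n1 = - l1" "n2 = - l2" using True S2 by (auto simp: S_def)
    ultimately have "(l1 - l2) * (l1 + l2 + 1) = 0" by (simp add: c1_def c2_def algebra_simps)
    then show ?thesis using \<open>n1 = - l1\<close> \<open>n2 = - l2\<close> by auto
  next
    case False
    define k where "k = (c1 - c2) / S"
    have kS: "k * S = c1 - c2" using False by (simp add: k_def)
    have Y21: "Y2 v * (1 - k * Y1 v) = Y1 v" if v: "0 < v" "v < e" for v
    proof -
      have "S * (Y2 v * (1 - k * Y1 v)) = S * Y2 v - (k * S) * (Y1 v * Y2 v)" by (simp add: algebra_simps)
      also have "\<dots> = S * Y1 v" using rel[OF v] unfolding kS by (simp add: algebra_simps)
      finally show ?thesis using False by simp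
    qed
    have poly: "(1 - k * Y1 v) * (1 - (k - 1) * Y1 v) * (1 - (k - n2) * Y1 v) = (1 - Y1 v) * (1 - n1 * Y1 v)"
      if v: "0 < v" "v < e" for v
    proof -
      have v': "\<bar>v\<bar> < d1" "\<bar>v\<bar> < d2" using v e by auto
      note p = pos[OF v]
      \<comment> \<open>D = Y1 / Y2. Differentiating Y2 D = Y1 gives Yd2 D^2 = Yd1, and multiplying
        \<open>Yrel\<close> by D^3 then eliminates Y2.\<close>
      define D where "D = 1 - k * Y1 v"
      have YD: "Y2 v * D = Y1 v" using Y21[OF v] by (simp add: D_def)
      then have "0 < Y2 v * D" using p(1) by simp
      then have D: "0 < D" using p(2) by (rule zero_less_mult_pos)
      have "((\<lambda>v. Y2 v * (1 - k * Y1 v)) has_real_derivative Yd2 v * D - k * Y2 v * Yd1 v) (at v)"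
        unfolding D_def by (auto intro!: derivative_eq_intros A.Y_deriv[OF v'(1)] B.Y_deriv[OF v'(2)] simp: algebra_simps)
      then have "(Y1 has_real_derivative Yd2 v * D - k * Y2 v * Yd1 v) (at v)"
        by (rule has_field_derivative_transform_within_open[where S = "{0<..<e}"]) (use Y21 v in auto)
      then have "Yd1 v = Yd2 v * D - k * Y2 v * Yd1 v"
        using A.Y_deriv[OF v'(1)] DERIV_unique by blast
      then have "Yd2 v * D = Yd1 v + k * Y2 v * Yd1 v" by linarith
      then have "Yd2 v * D * D = (Yd1 v + k * Y2 v * Yd1 v) * D" by (simp only:)
      also have "\<dots> = Yd1 v * (D + k * (Y2 v * D))" by (simp add: algebra_simps)
      also have "D + k * (Y2 v * D) = 1" unfolding YD by (simp add: D_def)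
      finally have YdD: "Yd2 v * D * D = Yd1 v" by (simp only: mult_1_right)
      have "Y2 v * Yd2 v * ((1 - Y1 v) * (1 - n1 * Y1 v)) * (D * D * D) =
            Y1 v * Yd1 v * ((1 + Y2 v) * D) * ((1 + n2 * Y2 v) * D) * D"
        unfolding Yrel[OF v, symmetric] by (simp add: mult_ac)
      moreover have "Y2 v * Yd2 v * ((1 - Y1 v) * (1 - n1 * Y1 v)) * (D * D * D) =
          (Y2 v * D) * (Yd2 v * D * D) * ((1 - Y1 v) * (1 - n1 * Y1 v))" by (simp add: mult_ac)
      moreover have "(1 + Y2 v) * D = 1 - (k - 1) * Y1 v"
      proof -
        have "(1 + Y2 v) * D = D + Y2 v * D" by (simp add: algebra_simps)
        also have "\<dots> = 1 - (k - 1) * Y1 v" unfolding YD by (simp add: D_def algebra_simps)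
        finally show ?thesis .
      qed
      moreover have "(1 + n2 * Y2 v) * D = 1 - (k - n2) * Y1 v"
      proof -
        have "(1 + n2 * Y2 v) * D = D + n2 * (Y2 v * D)" by (simp add: algebra_simps)
        also have "\<dots> = 1 - (k - n2) * Y1 v" unfolding YD by (simp add: D_def algebra_simps)
        finally show ?thesis .
      qed
      ultimately have "Y1 v * Yd1 v * ((1 - Y1 v) * (1 - n1 * Y1 v)) =
          Y1 v * Yd1 v * (1 - (k - 1) * Y1 v) * (1 - (k - n2) * Y1 v) * D"
        by (simp only: YD YdD)
      then have "Y1 v * Yd1 v * ((1 - Y1 v) * (1 - n1 * Y1 v)) =
          Y1 v * Yd1 v * ((1 - (k - 1) * Y1 v) * (1 - (k - n2) * Y1 v) * D)" by (simp only: mult.assoc)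
      moreover have ne: "Y1 v * Yd1 v \<noteq> 0" using p A.Yd_pos[OF v'(1)] by simp
      ultimately have "(1 - Y1 v) * (1 - n1 * Y1 v) = (1 - (k - 1) * Y1 v) * (1 - (k - n2) * Y1 v) * D"
        by (simp only: mult_left_cancel[OF ne])
      then show ?thesis by (simp only: D_def mult_ac)
    qed
    have "infinite (Y1 ` {0<..<e})"
    proof -
      have "inj_on Y1 {0<..<e}" using e by (intro inj_on_subset[OF A.Y_inj]) auto
      then show ?thesis using e by (simp add: finite_image_iff)
    qed
    then have "(1 + n1 + 1 + n2 - 3 * k = 0) \<and>
       (k * (k - 1) + k * (k - n2) + (k - 1) * (k - n2) - n1 = 0) \<and>
       (- (k * (k - 1) * (k - n2)) = 0)"
    proof (rule cubic_coefficients_zero)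
      fix t assume "t \<in> Y1 ` {0<..<e}"
      then have "(1 - k * t) * (1 - (k - 1) * t) * (1 - (k - n2) * t) - (1 - t) * (1 - n1 * t) = 0"
        using poly by auto
      then show "(1 + n1 + 1 + n2 - 3 * k) * t + (k * (k - 1) + k * (k - n2) + (k - 1) * (k - n2) - n1) * t\<^sup>2
          + - (k * (k - 1) * (k - n2)) * t ^ 3 = 0"
        by (simp add: algebra_simps power2_eq_square power3_eq_cube)
    qed
    then have r1: "n1 = 3 * k - n2 - 2" and r2: "k * (k - 1) + k * (k - n2) + (k - 1) * (k - n2) = n1"
      and r3': "k * (k - 1) * (k - n2) = 0" by linarith+
    from r3' have r3: "k = 0 \<or> k = 1 \<or> k = n2" by simp
    have l: "l1 = S - n1" "l2 = - S - n2" using S2 by (auto simp: S_def)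
    \<comment> \<open>The candidates k = 0 and k = n2 = 2 lead back to S = 0, against the case
      assumption. The others have n1 + n2 = 1, whence l1 + l2 = - 1 because (l1 + n1) + (l2 + n2) =
      0.\<close>
    from r3 show ?thesis
    proof (elim disjE)
      assume k: "k = 0"
      then have n: "n2 = n1" "n1 = -1" using r1 r2 by auto
      have "c1 = c2" using kS k by simp
      then have "S = 0" using l n by (simp add: c1_def c2_def)
      then show ?thesis using False by simp
    next
      assume k: "k = 1"
      then have "n1 = 1 - n2" using r1 by simp
      then show ?thesis using l by simp
    next
      assume k: "k = n2"
      then have n: "n1 = 2 * n2 - 2" and "n2 * (n2 - 1) = n1" using r1 r2 by (auto simp: algebra_simps)
      then have "(n2 - 1) * (n2 - 2) = 0" by (simp add: algebra_simps)
      then consider "n2 = 1" | "n2 = 2" by auto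
      then show ?thesis
      proof cases
        case 1
        then show ?thesis using n l by simp
      next
        case 2
        then have "S = 0" using kS k n l by (simp add: c1_def c2_def)
        then show ?thesis using False by simp
      qed
    qed
  qed
qed

text \<open>For l + n = 0 the equation becomes psi' = - n (l + 1) v psi^3, in which neither Y nor s
  occurs. So psi is determined by v and the number n (l + 1), which is the same on both
  sides.\<close>

lemma psi_eq_lotka_volterra:
  assumes H: "l1 = l2" "n1 = - l1" "n2 = - l1" and v: "\<bar>v\<bar> < d1" "\<bar>v\<bar> < d2"
  shows "A.psi v = B.psi v"
proof -
  have inv: "1 / (half_chart.psi s l n Y v)\<^sup>2 = 1 + n * (l + 1) * v\<^sup>2"
    if ch: "half_chart s l n d Y Yd" and n: "n = - l" and v: "\<bar>v\<bar> < d" for s l n d Y Yd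
  proof -
    interpret half_chart s l n d Y Yd by fact
    have ss: "s * s = 1" using s by auto
    have pd: "psi' u = - (n * (l + 1)) * u * (psi u) ^ 3" if u: "\<bar>u\<bar> < d" for u
    proof -
      define E where "E = (1 - s * Y u) * (1 - n * s * Y u)"
      have E: "0 < E" using factors_pos[OF u] by (auto simp: E_def)
      have "s * (l + n - n * (l + 1) * s * Y u) = - (n * (l + 1)) * (s * s) * Y u" using n by simp
      then have "psi' u = psi u * (- (n * (l + 1)) * (s * s)) * (Y u * Yd u) / E"
        unfolding psi'_def E_def[symmetric] by simp
      also have "\<dots> = - (n * (l + 1)) * u * (psi u) ^ 3"
        unfolding Y_Yd_psi[OF u] E_def[symmetric] ss using E by (simp add: power2_eq_square power3_eq_cube)
      finally show ?thesis .
    qed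
    have der: "((\<lambda>u. 1 / (psi u)\<^sup>2 - n * (l + 1) * u\<^sup>2) has_real_derivative 0) (at u)" if u: "\<bar>u\<bar> < d" for u
    proof -
      have ps: "psi u \<noteq> 0" using psi_pos[OF u] by simp
      have "((\<lambda>u. (psi u)\<^sup>2) has_real_derivative 2 * psi u * psi' u) (at u)"
        by (auto intro!: derivative_eq_intros psi_deriv[OF u])
      from DERIV_inverse'[OF this] ps
      have "((\<lambda>u. inverse ((psi u)\<^sup>2)) has_real_derivative
          - (inverse ((psi u)\<^sup>2) * (2 * psi u * psi' u) * inverse ((psi u)\<^sup>2))) (at u)"
        by simp
      moreover have "((\<lambda>u. n * (l + 1) * u\<^sup>2) has_real_derivative n * (l + 1) * (2 * u)) (at u)"
        by (auto intro!: derivative_eq_intros)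
      ultimately have "((\<lambda>u. inverse ((psi u)\<^sup>2) - n * (l + 1) * u\<^sup>2) has_real_derivative
          - (inverse ((psi u)\<^sup>2) * (2 * psi u * psi' u) * inverse ((psi u)\<^sup>2)) - n * (l + 1) * (2 * u)) (at u)"
        by (rule DERIV_diff)
      moreover have "- (inverse ((psi u)\<^sup>2) * (2 * psi u * psi' u) * inverse ((psi u)\<^sup>2)) = n * (l + 1) * (2 * u)"
        unfolding pd[OF u] using ps by (simp add: field_simps power2_eq_square power3_eq_cube)
      ultimately show ?thesis by (simp add: inverse_eq_divide)
    qed
    have der': "((\<lambda>u. 1 / (psi u)\<^sup>2 - n * (l + 1) * u\<^sup>2) has_field_derivative 0) (at u within {- d<..<d})"
      if "u \<in> {- d<..<d}" for u
      using der[of u] that by (auto intro: has_field_derivative_at_within simp: abs_less_iff)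
    have "\<exists>c. \<forall>u\<in>{- d<..<d}. 1 / (psi u)\<^sup>2 - n * (l + 1) * u\<^sup>2 = c"
      by (rule has_field_derivative_zero_constant[OF convex_real_interval(8) der'])
    then obtain c where c: "\<And>u. u \<in> {- d<..<d} \<Longrightarrow> 1 / (psi u)\<^sup>2 - n * (l + 1) * u\<^sup>2 = c"
      by (elim exE) (rule that, blast)
    have mem: "v \<in> {- d<..<d}" "0 \<in> {- d<..<d}" using v d by auto
    have "1 / (psi v)\<^sup>2 - n * (l + 1) * v\<^sup>2 = 1 / (psi 0)\<^sup>2 - n * (l + 1) * 0\<^sup>2"
      by (rule trans[OF c[OF mem(1)] c[OF mem(2), symmetric]])
    then have "1 / (psi v)\<^sup>2 - n * (l + 1) * v\<^sup>2 = 1" unfolding psi_0 by simp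
    then show ?thesis by linarith
  qed
  have "1 / (A.psi v)\<^sup>2 = 1 + n1 * (l1 + 1) * v\<^sup>2"
    by (rule inv[OF A.half_chart_axioms H(2) v(1)])
  moreover have "1 / (B.psi v)\<^sup>2 = 1 + n2 * (l2 + 1) * v\<^sup>2"
    by (rule inv[OF B.half_chart_axioms H(3)[unfolded H(1)] v(2)])
  moreover have "n1 * (l1 + 1) = n2 * (l2 + 1)" by (simp only: H)
  ultimately have "1 / (A.psi v)\<^sup>2 = 1 / (B.psi v)\<^sup>2" by (simp only:)
  then have "(A.psi v)\<^sup>2 = (B.psi v)\<^sup>2" by (simp only: divide_cancel_left) simp
  then show ?thesis
    by (rule power2_eq_imp_eq[OF _ less_imp_le[OF A.psi_pos[OF v(1)]] less_imp_le[OF B.psi_pos[OF v(2)]]])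
qed

text \<open>The projective involution \<open>(x, y) \<mapsto> (x / (1 - y), - y / (1 - y))\<close> exchanges the two half systems.\<close>

lemma psi_eq_involution:
  assumes H: "l2 = - 1 - l1" "n2 = 1 - n1"
  obtains e where "0 < e" "e \<le> d1" "e \<le> d2" "\<And>v. 0 < v \<Longrightarrow> v < e \<Longrightarrow> A.psi v = B.psi v"
proof -
  define w where "w = d2 / 2"
  have w: "0 < w" "w < d2" using B.d by (auto simp: w_def)
  have Yw: "0 < Y2 w" using B.Y_pos w by simp
  have c: "isCont (\<lambda>v. Y1 v / (1 - Y1 v)) 0"
    using A.Y_deriv[of 0] A.d A.Y0 DERIV_isCont[of Y1] by (intro continuous_intros) auto
  then have "((\<lambda>v. Y1 v / (1 - Y1 v)) \<longlongrightarrow> 0) (nhds 0)"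
    using tendsto_at_iff_tendsto_nhds[of "\<lambda>v. Y1 v / (1 - Y1 v)" 0] A.Y0 by (simp add: isCont_def)
  then have "\<forall>\<^sub>F v in nhds 0. Y1 v / (1 - Y1 v) < Y2 w" using Yw by (rule order_tendstoD(2))
  then obtain e0 where e0: "0 < e0" "\<And>v. dist v 0 < e0 \<Longrightarrow> Y1 v / (1 - Y1 v) < Y2 w"
    unfolding eventually_nhds_metric by metis
  define e where "e = Min {e0, d1, d2}"
  have e: "0 < e" "e \<le> d1" "e \<le> d2" "e \<le> e0" using e0 A.d B.d by (auto simp: e_def)
  \<comment> \<open>Z v is the depth below the line of the image of a point at height Y1 v. The aim
    is u v = v, that is Z v = Y2 v: the point and its image carry the same Lienard
    coordinate.\<close>
  define Z where "Z = (\<lambda>v. Y1 v / (1 - Y1 v))"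
  define u where "u = (\<lambda>v. B.V (Z v))"
  have pZ: "1/2 \<le> 1 - Y1 v" "1/2 \<le> 1 - n1 * Y1 v" if "\<bar>v\<bar> < e" for v
    using A.factors_pos[of v] that e by auto
  have Zr: "0 \<le> u v \<and> u v \<le> w \<and> Z v = Y2 (u v)" if v: "0 \<le> v" "v < e" for v
  proof -
    have "0 \<le> Y1 v" using A.Y_pos[of v] A.Y0 v e by (cases "v = 0") auto
    then have "0 \<le> Z v" using pZ[of v] v by (simp add: Z_def)
    moreover have "Z v \<le> Y2 w" using e0(2)[of v] v e by (simp add: Z_def)
    ultimately obtain r where "0 \<le> r" "r \<le> w" "Z v = Y2 r" using B.in_range_Y[of "Z v" w] w by auto
    then show ?thesis using B.V_Y[of r] w by (simp add: u_def)
  qed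
  \<comment> \<open>Substituting h = Z in v dv = h (1 + n2 h) (1 + h)^(2 l2 - 1) dh, the relation of
    the lower chart, reproduces the relation of the upper chart. So u^2 and v^2 have the same
    derivative, and both vanish at 0.\<close>
  have uder: "((\<lambda>v. (u v)\<^sup>2) has_real_derivative 2 * v) (at v)" if v: "0 < v" "v < e" for v
  proof -
    define p where "p = 1 - Y1 v"
    have v': "\<bar>v\<bar> < e" "\<bar>v\<bar> < d1" using v e by auto
    have p: "0 < p" using pZ[OF v'(1)] by (simp add: p_def)
    have inv_powr: "(1 / p) powr a = p powr (- a)" for a
      using p by (simp add: powr_divide powr_minus_divide)
    have r: "\<bar>u v\<bar> < d2" "Z v = Y2 (u v)" using Zr[of v] v w by auto
    have dZ: "(Z has_real_derivative Yd1 v / p\<^sup>2) (at v)"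
      unfolding Z_def p_def using p unfolding p_def
      by (auto intro!: derivative_eq_intros A.Y_deriv[OF v'(2)] simp: power2_eq_square field_simps)
    have "(B.V has_real_derivative 1 / Yd2 (u v)) (at (Z v))" using B.V_deriv[OF r(1)] r(2) by simp
    then have "(u has_real_derivative 1 / Yd2 (u v) * (Yd1 v / p\<^sup>2)) (at v)"
      unfolding u_def by (rule DERIV_chain2[OF _ dZ])
    then have "((\<lambda>v. (u v)\<^sup>2) has_real_derivative 2 * u v * (1 / Yd2 (u v) * (Yd1 v / p\<^sup>2))) (at v)"
      by (auto intro!: derivative_eq_intros)
    moreover have "u v * (1 / Yd2 (u v) * (Yd1 v / p\<^sup>2)) = v"
    proof -
      have Zp: "1 + Z v = 1 / p" "1 + n2 * Z v = (1 - n1 * Y1 v) / p" "Z v = Y1 v / p"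
        using p unfolding Z_def p_def H by (auto simp: field_simps)
      have "u v = Z v * (1 + n2 * Z v) * (1 + Z v) powr (2 * l2 - 1) * Yd2 (u v)"
        using B.Y_eq[OF r(1)] r(2) by simp
      then have "u v / Yd2 (u v) = Z v * (1 + n2 * Z v) * (1 + Z v) powr (2 * l2 - 1)"
        using B.Yd_pos[OF r(1)] by (simp add: field_simps)
      also have "\<dots> = Y1 v * (1 - n1 * Y1 v) / (p * p) * (1 / p) powr (2 * l2 - 1)"
        unfolding Zp(1,2) unfolding Zp(3) by simp
      also have "(1 / p) powr (2 * l2 - 1) = p powr (2 * l1 - 1) * p ^ 4"
      proof -
        have "(1 / p) powr (2 * l2 - 1) = p powr (- (2 * l2 - 1))"
          by (rule inv_powr)
        \<comment> \<open>The extra p^4 cancels p^2 from the two factors Z and 1 + n2 Z and another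
          p^2 from the derivative of Z.\<close>
        also have "- (2 * l2 - 1) = (2 * l1 - 1) + real 4" using H by simp
        also have "p powr ((2 * l1 - 1) + real 4) = p powr (2 * l1 - 1) * p powr (real 4)" by (rule powr_add)
        also have "p powr (real 4) = p ^ 4" by (rule powr_realpow[OF p])
        finally show ?thesis .
      qed
      finally have "u v / Yd2 (u v) * (Yd1 v / p\<^sup>2) =
          Y1 v * (1 - n1 * Y1 v) / (p * p) * (p powr (2 * l1 - 1) * p ^ 4) * (Yd1 v / p\<^sup>2)" by simp
      also have "\<dots> = Y1 v * (1 - n1 * Y1 v) * p powr (2 * l1 - 1) * Yd1 v"
        using p by (simp add: power2_eq_square power4_eq_xxxx)
      also have "\<dots> = v" using A.Y_eq[OF v'(2)] by (simp add: p_def)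
      finally show ?thesis by simp
    qed
    ultimately show ?thesis by (simp only: mult.assoc)
  qed
  have u_eq: "u v = v" if v: "0 < v" "v < e" for v
  proof -
    have "(u v)\<^sup>2 - v\<^sup>2 = (u 0)\<^sup>2 - 0\<^sup>2"
    proof (rule DERIV_isconst_end[OF v(1), of "\<lambda>v. (u v)\<^sup>2 - v\<^sup>2"])
      show "((\<lambda>v. (u v)\<^sup>2 - v\<^sup>2) has_real_derivative 0) (at x)" if "0 < x" "x < v" for x
      proof -
        have "((\<lambda>v. v\<^sup>2) has_real_derivative 2 * x) (at x)" by (auto intro!: derivative_eq_intros)
        from DERIV_diff[OF uder[of x] this] show ?thesis using that v by simp
      qed
      have "isCont u x" if "0 \<le> x" "x < e" for x
        unfolding u_def
      proof (rule isCont_o2[where f = Z and g = B.V])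
        have x: "\<bar>x\<bar> < e" "\<bar>x\<bar> < d1" using that e by auto
        show "isCont Z x" unfolding Z_def using DERIV_isCont[OF A.Y_deriv[OF x(2)]] pZ[OF x(1)]
          by (intro continuous_intros) auto
        have "\<bar>u x\<bar> < d2" "Z x = Y2 (u x)" using Zr[OF that] w by auto
        then show "isCont B.V (Z x)" using B.V_deriv DERIV_isCont by metis
      qed
      then show "continuous_on {0..v} (\<lambda>v. (u v)\<^sup>2 - v\<^sup>2)"
        using v by (intro continuous_intros continuous_at_imp_continuous_on) auto
    qed
    moreover have "u 0 = 0" using B.V_Y[of 0] B.d by (simp add: u_def Z_def A.Y0 B.Y0)
    ultimately have "(u v)\<^sup>2 = v\<^sup>2" by simp
    moreover have "0 \<le> u v" using Zr[of v] v by simp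
    ultimately show ?thesis using v(1) by (rule power2_eq_imp_eq[OF _ _ less_imp_le])
  qed
  have "A.psi v = B.psi v" if v: "0 < v" "v < e" for v
  proof -
    define p where "p = 1 - Y1 v"
    have p: "0 < p" "0 < 1 - n1 * Y1 v" using pZ[of v] v by (auto simp: p_def)
    have Y2: "Y2 v = Y1 v / p" using Zr[of v] u_eq[OF v] v by (simp add: Z_def p_def)
    have Zp: "1 + Y2 v = 1 / p" "1 + n2 * Y2 v = (1 - n1 * Y1 v) / p"
      using p unfolding Y2 p_def H by (auto simp: field_simps)
    have "(1 / p) powr (- l2) = p powr (- l1) / p"
    proof -
      have "(1 / p) powr (- l2) = p powr l2" using p(1) by (simp add: powr_divide powr_minus)
      also have "\<dots> = p powr (- l1 - 1)"
        by (rule arg_cong[where f = "(powr) p"]) (use H(1) in linarith)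
      also have "\<dots> = p powr (- l1) / p" using p by (simp add: powr_diff)
      finally show ?thesis .
    qed
    moreover have "B.psi v = (1 / p) powr (- l2) / ((1 - n1 * Y1 v) / p)"
    proof -
      have "1 - -1 * Y2 v = 1 / p" "1 - n2 * -1 * Y2 v = (1 - n1 * Y1 v) / p" using Zp by simp_all
      then show ?thesis unfolding B.psi_def by (simp only:)
    qed
    moreover have "A.psi v = p powr (- l1) / (1 - n1 * Y1 v)"
      unfolding A.psi_def p_def by simp
    ultimately show ?thesis using p(1) by simp
  qed
  then show ?thesis using that[of e] e by blast
qed

end

section \<open>Necessity\<close>

text \<open>Near the start H' = X (1 - s H) has the sign of X a, and H must rise from 0. Hence a
  half arc always leaves the positive half axis.\<close>

lemma half_arc_start_pos:
  assumes ha: "half_arc s l m n X H a b"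
  shows "0 < X a"
proof (rule ccontr)
  assume "\<not> 0 < X a"
  then have Xa: "X a < 0" using ha by (auto simp: half_arc_def)
  have ab: "a < b" "H a = 0" and curve_x: "continuous_on {a..b} X" and curve_h: "continuous_on {a..b} H"
    using ha by (auto simp: half_arc_def)
  have cS: "continuous_on {a..b} (\<lambda>t. 1 - s * H t)" by (intro continuous_intros curve_h)
  have "a \<in> {a..b}" using ab by simp
  then have "((\<lambda>t. 1 - s * H t) \<longlongrightarrow> 1 - s * H a) (at a within {a..b})" and "(X \<longlongrightarrow> X a) (at a within {a..b})"
    using curve_x cS unfolding continuous_on by blast+
  then have "\<forall>\<^sub>F t in at a within {a..b}. 0 < 1 - s * H t \<and> X t < 0"
    using Xa ab by (intro eventually_conj order_tendstoD) auto
  then obtain e where e: "0 < e" "\<And>t. t \<in> {a..b} \<Longrightarrow> t \<noteq> a \<Longrightarrow> dist t a < e \<Longrightarrow> 0 < 1 - s * H t \<and> X t < 0"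
    unfolding eventually_at by metis
  define t where "t = a + min (b - a) e / 2"
  have t: "a < t" "t < b" "t < a + e" using ab e(1) by (auto simp: t_def min_def field_simps)
  have "H t < H a"
  proof (rule DERIV_neg_imp_decreasing_open[OF t(1)])
    show "continuous_on {a..t} H" using curve_h t by (auto intro: continuous_on_subset)
    fix x assume x: "a < x" "x < t"
    have "(H has_real_derivative X x * (1 - s * H x)) (at x)" using ha x t unfolding half_arc_def by auto
    moreover have "X x * (1 - s * H x) < 0"
      using e(2)[of x] x t by (auto simp: dist_real_def mult_less_0_iff)
    ultimately show "\<exists>y. (H has_real_derivative y) (at x) \<and> y < 0" by blast
  qed
  moreover have "0 < H t" using ha t by (auto simp: half_arc_def)
  ultimately show False using ab by simp
qed

lemma half_arc_end_neg:
  assumes "half_arc s l m n X H a b"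
  shows "X b < 0"
  using half_arc_start_pos[OF half_arc_reverse[OF assms]] by simp

section \<open>From orbit arcs to half arcs\<close>

lemma orbit_arc_components:
  assumes "orbit_arc (quad_field l m n) S \<gamma> a b"
  shows "a < b" "continuous_on {a..b} (\<lambda>t. fst (\<gamma> t))" "continuous_on {a..b} (\<lambda>t. snd (\<gamma> t))"
    "snd (\<gamma> a) = 0" "snd (\<gamma> b) = 0" "\<And>t. t \<in> {a<..<b} \<Longrightarrow> \<gamma> t \<in> S"
    "\<And>t. t \<in> {a<..<b} \<Longrightarrow> ((\<lambda>t. fst (\<gamma> t)) has_real_derivative
       - snd (\<gamma> t) + l * (fst (\<gamma> t))\<^sup>2 + m * fst (\<gamma> t) * snd (\<gamma> t) + n * (snd (\<gamma> t))\<^sup>2) (at t)"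
    "\<And>t. t \<in> {a<..<b} \<Longrightarrow> ((\<lambda>t. snd (\<gamma> t)) has_real_derivative fst (\<gamma> t) * (1 - snd (\<gamma> t))) (at t)"
proof -
  show ab: "a < b" "snd (\<gamma> a) = 0" "snd (\<gamma> b) = 0" "\<And>t. t \<in> {a<..<b} \<Longrightarrow> \<gamma> t \<in> S"
    using assms by (auto simp: orbit_arc_def separation_line_def)
  have der: "(\<gamma> has_vector_derivative quad_field l m n (\<gamma> t)) (at t within {a..b})" if "t \<in> {a..b}" for t
    using assms that by (auto simp: orbit_arc_def)
  have cont: "continuous_on {a..b} \<gamma>"
    using der by (intro continuous_on_vector_derivative) auto
  show "continuous_on {a..b} (\<lambda>t. fst (\<gamma> t))" "continuous_on {a..b} (\<lambda>t. snd (\<gamma> t))"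
    by (intro continuous_intros cont)+
  fix t assume t: "t \<in> {a<..<b}"
  have d: "(\<gamma> has_vector_derivative quad_field l m n (\<gamma> t)) (at t)"
    using der[of t] t at_within_Icc_at[of a t b] by auto
  show "((\<lambda>t. fst (\<gamma> t)) has_real_derivative
       - snd (\<gamma> t) + l * (fst (\<gamma> t))\<^sup>2 + m * fst (\<gamma> t) * snd (\<gamma> t) + n * (snd (\<gamma> t))\<^sup>2) (at t)"
    using bounded_linear.has_vector_derivative[OF bounded_linear_fst d]
    unfolding has_real_derivative_iff_has_vector_derivative
    by (simp add: quad_field_def case_prod_beta)
  show "((\<lambda>t. snd (\<gamma> t)) has_real_derivative fst (\<gamma> t) * (1 - snd (\<gamma> t))) (at t)"
    using bounded_linear.has_vector_derivative[OF bounded_linear_snd d]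
    unfolding has_real_derivative_iff_has_vector_derivative
    by (simp add: quad_field_def case_prod_beta)
qed

lemma upper_orbit_half_arc:
  assumes arc: "orbit_arc (quad_field l m n) upper_half \<gamma> a b" and ne: "fst (\<gamma> a) \<noteq> 0" "fst (\<gamma> b) \<noteq> 0"
  shows "half_arc 1 l m n (\<lambda>t. fst (\<gamma> t)) (\<lambda>t. snd (\<gamma> t)) a b"
  using orbit_arc_components[OF arc] ne unfolding half_arc_def by (auto simp: upper_half_def)

lemma lower_orbit_half_arc:
  assumes arc: "orbit_arc (quad_field l m n) lower_half \<gamma> a b" and ne: "fst (\<gamma> a) \<noteq> 0" "fst (\<gamma> b) \<noteq> 0"
  shows "half_arc (-1) l m n (\<lambda>t. fst (\<gamma> (a + b - t))) (\<lambda>t. - snd (\<gamma> (a + b - t))) a b"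
proof -
  note C = orbit_arc_components[OF arc]
  have cont: "continuous_on {a..b} (\<lambda>t. fst (\<gamma> (a + b - t)))" "continuous_on {a..b} (\<lambda>t. snd (\<gamma> (a + b - t)))"
  proof -
    have "continuous_on {a..b} ((-) (a + b))" by (intro continuous_intros)
    then show "continuous_on {a..b} (\<lambda>t. fst (\<gamma> (a + b - t)))" "continuous_on {a..b} (\<lambda>t. snd (\<gamma> (a + b - t)))"
      using continuous_on_compose2[OF C(2), of "{a..b}" "(-) (a + b)"]
        continuous_on_compose2[OF C(3), of "{a..b}" "(-) (a + b)"] by auto
  qed
  have "0 < - snd (\<gamma> (a + b - t)) \<and>
     ((\<lambda>t. fst (\<gamma> (a + b - t))) has_real_derivative - (- snd (\<gamma> (a + b - t))) + -1 * l * (fst (\<gamma> (a + b - t)))\<^sup>2 +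
       m * fst (\<gamma> (a + b - t)) * - snd (\<gamma> (a + b - t)) + -1 * n * (- snd (\<gamma> (a + b - t)))\<^sup>2) (at t) \<and>
     ((\<lambda>t. - snd (\<gamma> (a + b - t))) has_real_derivative fst (\<gamma> (a + b - t)) * (1 - -1 * - snd (\<gamma> (a + b - t)))) (at t)"
    if t: "t \<in> {a<..<b}" for t
  proof (intro conjI)
    have t': "a + b - t \<in> {a<..<b}" using t by auto
    have i: "((\<lambda>t. a + b - t) has_real_derivative -1) (at t)" by (auto intro!: derivative_eq_intros)
    show "0 < - snd (\<gamma> (a + b - t))" using C(6)[OF t'] by (simp add: lower_half_def)
    show "((\<lambda>t. fst (\<gamma> (a + b - t))) has_real_derivative - (- snd (\<gamma> (a + b - t))) + -1 * l * (fst (\<gamma> (a + b - t)))\<^sup>2 +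
       m * fst (\<gamma> (a + b - t)) * - snd (\<gamma> (a + b - t)) + -1 * n * (- snd (\<gamma> (a + b - t)))\<^sup>2) (at t)"
      by (rule DERIV_cong[OF DERIV_chain2[OF C(7)[OF t'] i]]) simp
    show "((\<lambda>t. - snd (\<gamma> (a + b - t))) has_real_derivative fst (\<gamma> (a + b - t)) * (1 - -1 * - snd (\<gamma> (a + b - t)))) (at t)"
      by (rule DERIV_cong[OF DERIV_minus[OF DERIV_chain2[OF C(8)[OF t'] i]]]) simp
  qed
  then show ?thesis
    unfolding half_arc_def using C(1,4,5) ne cont by (auto intro!: continuous_intros)
qed

text \<open>A relation in place of a return map: the arcs are supplied by a given orbit, and the
  comparison concerns the ends of any two arcs that exist.\<close>

definition half_map :: "real \<Rightarrow> real \<Rightarrow> real \<Rightarrow> real \<Rightarrow> real \<Rightarrow> real \<Rightarrow> bool" where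
  "half_map s l m n x y \<longleftrightarrow> (\<exists>X H a b. half_arc s l m n X H a b \<and> X a = x \<and> X b = y)"

lemma half_map_signs: "half_map s l m n x y \<Longrightarrow> 0 < x \<and> y < 0"
  using half_arc_start_pos half_arc_end_neg unfolding half_map_def by blast

text \<open>The arcs starting and ending at a crossing point exist because the orbit closes up; the sign of the
  point decides which of the two half systems they belong to.\<close>

lemma crossing_points_of_orbit:
  assumes cpo: "crossing_periodic_orbit (quad_field l1 m1 n1) (quad_field l2 m2 n2) \<Gamma>"
    and mem: "(\<xi>, 0) \<in> \<Gamma>"
  obtains C where "finite C" "\<xi> \<in> C"
    "\<And>x. x \<in> C \<Longrightarrow> 0 < x \<Longrightarrow> \<exists>y\<in>C. half_map 1 l1 m1 n1 x y"
    "\<And>x. x \<in> C \<Longrightarrow> 0 < x \<Longrightarrow> \<exists>y\<in>C. half_map (-1) l2 m2 n2 x y"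
    "\<And>y. y \<in> C \<Longrightarrow> y < 0 \<Longrightarrow> \<exists>x\<in>C. half_map 1 l1 m1 n1 x y"
    "\<And>y. y \<in> C \<Longrightarrow> y < 0 \<Longrightarrow> \<exists>x\<in>C. half_map (-1) l2 m2 n2 x y"
proof -
  obtain \<gamma> :: "real \<Rightarrow> real \<times> real" and k :: nat and \<tau> :: "nat \<Rightarrow> real" where k: "1 \<le> k"
    and arcs: "\<And>i. i < k \<Longrightarrow> orbit_arc (quad_field l1 m1 n1) upper_half \<gamma> (\<tau> i) (\<tau> (Suc i)) \<or>
               orbit_arc (quad_field l2 m2 n2) lower_half \<gamma> (\<tau> i) (\<tau> (Suc i))"
    and cp: "\<And>i. i \<le> k \<Longrightarrow> crossing_point (quad_field l1 m1 n1) (quad_field l2 m2 n2) (\<gamma> (\<tau> i))"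
    and closed: "\<gamma> (\<tau> k) = \<gamma> (\<tau> 0)" and \<Gamma>: "\<Gamma> = \<gamma> ` {\<tau> 0..\<tau> k}"
    using cpo unfolding crossing_periodic_orbit_def by metis
  define c where "c = (\<lambda>i. fst (\<gamma> (\<tau> i)))"
  \<comment> \<open>On y = 0 the second component of both fields is x, so a crossing point has x
    \<noteq> 0.\<close>
  have cne: "c i \<noteq> 0" if "i \<le> k" for i
    using cp[OF that] unfolding c_def
    by (auto simp: crossing_point_def separation_line_def quad_field_def case_prod_beta)
  \<comment> \<open>A lower arc enters \<open>half_map\<close> reversed in time, so its two ends
    change places.\<close>
  have edge: "half_map 1 l1 m1 n1 (c i) (c (Suc i)) \<or> half_map (-1) l2 m2 n2 (c (Suc i)) (c i)" if i: "i < k" for i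
  proof -
    have ne: "fst (\<gamma> (\<tau> i)) \<noteq> 0" "fst (\<gamma> (\<tau> (Suc i))) \<noteq> 0" using cne[of i] cne[of "Suc i"] i by (auto simp: c_def)
    from arcs[OF i] show ?thesis
    proof
      assume "orbit_arc (quad_field l1 m1 n1) upper_half \<gamma> (\<tau> i) (\<tau> (Suc i))"
      from upper_orbit_half_arc[OF this ne] show ?thesis unfolding half_map_def c_def by blast
    next
      assume "orbit_arc (quad_field l2 m2 n2) lower_half \<gamma> (\<tau> i) (\<tau> (Suc i))"
      from lower_orbit_half_arc[OF this ne]
      have "half_map (-1) l2 m2 n2 (fst (\<gamma> (\<tau> i + \<tau> (Suc i) - \<tau> i))) (fst (\<gamma> (\<tau> i + \<tau> (Suc i) - \<tau> (Suc i))))"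
        unfolding half_map_def by blast
      then show ?thesis unfolding c_def by simp
    qed
  qed
  define C where "C = c ` {..k}"
  have succ: "\<exists>i<k. c i = x" if x: "x \<in> C" for x
  proof -
    obtain i where i: "i \<le> k" "c i = x" using x by (auto simp: C_def)
    show ?thesis
    proof (cases "i = k")
      case True
      then have "c 0 = x" using i closed by (simp add: c_def)
      then show ?thesis using k by (intro exI[of _ 0]) auto
    qed (use i in \<open>auto intro!: exI[of _ i]\<close>)
  qed
  have pred: "\<exists>i<k. c (Suc i) = x" if x: "x \<in> C" for x
  proof -
    obtain i where i: "i \<le> k" "c i = x" using x by (auto simp: C_def)
    show ?thesis
    proof (cases i)
      case 0
      then have "c k = x" using i closed by (simp add: c_def)
      then show ?thesis using k by (intro exI[of _ "k - 1"]) auto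
    next
      case (Suc j)
      then show ?thesis using i by (intro exI[of _ j]) auto
    qed
  qed
  have CI: "c i \<in> C" if "i \<le> k" for i using that by (auto simp: C_def)
  have cover: "\<exists>i\<le>j. t = \<tau> i \<or> (i < j \<and> \<tau> i < t \<and> t < \<tau> (Suc i))" if "\<tau> 0 \<le> t" "t \<le> \<tau> j" for t j
    using that
  proof (induction j)
    case (Suc j)
    show ?case
    proof (cases "t \<le> \<tau> j")
      case True
      then show ?thesis using Suc by (metis le_Suc_eq less_Suc_eq)
    next
      case False
      then show ?thesis using Suc.prems by (metis le_Suc_eq lessI linorder_not_le order_le_less)
    qed
  qed auto
  have "\<xi> \<in> C"
  proof -
    obtain t where t: "\<tau> 0 \<le> t" "t \<le> \<tau> k" "\<gamma> t = (\<xi>, 0)" using mem \<Gamma> by force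
    obtain i where i: "i \<le> k" "t = \<tau> i \<or> (i < k \<and> \<tau> i < t \<and> t < \<tau> (Suc i))" using cover[OF t(1,2)] by blast
    have "\<not> (i < k \<and> \<tau> i < t \<and> t < \<tau> (Suc i))"
    proof
      assume a: "i < k \<and> \<tau> i < t \<and> t < \<tau> (Suc i)"
      then have "\<gamma> t \<in> upper_half \<or> \<gamma> t \<in> lower_half" using arcs[of i] by (auto simp: orbit_arc_def)
      then show False using t(3) by (simp add: upper_half_def lower_half_def)
    qed
    then have "c i = \<xi>" using i(2) t(3) by (auto simp: c_def)
    then show ?thesis using CI[OF i(1)] by simp
  qed
  then show ?thesis
  proof (rule that[rotated])
    show "finite C" by (simp add: C_def)
    show "\<exists>y\<in>C. half_map 1 l1 m1 n1 x y" "\<exists>y\<in>C. half_map (-1) l2 m2 n2 x y" if x: "x \<in> C" "0 < x" for x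
    proof -
      show "\<exists>y\<in>C. half_map 1 l1 m1 n1 x y"
        using succ[OF x(1)] edge half_map_signs x(2) CI by (metis Suc_leI less_asym)
      show "\<exists>y\<in>C. half_map (-1) l2 m2 n2 x y"
        using pred[OF x(1)] edge half_map_signs x(2) CI by (metis less_asym less_imp_le)
    qed
    show "\<exists>x\<in>C. half_map 1 l1 m1 n1 x y" "\<exists>x\<in>C. half_map (-1) l2 m2 n2 x y" if y: "y \<in> C" "y < 0" for y
    proof -
      show "\<exists>x\<in>C. half_map 1 l1 m1 n1 x y"
        using pred[OF y(1)] edge half_map_signs y(2) CI by (metis less_asym less_imp_le)
      show "\<exists>x\<in>C. half_map (-1) l2 m2 n2 x y"
        using succ[OF y(1)] edge half_map_signs y(2) CI by (metis Suc_leI less_asym)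
    qed
  qed
qed

context half_chart
begin

lemma half_map_polar:
  assumes "half_map s l m n x y" "tame w B (\<lambda>v. m * v * psi v)" "w < d" "9 * x < w \<or> 9 * - y < w"
  obtains R A a b where "polar_curve (\<lambda>v. m * v * psi v) R A a b"
    "A a = 0" "A b = pi" "R a = x" "R b = - y" "\<And>t. t \<in> {a..b} \<Longrightarrow> R t < w" "- y \<le> 3 * x"
proof -
  obtain X H a b where ha: "half_arc s l m n X H a b" and X: "X a = x" "X b = y"
    using assms(1) unfolding half_map_def by blast
  have sgn: "0 < X a" "X b < 0" using half_arc_start_pos[OF ha] half_arc_end_neg[OF ha] by auto
  then have sm: "9 * \<bar>X a\<bar> < w \<or> 9 * \<bar>X b\<bar> < w" using assms(4) X by auto
  obtain R A where RA: "polar_curve (\<lambda>v. m * v * psi v) R A a b" "A a = 0" "A b = pi"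
    "R a = X a" "R b = - X b" "\<And>t. t \<in> {a..b} \<Longrightarrow> R t < w" "- X b \<le> 3 * X a"
    using half_arc_polar[OF ha assms(2,3) sm sgn] by metis
  show ?thesis
    by (rule that[of R A a b]) (use RA X in auto)
qed

end

section \<open>Expansion or contraction of a full turn\<close>

context chart_pair
begin

text \<open>The arcs share their negative end y. The 30 exceeds 3 * 9: the factor 3 passes from the
  small positive end to - y, and 9 is what \<open>half_map_polar\<close> asks for at y.\<close>

lemma turn_increasing:
  assumes tA: "tame w BA (\<lambda>v. m1 * v * A.psi v)" and tB: "tame w BB (\<lambda>v. m2 * v * B.psi v)"
    and w: "w < d1" "w < d2"
    and up: "half_map 1 l1 m1 n1 x y" and low: "half_map (-1) l2 m2 n2 x' y"
    and small: "30 * x < w \<or> 30 * x' < w"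
  shows "(\<And>v. 0 < v \<Longrightarrow> v < w \<Longrightarrow> m2 * v * B.psi v < m1 * v * A.psi v) \<Longrightarrow> x < x'"
    and "(\<And>v. 0 < v \<Longrightarrow> v < w \<Longrightarrow> m1 * v * A.psi v < m2 * v * B.psi v) \<Longrightarrow> x' < x"
proof -
  have pos: "0 < x" "0 < x'" "y < 0" using half_map_signs up low by blast+
  have ysmall: "9 * - y < w"
    using small
  proof
    assume s: "30 * x < w"
    have "- y \<le> 3 * x" by (rule A.half_map_polar[OF up tA w(1)]) (use s pos in auto)
    then show ?thesis using s pos by linarith
  next
    assume s: "30 * x' < w"
    have "- y \<le> 3 * x'" by (rule B.half_map_polar[OF low tB w(2)]) (use s pos in auto)
    then show ?thesis using s pos by linarith
  qed
  obtain R1 A1 a1 b1 where c1: "polar_curve (\<lambda>v. m1 * v * A.psi v) R1 A1 a1 b1"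
    "A1 a1 = 0" "A1 b1 = pi" "\<And>t. t \<in> {a1..b1} \<Longrightarrow> R1 t < w" and e1: "R1 a1 = x" "R1 b1 = - y"
    by (rule A.half_map_polar[OF up tA w(1)]) (use ysmall in auto)
  obtain R2 A2 a2 b2 where c2: "polar_curve (\<lambda>v. m2 * v * B.psi v) R2 A2 a2 b2"
    "A2 a2 = 0" "A2 b2 = pi" "\<And>t. t \<in> {a2..b2} \<Longrightarrow> R2 t < w" and e2: "R2 a2 = x'" "R2 b2 = - y"
    by (rule B.half_map_polar[OF low tB w(2)]) (use ysmall in auto)
  have e: "R1 b1 = R2 b2" "R2 b2 = R1 b1" "R1 b1 \<le> w / 2" "R2 b2 \<le> w / 2" using e1 e2 ysmall pos by auto
  show "x < x'" if "\<And>v. 0 < v \<Longrightarrow> v < w \<Longrightarrow> m2 * v * B.psi v < m1 * v * A.psi v"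
    using turn_comparison[OF c1 c2 tA tB e(1,3) that] e1 e2 by simp
  show "x' < x" if "\<And>v. 0 < v \<Longrightarrow> v < w \<Longrightarrow> m1 * v * A.psi v < m2 * v * B.psi v"
    using turn_comparison[OF c2 c1 tB tA e(2,4) that] e1 e2 by simp
qed

text \<open>At the smallest positive crossing point of an orbit, some turn starting or ending there leads to a
  smaller one.\<close>

lemma no_small_orbit:
  assumes tA: "tame w BA (\<lambda>v. m1 * v * A.psi v)" and tB: "tame w BB (\<lambda>v. m2 * v * B.psi v)"
    and w: "w < d1" "w < d2"
    and cpo: "crossing_periodic_orbit (quad_field l1 m1 n1) (quad_field l2 m2 n2) \<Gamma>"
    and mem: "(\<xi>, 0) \<in> \<Gamma>" and \<xi>: "0 < \<xi>" "30 * \<xi> < w"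
    and sgn: "(\<forall>v. 0 < v \<longrightarrow> v < w \<longrightarrow> m2 * v * B.psi v < m1 * v * A.psi v) \<or>
      (\<forall>v. 0 < v \<longrightarrow> v < w \<longrightarrow> m1 * v * A.psi v < m2 * v * B.psi v)"
  shows False
proof -
  obtain C where C: "finite C" "\<xi> \<in> C"
    "\<And>x. x \<in> C \<Longrightarrow> 0 < x \<Longrightarrow> \<exists>y\<in>C. half_map 1 l1 m1 n1 x y"
    "\<And>x. x \<in> C \<Longrightarrow> 0 < x \<Longrightarrow> \<exists>y\<in>C. half_map (-1) l2 m2 n2 x y"
    "\<And>y. y \<in> C \<Longrightarrow> y < 0 \<Longrightarrow> \<exists>x\<in>C. half_map 1 l1 m1 n1 x y"
    "\<And>y. y \<in> C \<Longrightarrow> y < 0 \<Longrightarrow> \<exists>x\<in>C. half_map (-1) l2 m2 n2 x y"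
    by (rule crossing_points_of_orbit[OF cpo mem]) (rule that)
  let ?P = "{x \<in> C. 0 < x}"
  define \<mu> where "\<mu> = Min ?P"
  have P: "finite ?P" "\<xi> \<in> ?P" using C(1,2) \<xi> by auto
  have \<mu>: "\<mu> \<in> C" "0 < \<mu>" using Min_in[of ?P] P unfolding \<mu>_def by blast+
  have least: "\<mu> \<le> x" if "x \<in> C" "0 < x" for x unfolding \<mu>_def using P(1) that by (intro Min_le) auto
  have "30 * \<mu> < w" using least[OF C(2) \<xi>(1)] \<xi>(2) by simp
  note turn = turn_increasing[OF tA tB w]
  from sgn show False
  proof
    assume lt: "\<forall>v. 0 < v \<longrightarrow> v < w \<longrightarrow> m2 * v * B.psi v < m1 * v * A.psi v"
    \<comment> \<open>The turn sets out along the arc with the smaller Lienard function, from \<mu>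
      to y, and returns along the other one to some x < \<mu>.\<close>
    obtain y where y: "y \<in> C" "half_map (-1) l2 m2 n2 \<mu> y" using C(4)[OF \<mu>] by blast
    then obtain x where x: "x \<in> C" "half_map 1 l1 m1 n1 x y" using C(5) half_map_signs by blast
    have "x < \<mu>" by (rule turn(1)[OF x(2) y(2)]) (use \<open>30 * \<mu> < w\<close> lt in auto)
    then show False using least[OF x(1)] half_map_signs[OF x(2)] by simp
  next
    assume lt: "\<forall>v. 0 < v \<longrightarrow> v < w \<longrightarrow> m1 * v * A.psi v < m2 * v * B.psi v"
    obtain y where y: "y \<in> C" "half_map 1 l1 m1 n1 \<mu> y" using C(3)[OF \<mu>] by blast
    then obtain x where x: "x \<in> C" "half_map (-1) l2 m2 n2 x y" using C(6) half_map_signs by blast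
    have "x < \<mu>" by (rule turn(2)[OF y(2) x(2)]) (use \<open>30 * \<mu> < w\<close> lt in auto)
    then show False using least[OF x(1)] half_map_signs[OF x(2)] by simp
  qed
qed

end

lemma center_conditions_necessary:
  fixes l1 l2 m1 m2 n1 n2 :: real
  assumes center: "origin_is_center (quad_field l1 m1 n1) (quad_field l2 m2 n2)"
  shows "(m1 = 0 \<and> m2 = 0) \<or>
    (l1 - l2 = 0 \<and> m1 - m2 = 0 \<and> l1 + n2 = 0 \<and> l1 + n1 = 0) \<or>
    (l1 + l2 + 1 = 0 \<and> m1 - m2 = 0 \<and> n1 + n2 - 1 = 0)"
proof -
  obtain d1 Y1 Yd1 G1 where h1: "half_chart 1 l1 n1 d1 Y1 Yd1" and G1: "G1 holomorphic_on ball 0 d1"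
    "\<And>v. \<bar>v\<bar> < d1 \<Longrightarrow> G1 (complex_of_real v) = complex_of_real (Y1 v)"
    using half_chart_exists[of 1 l1 n1] by blast
  obtain d2 Y2 Yd2 G2 where h2: "half_chart (-1) l2 n2 d2 Y2 Yd2" and G2: "G2 holomorphic_on ball 0 d2"
    "\<And>v. \<bar>v\<bar> < d2 \<Longrightarrow> G2 (complex_of_real v) = complex_of_real (Y2 v)"
    using half_chart_exists[of "-1" l2 n2] by blast
  interpret chart_pair l1 n1 d1 Y1 Yd1 l2 n2 d2 Y2 Yd2
    using h1 h2 by (simp add: chart_pair_def)
  obtain e1 P1 where P1: "0 < e1" "e1 \<le> d1" "P1 holomorphic_on ball 0 e1"
    "\<And>v. \<bar>v\<bar> < e1 \<Longrightarrow> P1 (complex_of_real v) = complex_of_real (A.psi v)"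
    using A.psi_holomorphic_extension[OF G1] by blast
  obtain e2 P2 where P2: "0 < e2" "e2 \<le> d2" "P2 holomorphic_on ball 0 e2"
    "\<And>v. \<bar>v\<bar> < e2 \<Longrightarrow> P2 (complex_of_real v) = complex_of_real (B.psi v)"
    using B.psi_holomorphic_extension[OF G2] by blast
  define e0 where "e0 = min e1 e2"
  have e0: "0 < e0" "e0 \<le> e1" "e0 \<le> e2" using P1 P2 by (auto simp: e0_def)
  have hol: "(\<lambda>z. of_real m1 * P1 z - of_real m2 * P2 z) holomorphic_on ball 0 e0"
    using e0 by (intro holomorphic_intros holomorphic_on_subset[OF P1(3)] holomorphic_on_subset[OF P2(3)]) auto
  have ext: "of_real m1 * P1 (of_real v) - of_real m2 * P2 (of_real v) = complex_of_real (m1 * A.psi v - m2 * B.psi v)"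
    if "\<bar>v\<bar> < e0" for v
    using P1(4)[of v] P2(4)[of v] that e0 by simp
  obtain e where e: "0 < e" "e \<le> e0" and tri: "(\<forall>v. \<bar>v\<bar> < e \<longrightarrow> m1 * A.psi v - m2 * B.psi v = 0) \<or>
     (\<forall>v. 0 < v \<longrightarrow> v < e \<longrightarrow> 0 < m1 * A.psi v - m2 * B.psi v) \<or>
     (\<forall>v. 0 < v \<longrightarrow> v < e \<longrightarrow> m1 * A.psi v - m2 * B.psi v < 0)"
    using analytic_sign_trichotomy[OF e0(1) hol ext] by blast
  obtain BA wA where wA: "0 < wA" "wA < d1" "\<And>u. 0 < u \<Longrightarrow> u \<le> wA \<Longrightarrow> tame u BA (\<lambda>v. m1 * v * A.psi v)"
    using A.tame_lienard by blast
  obtain BB wB where wB: "0 < wB" "wB < d2" "\<And>u. 0 < u \<Longrightarrow> u \<le> wB \<Longrightarrow> tame u BB (\<lambda>v. m2 * v * B.psi v)"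
    using B.tame_lienard by blast
  define w where "w = Min {e, wA, wB}"
  have w: "0 < w" "w \<le> e" "w \<le> wA" "w \<le> wB" "w < d1" "w < d2" using e wA wB by (auto simp: w_def)
  obtain U where U: "(0, 0) \<in> interior U" and orb: "\<And>p. p \<in> U - {(0, 0)} \<Longrightarrow>
      \<exists>\<Gamma>. crossing_periodic_orbit (quad_field l1 m1 n1) (quad_field l2 m2 n2) \<Gamma> \<and> p \<in> \<Gamma>"
    using center unfolding origin_is_center_def by blast
  obtain r where r: "0 < r" "ball (0, 0) r \<subseteq> U" using U by (auto simp: mem_interior)
  \<comment> \<open>The bound w / 60 gives 30 \<xi> < w for \<open>no_small_orbit\<close>; r / 2
    keeps the test point in the given neighborhood.\<close>
  define \<xi> where "\<xi> = min (r / 2) (w / 60)"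
  have \<xi>: "0 < \<xi>" "\<xi> < r" "30 * \<xi> < w" using r w by (auto simp: \<xi>_def)
  have "(\<xi>, 0) \<in> U - {(0, 0)}"
    using r(2) \<xi> by (auto simp: subset_iff dist_Pair_Pair dist_real_def)
  then obtain \<Gamma> where \<Gamma>: "crossing_periodic_orbit (quad_field l1 m1 n1) (quad_field l2 m2 n2) \<Gamma>" "(\<xi>, 0) \<in> \<Gamma>"
    using orb by blast
  note no = no_small_orbit[OF wA(3)[OF w(1,3)] wB(3)[OF w(1,4)] w(5,6) \<Gamma> \<xi>(1,3)]
  from tri consider (zero) "\<forall>v. \<bar>v\<bar> < e \<longrightarrow> m1 * A.psi v - m2 * B.psi v = 0"
    | (pos) "\<forall>v. 0 < v \<longrightarrow> v < e \<longrightarrow> 0 < m1 * A.psi v - m2 * B.psi v"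
    | (neg) "\<forall>v. 0 < v \<longrightarrow> v < e \<longrightarrow> m1 * A.psi v - m2 * B.psi v < 0" by blast
  then show ?thesis
  proof cases
    case zero
    have m: "m1 = m2" using zero[rule_format, of 0] e(1) A.psi_0 B.psi_0 by simp
    show ?thesis
    proof (cases "m1 = 0")
      case False
      have "A.psi v = B.psi v" if "\<bar>v\<bar> < e" for v
        using zero that False m by (simp flip: right_diff_distrib)
      from parameters_of_psi_eq[OF e(1) _ _ this] show ?thesis using e e0 P1 P2 m by auto
    qed (use m in simp)
  next
    case pos
    have "m2 * v * B.psi v < m1 * v * A.psi v" if "0 < v" "v < w" for v
    proof -
      have "0 < v * (m1 * A.psi v - m2 * B.psi v)" using pos that w by simp
      then show ?thesis by (simp add: algebra_simps)
    qed
    then show ?thesis using no by blast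
  next
    case neg
    have "m1 * v * A.psi v < m2 * v * B.psi v" if "0 < v" "v < w" for v
    proof -
      have "0 < v * (m2 * B.psi v - m1 * A.psi v)" using neg that w by simp
      then show ?thesis by (simp add: algebra_simps)
    qed
    then show ?thesis using no by blast
  qed
qed

section \<open>Sufficiency\<close>

lemma time_reparametrization:
  fixes c :: "real \<Rightarrow> real \<times> real" and \<kappa> :: "real \<Rightarrow> real"
  assumes ab: "a < b" and ck: "continuous_on {a..b} \<kappa>" and kpos: "\<And>\<phi>. \<phi> \<in> {a..b} \<Longrightarrow> 0 < \<kappa> \<phi>"
    and der: "\<And>\<phi>. \<phi> \<in> {a..b} \<Longrightarrow> (c has_vector_derivative \<kappa> \<phi> *\<^sub>R F (c \<phi>)) (at \<phi> within {a..b})"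
  obtains T \<gamma> where "0 < T" "\<And>t. t \<in> {0..T} \<Longrightarrow> (\<gamma> has_vector_derivative F (\<gamma> t)) (at t within {0..T})"
    "\<gamma> 0 = c a" "\<gamma> T = c b" "\<gamma> ` {0..T} = c ` {a..b}" "\<gamma> ` {0<..<T} = c ` {a<..<b}"
proof -
  \<comment> \<open>Extends \<kappa> by constants to [a - 1, b + 1]. Then a and b are interior
    points, and the inverse \<theta> of the new time \<tau>, the integral of \<kappa>, has two-sided
    derivatives at the ends as well.\<close>
  define q where "q = (\<lambda>x::real. max a (min b x))"
  define K where "K = (\<lambda>x. \<kappa> (q x))"
  have q: "q x \<in> {a..b}" "x \<in> {a..b} \<Longrightarrow> q x = x" for x using ab by (auto simp: q_def)
  have Kpos: "0 < K x" for x unfolding K_def by (rule kpos[OF q(1)])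
  have cq: "continuous_on {a-1..b+1} q" unfolding q_def by (intro continuous_intros)
  have cK: "continuous_on {a-1..b+1} K"
    unfolding K_def by (rule continuous_on_compose2[OF ck cq]) (use q in auto)
  define \<tau> where "\<tau> = (\<lambda>x. integral {a-1..x} K - integral {a-1..a} K)"
  have td: "(\<tau> has_real_derivative K x) (at x)" if x: "a - 1 < x" "x < b + 1" for x
  proof -
    have "((\<lambda>x. integral {a-1..x} K) has_real_derivative K x) (at x within {a-1..b+1})"
      by (rule integral_has_real_derivative[OF cK]) (use x in auto)
    then have "((\<lambda>x. integral {a-1..x} K) has_real_derivative K x) (at x)"
      using at_within_Icc_at[OF x] by simp
    then show ?thesis unfolding \<tau>_def by (auto intro!: derivative_eq_intros)
  qed
  have mono: "\<tau> x < \<tau> y" if "a - 1 < x" "x < y" "y < b + 1" for x y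
  proof (rule DERIV_pos_imp_increasing[OF that(2)])
    fix u assume "x \<le> u" "u \<le> y"
    then show "\<exists>D. (\<tau> has_real_derivative D) (at u) \<and> 0 < D" using td[of u] Kpos[of u] that by auto
  qed
  let ?S = "{a-1<..<b+1}"
  have inj: "inj_on \<tau> ?S" by (rule linorder_inj_onI) (use mono in force)+
  define \<theta> where "\<theta> = inv_into ?S \<tau>"
  have th: "\<theta> (\<tau> x) = x" if "x \<in> ?S" for x unfolding \<theta>_def by (rule inv_into_f_f[OF inj that])
  have ct: "continuous_on ?S \<tau>"
    by (rule continuous_at_imp_continuous_on) (use td DERIV_isCont in force)
  have thd: "(\<theta> has_real_derivative 1 / K x) (at (\<tau> x))" if x: "x \<in> ?S" for x
  proof -
    have "(\<theta> has_real_derivative inverse (K x)) (at (\<tau> x))"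
    proof (rule has_field_derivative_inverse_strong[of \<tau> "K x" x ?S \<theta>])
      show "(\<tau> has_real_derivative K x) (at x)" using td x by auto
    qed (use x Kpos[of x] ct th in auto)
    then show ?thesis by (simp add: inverse_eq_divide)
  qed
  define T where "T = \<tau> b"
  have t0: "\<tau> a = 0" by (simp add: \<tau>_def)
  have T: "0 < T" using mono[of a b] ab t0 by (simp add: T_def)
  have onto: "\<exists>x\<in>{a..b}. \<tau> x = t" if t: "t \<in> {0..T}" for t
  proof -
    have "continuous_on {a..b} \<tau>" by (rule continuous_on_subset[OF ct]) auto
    then show ?thesis using IVT'[of \<tau> a t b] t t0 ab by (auto simp: T_def)
  qed
  have into: "\<tau> x \<in> {0..T}" if "x \<in> {a..b}" for x
  proof -
    have "\<tau> a \<le> \<tau> x" using mono[of a x] that ab by (cases "x = a") auto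
    moreover have "\<tau> x \<le> \<tau> b" using mono[of x b] that ab by (cases "x = b") auto
    ultimately show ?thesis using t0 by (simp add: T_def)
  qed
  have thr: "\<theta> t \<in> {a..b} \<and> \<tau> (\<theta> t) = t" if t: "t \<in> {0..T}" for t
    using onto[OF t] th by force
  define \<gamma> where "\<gamma> = c \<circ> \<theta>"
  have gd: "(\<gamma> has_vector_derivative F (\<gamma> t)) (at t within {0..T})" if t: "t \<in> {0..T}" for t
  proof -
    have x: "\<theta> t \<in> {a..b}" "\<tau> (\<theta> t) = t" using thr[OF t] by auto
    have "(\<theta> has_vector_derivative 1 / K (\<theta> t)) (at t within {0..T})"
      using thd[of "\<theta> t"] x
      by (auto simp: has_real_derivative_iff_has_vector_derivative intro: has_vector_derivative_at_within)
    moreover have "(c has_vector_derivative \<kappa> (\<theta> t) *\<^sub>R F (c (\<theta> t))) (at (\<theta> t) within \<theta> ` {0..T})"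
      by (rule has_vector_derivative_within_subset[OF der[OF x(1)]]) (use thr in auto)
    ultimately have "(c \<circ> \<theta> has_vector_derivative (1 / K (\<theta> t)) *\<^sub>R (\<kappa> (\<theta> t) *\<^sub>R F (c (\<theta> t)))) (at t within {0..T})"
      by (rule vector_diff_chain_within)
    moreover have "K (\<theta> t) = \<kappa> (\<theta> t)" using q(2)[OF x(1)] by (simp add: K_def)
    ultimately show ?thesis using kpos[OF x(1)] by (simp add: \<gamma>_def)
  qed
  have th_img: "\<theta> ` {0..T} = {a..b}"
  proof
    show "\<theta> ` {0..T} \<subseteq> {a..b}" using thr by auto
    show "{a..b} \<subseteq> \<theta> ` {0..T}"
    proof
      fix x assume x: "x \<in> {a..b}"
      then have "x = \<theta> (\<tau> x)" using th by auto
      then show "x \<in> \<theta> ` {0..T}" using into[OF x] by (rule image_eqI)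
    qed
  qed
  have th_ends: "\<theta> 0 = a" "\<theta> T = b" using th[of a] th[of b] t0 ab by (auto simp: T_def)
  have th_int: "\<theta> ` {0<..<T} = {a<..<b}"
  proof
    show "\<theta> ` {0<..<T} \<subseteq> {a<..<b}"
    proof (rule image_subsetI)
      fix t assume t: "t \<in> {0<..<T}"
      then have "\<theta> t \<in> {a..b}" "\<tau> (\<theta> t) = t" using thr[of t] by auto
      moreover have "\<theta> t \<noteq> a" "\<theta> t \<noteq> b" using calculation(2) t t0 by (auto simp: T_def)
      ultimately show "\<theta> t \<in> {a<..<b}" by auto
    qed
    show "{a<..<b} \<subseteq> \<theta> ` {0<..<T}"
    proof
      fix x assume x: "x \<in> {a<..<b}"
      have "0 < \<tau> x" "\<tau> x < T" using mono[of a x] mono[of x b] x t0 by (auto simp: T_def)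
      moreover have "x = \<theta> (\<tau> x)" using th x by auto
      ultimately show "x \<in> \<theta> ` {0<..<T}" by (metis greaterThanLessThan_iff image_eqI)
    qed
  qed
  show ?thesis
  proof (rule that[OF T gd])
    show "\<gamma> 0 = c a" "\<gamma> T = c b" using th_ends by (auto simp: \<gamma>_def)
    show "\<gamma> ` {0..T} = c ` {a..b}" "\<gamma> ` {0<..<T} = c ` {a<..<b}"
      by (simp_all only: \<gamma>_def image_comp[symmetric] th_img th_int)
  qed
qed

section \<open>Gluing two arcs to a crossing periodic orbit\<close>

lemma orbit_arc_cong:
  assumes "orbit_arc F S \<gamma> a b" "\<And>t. t \<in> {a..b} \<Longrightarrow> \<gamma>' t = \<gamma> t"
  shows "orbit_arc F S \<gamma>' a b"
proof -
  have "(\<gamma>' has_vector_derivative F (\<gamma>' t)) (at t within {a..b})" if t: "t \<in> {a..b}" for t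
    by (rule has_vector_derivative_transform[OF t assms(2)])
       (use assms t in \<open>auto simp: orbit_arc_def\<close>)
  then show ?thesis using assms by (auto simp: orbit_arc_def)
qed

lemma orbit_arc_shift:
  assumes arc: "orbit_arc F S \<gamma> 0 T"
  shows "orbit_arc F S (\<lambda>t. \<gamma> (t - c)) c (c + T)"
proof -
  have "((\<lambda>t. \<gamma> (t - c)) has_vector_derivative F (\<gamma> (t - c))) (at t within {c..c + T})" if t: "t \<in> {c..c + T}" for t
  proof -
    have img: "(\<lambda>t. t - c) ` {c..c + T} \<subseteq> {0..T}" by auto
    have "((\<lambda>t. t - c) has_vector_derivative 1) (at t within {c..c + T})"
      by (auto intro!: derivative_eq_intros)
    moreover have "(\<gamma> has_vector_derivative F (\<gamma> (t - c))) (at (t - c) within (\<lambda>t. t - c) ` {c..c + T})"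
      by (rule has_vector_derivative_within_subset[OF _ img]) (use arc t in \<open>auto simp: orbit_arc_def\<close>)
    ultimately have "(\<gamma> \<circ> (\<lambda>t. t - c) has_vector_derivative 1 *\<^sub>R F (\<gamma> (t - c))) (at t within {c..c + T})"
      by (rule vector_diff_chain_within)
    then show ?thesis by (simp add: o_def)
  qed
  then show ?thesis using arc by (auto simp: orbit_arc_def)
qed

lemma two_arcs_crossing_periodic_orbit:
  assumes a1: "orbit_arc X1 upper_half \<gamma>1 0 T1" and a2: "orbit_arc X2 lower_half \<gamma>2 0 T2"
    and join: "\<gamma>1 T1 = \<gamma>2 0" "\<gamma>2 T2 = \<gamma>1 0"
    and cross: "crossing_point X1 X2 (\<gamma>1 0)" "crossing_point X1 X2 (\<gamma>1 T1)"
  shows "crossing_periodic_orbit X1 X2 (\<gamma>1 ` {0..T1} \<union> \<gamma>2 ` {0..T2})"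
proof -
  have T: "0 < T1" "0 < T2" using a1 a2 by (auto simp: orbit_arc_def)
  define \<gamma> where "\<gamma> = (\<lambda>t. if t \<le> T1 then \<gamma>1 t else \<gamma>2 (t - T1))"
  define \<tau> :: "nat \<Rightarrow> real" where "\<tau> = (\<lambda>i. if i = 0 then 0 else if i = 1 then T1 else T1 + T2)"
  have tau: "\<tau> 0 = 0" "\<tau> (Suc 0) = T1" "\<tau> (Suc (Suc 0)) = T1 + T2" "\<tau> 2 = T1 + T2" by (auto simp: \<tau>_def)
  have o1: "orbit_arc X1 upper_half \<gamma> 0 T1" by (rule orbit_arc_cong[OF a1]) (auto simp: \<gamma>_def)
  have o2: "orbit_arc X2 lower_half \<gamma> T1 (T1 + T2)"
    by (rule orbit_arc_cong[OF orbit_arc_shift[OF a2]]) (use join in \<open>auto simp: \<gamma>_def\<close>)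
  have g: "\<gamma> 0 = \<gamma>1 0" "\<gamma> T1 = \<gamma>1 T1" "\<gamma> (T1 + T2) = \<gamma>1 0" using T join by (auto simp: \<gamma>_def)
  have img: "\<gamma> ` {0..T1 + T2} = \<gamma>1 ` {0..T1} \<union> \<gamma>2 ` {0..T2}"
  proof -
    have "{0..T1 + T2} = {0..T1} \<union> {T1..T1 + T2}" using T by auto
    moreover have "\<gamma> ` {0..T1} = \<gamma>1 ` {0..T1}" by (rule image_cong) (auto simp: \<gamma>_def)
    moreover have "\<gamma> ` {T1..T1 + T2} = (\<lambda>t. \<gamma>2 (t - T1)) ` {T1..T1 + T2}"
      by (rule image_cong) (use join in \<open>auto simp: \<gamma>_def\<close>)
    moreover have "(\<lambda>t. \<gamma>2 (t - T1)) ` {T1..T1 + T2} = \<gamma>2 ` {0..T2}"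
      by (simp only: image_image[of \<gamma>2 "\<lambda>t. t - T1", symmetric]) simp
    ultimately show ?thesis by (simp only: image_Un)
  qed
  show ?thesis
    unfolding crossing_periodic_orbit_def
  proof (intro exI[of _ \<gamma>] exI[of _ "2::nat"] exI[of _ \<tau>] conjI allI impI)
    fix i :: nat assume "i < 2"
    then have "i = 0 \<or> i = Suc 0" by auto
    then show "orbit_arc X1 upper_half \<gamma> (\<tau> i) (\<tau> (Suc i)) \<or> orbit_arc X2 lower_half \<gamma> (\<tau> i) (\<tau> (Suc i))"
      using o1 o2 tau by auto
  next
    fix i :: nat assume "i \<le> 2"
    then have "i = 0 \<or> i = Suc 0 \<or> i = 2" by auto
    then show "crossing_point X1 X2 (\<gamma> (\<tau> i))" using cross g tau by auto
  qed (use g tau img in auto)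
qed

section \<open>Orbit arcs obtained from polar solutions\<close>

context half_chart
begin

lemma V_range:
  assumes "0 < w" "w < d" "0 \<le> h" "h \<le> Y w"
  shows "0 \<le> V h" "V h \<le> w" "Y (V h) = h"
proof -
  obtain v where v: "0 \<le> v" "v \<le> w" "h = Y v" using in_range_Y[of h w] assms by blast
  then have "V h = v" using V_Y[of v] assms by simp
  then show "0 \<le> V h" "V h \<le> w" "Y (V h) = h" using v by auto
qed

lemma V_continuous:
  assumes w: "0 < w" "w < d"
  shows "continuous_on {0..Y w} V"
proof (rule continuous_at_imp_continuous_on, clarify)
  fix h assume "h \<in> {0..Y w}"
  then have "0 \<le> V h" "V h \<le> w" "Y (V h) = h" using V_range[OF w] by auto
  then show "isCont V h" using V_deriv[of "V h"] w DERIV_isCont by fastforce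
qed

definition curve_x :: "(real \<Rightarrow> real) \<Rightarrow> real \<Rightarrow> real" where
  "curve_x r \<phi> = r \<phi> * cos \<phi> * (1 - s * Y (r \<phi> * sin \<phi>)) powr (- l)"

definition curve_h :: "(real \<Rightarrow> real) \<Rightarrow> real \<Rightarrow> real" where
  "curve_h r \<phi> = Y (r \<phi> * sin \<phi>)"

text \<open>The converse passage to \<open>half_arc_lienard_deriv\<close>, with the angle as
  parameter. The function f is kept apart from m v psi and tied to it on [0, w], so that one f and
  one r can serve both charts.\<close>

lemma pulled_back_curve:
  assumes tm: "tame w B f" and w: "w < d" and sol: "polar_solution f w r"
    and f: "\<And>v. 0 \<le> v \<Longrightarrow> v \<le> w \<Longrightarrow> f v = m * v * psi v"
  obtains \<kappa> where "continuous_on {0..pi} \<kappa>" "\<And>\<phi>. \<phi> \<in> {0..pi} \<Longrightarrow> 0 < \<kappa> \<phi>"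
    "\<And>\<phi>. \<phi> \<in> {0..pi} \<Longrightarrow> (curve_x r has_real_derivative \<kappa> \<phi> *
       (- curve_h r \<phi> + s * l * (curve_x r \<phi>)\<^sup>2 + m * curve_x r \<phi> * curve_h r \<phi> + s * n * (curve_h r \<phi>)\<^sup>2)) (at \<phi> within {0..pi})"
    "\<And>\<phi>. \<phi> \<in> {0..pi} \<Longrightarrow> (curve_h r has_real_derivative \<kappa> \<phi> * (curve_x r \<phi> * (1 - s * curve_h r \<phi>))) (at \<phi> within {0..pi})"
proof -
  define v where "v = (\<lambda>\<phi>. r \<phi> * sin \<phi>)"
  define z where "z = (\<lambda>\<phi>. r \<phi> * cos \<phi>)"
  define D where "D = (\<lambda>\<phi>. 1 - f (v \<phi>) * (sin \<phi> * cos \<phi>))"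
  \<comment> \<open>The angle moves at rate D in Lienard time, hence at rate D lam in the time of
    the half system; \<kappa> is dt/d\<phi>.\<close>
  define \<kappa> where "\<kappa> = (\<lambda>\<phi>. 1 / (D \<phi> * lam (v \<phi>)))"
  have r: "0 < r \<phi>" "r \<phi> \<le> w" "(r has_real_derivative polar_field f (r \<phi>) \<phi>) (at \<phi> within {0..pi})"
    if "\<phi> \<in> {0..pi}" for \<phi> using sol that by (auto simp: polar_solution_def)
  have vr: "0 \<le> v \<phi>" "v \<phi> \<le> w" "\<bar>v \<phi>\<bar> < d" if "\<phi> \<in> {0..pi}" for \<phi>
    using mult_sin_range[of "r \<phi>" w \<phi>] r[OF that] that w unfolding v_def by auto
  have Dpos: "0 < D \<phi>" if "\<phi> \<in> {0..pi}" for \<phi>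
    using denominator_bounds(1)[OF tame_bound(2)[OF tm vr(1,2)[OF that]], of \<phi>] unfolding D_def by linarith
  have kpos: "0 < \<kappa> \<phi>" if "\<phi> \<in> {0..pi}" for \<phi>
    using Dpos[OF that] lam_pos[OF vr(3)[OF that]] by (simp add: \<kappa>_def)
  have cr: "continuous_on {0..pi} r" by (rule polar_solution_continuous[OF sol])
  have cv: "continuous_on {0..pi} v" unfolding v_def by (intro continuous_intros cr)
  have cY: "continuous_on {0..pi} (\<lambda>\<phi>. Y (v \<phi>))" "continuous_on {0..pi} (\<lambda>\<phi>. Yd (v \<phi>))"
    by (rule continuous_on_compose2[OF Y_cont cv] continuous_on_compose2[OF Yd_cont cv];
        use vr in \<open>force simp: abs_less_iff\<close>)+
  have cf: "continuous_on {0..pi} (\<lambda>\<phi>. f (v \<phi>))"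
  proof -
    have "B-lipschitz_on {0..w} f" using tm by (auto simp: tame_def lipschitz_on_def dist_real_def)
    then show ?thesis
      by (intro continuous_on_compose2[OF lipschitz_on_continuous_on cv]) (use vr in auto)
  qed
  have pf: "1/2 \<le> 1 - s * Y (v \<phi>)" if "\<phi> \<in> {0..pi}" for \<phi> by (rule factors_pos(1)[OF vr(3)[OF that]])
  have clam: "continuous_on {0..pi} (\<lambda>\<phi>. lam (v \<phi>))"
    unfolding lam_def using pf Yd_pos vr(3) by (intro continuous_intros cY) force+
  have cD: "continuous_on {0..pi} D" unfolding D_def by (intro continuous_intros cf)
  have ck: "continuous_on {0..pi} \<kappa>"
    unfolding \<kappa>_def using Dpos lam_pos vr(3) by (intro continuous_intros cD clam) force
  have dv: "(v has_real_derivative z \<phi> / D \<phi>) (at \<phi> within {0..pi})"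
    and dz: "(z has_real_derivative (f (v \<phi>) * z \<phi> - v \<phi>) / D \<phi>) (at \<phi> within {0..pi})"
    if p: "\<phi> \<in> {0..pi}" for \<phi>
  proof -
    define F where "F = f (v \<phi>)"
    define S where "S = sin \<phi>"
    define C where "C = cos \<phi>"
    have SC: "S * S + C * C = 1" unfolding S_def C_def using sin_cos_squared_add[of \<phi>] by (simp add: power2_eq_square)
    have DD: "D \<phi> = 1 - F * (S * C)" by (simp add: D_def F_def S_def C_def)
    have pfd: "polar_field f (r \<phi>) \<phi> = r \<phi> * (F * (C * C)) / D \<phi>"
      unfolding polar_field_def D_def F_def v_def C_def by (simp add: power2_eq_square)
    have D0: "D \<phi> \<noteq> 0" using Dpos[OF p] by simp
    have "(v has_real_derivative polar_field f (r \<phi>) \<phi> * S + C * r \<phi>) (at \<phi> within {0..pi})"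
      unfolding v_def S_def C_def by (auto intro!: derivative_eq_intros r(3)[OF p])
    moreover have "polar_field f (r \<phi>) \<phi> * S + C * r \<phi> = z \<phi> / D \<phi>"
    proof -
      have "polar_field f (r \<phi>) \<phi> * S + C * r \<phi> = (r \<phi> * (F * (C * C)) * S + C * r \<phi> * D \<phi>) / D \<phi>"
        unfolding pfd add_divide_distrib using D0 by simp
      also have "r \<phi> * (F * (C * C)) * S + C * r \<phi> * D \<phi> = z \<phi>"
        unfolding DD z_def C_def[symmetric] by (simp add: algebra_simps)
      finally show ?thesis .
    qed
    ultimately show "(v has_real_derivative z \<phi> / D \<phi>) (at \<phi> within {0..pi})" by simp
    have "(z has_real_derivative polar_field f (r \<phi>) \<phi> * C - S * r \<phi>) (at \<phi> within {0..pi})"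
      unfolding z_def S_def C_def by (auto intro!: derivative_eq_intros r(3)[OF p])
    moreover have "polar_field f (r \<phi>) \<phi> * C - S * r \<phi> = (F * z \<phi> - v \<phi>) / D \<phi>"
    proof -
      have "polar_field f (r \<phi>) \<phi> * C - S * r \<phi> = (r \<phi> * (F * (C * C)) * C - S * r \<phi> * D \<phi>) / D \<phi>"
        unfolding pfd diff_divide_distrib using D0 by simp
      also have "r \<phi> * (F * (C * C)) * C - S * r \<phi> * D \<phi> = r \<phi> * F * C * (S * S + C * C) - r \<phi> * S"
        unfolding DD by (simp add: algebra_simps)
      also have "\<dots> = F * z \<phi> - v \<phi>" unfolding SC unfolding z_def v_def S_def C_def by simp
      finally show ?thesis .
    qed
    ultimately show "(z has_real_derivative (f (v \<phi>) * z \<phi> - v \<phi>) / D \<phi>) (at \<phi> within {0..pi})"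
      by (simp add: F_def)
  qed
  have H: "(curve_h r has_real_derivative \<kappa> \<phi> * (curve_x r \<phi> * (1 - s * curve_h r \<phi>))) (at \<phi> within {0..pi})"
    and X: "(curve_x r has_real_derivative \<kappa> \<phi> *
       (- curve_h r \<phi> + s * l * (curve_x r \<phi>)\<^sup>2 + m * curve_x r \<phi> * curve_h r \<phi> + s * n * (curve_h r \<phi>)\<^sup>2)) (at \<phi> within {0..pi})"
    if p: "\<phi> \<in> {0..pi}" for \<phi>
  proof -
    define h where "h = Y (v \<phi>)"
    define P where "P = 1 - s * h"
    have P: "1/2 \<le> P" using pf[OF p] by (simp add: P_def h_def)
    have L: "0 < lam (v \<phi>)" "0 < D \<phi>" using lam_pos[OF vr(3)[OF p]] Dpos[OF p] by auto
    have curve_h_v: "curve_h r = (\<lambda>\<phi>. Y (v \<phi>))" and curve_x_z: "curve_x r = (\<lambda>\<phi>. z \<phi> * (1 - s * Y (v \<phi>)) powr (- l))"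
      by (auto simp: curve_h_def curve_x_def v_def z_def fun_eq_iff)
    define x where "x = curve_x r \<phi>"
    have x: "x = z \<phi> * P powr (- l)" by (simp add: x_def curve_x_z P_def h_def)
    have zx: "z \<phi> = P powr l * x" unfolding x using P by (simp add: powr_minus)
    have dH: "(curve_h r has_real_derivative Yd (v \<phi>) * (z \<phi> / D \<phi>)) (at \<phi> within {0..pi})"
      unfolding curve_h_v by (rule DERIV_chain2[OF Y_deriv[OF vr(3)[OF p]] dv[OF p]])
    have eH: "Yd (v \<phi>) * (z \<phi> / D \<phi>) = \<kappa> \<phi> * (x * P)"
    proof -
      have "lam (v \<phi>) * z \<phi> = x * P / Yd (v \<phi>)"
        using lam_identities(2)[OF vr(3)[OF p], of x] unfolding zx P_def h_def .
      then have "Yd (v \<phi>) * z \<phi> = x * P / lam (v \<phi>)" using L Yd_pos[OF vr(3)[OF p]] by (simp add: field_simps)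
      then show ?thesis unfolding \<kappa>_def using L by (simp add: field_simps)
    qed
    show "(curve_h r has_real_derivative \<kappa> \<phi> * (curve_x r \<phi> * (1 - s * curve_h r \<phi>))) (at \<phi> within {0..pi})"
      using dH unfolding eH by (simp add: x_def P_def h_def curve_h_v)
    have dH': "((\<lambda>\<phi>. Y (v \<phi>)) has_real_derivative \<kappa> \<phi> * (x * P)) (at \<phi> within {0..pi})"
      using dH unfolding eH curve_h_v .
    have dP: "((\<lambda>\<phi>. 1 - s * Y (v \<phi>)) has_real_derivative - s * (\<kappa> \<phi> * (x * P))) (at \<phi> within {0..pi})"
      by (auto intro!: derivative_eq_intros dH')
    have "((\<lambda>\<phi>. (1 - s * Y (v \<phi>)) powr (- l)) has_real_derivative
        - l * (1 - s * Y (v \<phi>)) powr (- l - 1) * (- s * (\<kappa> \<phi> * (x * P)))) (at \<phi> within {0..pi})"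
      by (rule DERIV_chain2[OF has_real_derivative_powr dP]) (use pf[OF p] in simp)
    then have "(curve_x r has_real_derivative z \<phi> * (- l * P powr (- l - 1) * (- s * (\<kappa> \<phi> * (x * P)))) +
        (f (v \<phi>) * z \<phi> - v \<phi>) / D \<phi> * P powr (- l)) (at \<phi> within {0..pi})"
      unfolding curve_x_z P_def h_def by (intro DERIV_cong[OF DERIV_mult[OF dz[OF p]]]) (auto simp: algebra_simps)
    moreover have "z \<phi> * (- l * P powr (- l - 1) * (- s * (\<kappa> \<phi> * (x * P)))) +
        (f (v \<phi>) * z \<phi> - v \<phi>) / D \<phi> * P powr (- l)
        = \<kappa> \<phi> * (- h + s * l * x\<^sup>2 + m * x * h + s * n * h\<^sup>2)"
    proof -
      have pp: "P powr (- l - 1) * P = P powr (- l)"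
        using P powr_mult_base[of P "- l - 1"] by (simp add: mult.commute)
      have "z \<phi> * (- l * P powr (- l - 1) * (- s * (\<kappa> \<phi> * (x * P))))
          = \<kappa> \<phi> * s * l * x * (z \<phi> * (P powr (- l - 1) * P))" by (simp add: mult_ac)
      also have "\<dots> = \<kappa> \<phi> * s * l * x * x" unfolding pp x[symmetric] by simp
      finally have 1: "z \<phi> * (- l * P powr (- l - 1) * (- s * (\<kappa> \<phi> * (x * P)))) = \<kappa> \<phi> * s * l * x * x" .
      have "lam (v \<phi>) * (f (v \<phi>) * z \<phi> - v \<phi>) = P powr l * (m * x * h) - h * (1 - n * s * h) * P powr l"
        using lam_identities(1)[OF vr(3)[OF p]] lam_identities(3)[OF vr(3)[OF p], of m x]
        unfolding right_diff_distrib f[OF vr(1,2)[OF p]] zx P_def h_def by simp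
      also have "\<dots> = (m * x * h - h * (1 - n * s * h)) * P powr l" by (simp add: algebra_simps)
      finally have e: "f (v \<phi>) * z \<phi> - v \<phi> = (m * x * h - h * (1 - n * s * h)) * P powr l / lam (v \<phi>)"
        using L by (simp add: field_simps)
      have "(f (v \<phi>) * z \<phi> - v \<phi>) / D \<phi> * P powr (- l)
          = \<kappa> \<phi> * (m * x * h - h * (1 - n * s * h)) * (P powr l * P powr (- l))"
        unfolding e \<kappa>_def by (simp add: mult_ac)
      also have "P powr l * P powr (- l) = 1" using P by (simp add: powr_add[symmetric])
      finally have 2: "(f (v \<phi>) * z \<phi> - v \<phi>) / D \<phi> * P powr (- l) = \<kappa> \<phi> * (m * x * h - h * (1 - n * s * h))"
        by simp
      show ?thesis unfolding 1 2 by (simp add: algebra_simps power2_eq_square)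
    qed
    ultimately show "(curve_x r has_real_derivative \<kappa> \<phi> *
       (- curve_h r \<phi> + s * l * (curve_x r \<phi>)\<^sup>2 + m * curve_x r \<phi> * curve_h r \<phi> + s * n * (curve_h r \<phi>)\<^sup>2)) (at \<phi> within {0..pi})"
      by (simp add: x_def h_def curve_h_v)
  qed
  show ?thesis by (rule that[OF ck kpos X H])
qed

lemma curve_ends: "curve_x r 0 = r 0" "curve_x r pi = - r pi" "curve_h r 0 = 0" "curve_h r pi = 0"
  by (simp_all add: curve_x_def curve_h_def Y0)

lemma curve_h_pos:
  assumes "polar_solution f w r" "w < d" "0 < \<phi>" "\<phi> < pi"
  shows "0 < curve_h r \<phi>"
proof -
  have "0 < r \<phi>" "r \<phi> \<le> w" using assms by (auto simp: polar_solution_def)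
  then have "0 < r \<phi> * sin \<phi>" "r \<phi> * sin \<phi> < d"
    using mult_sin_range(2)[of "r \<phi>" w \<phi>] assms sin_gt_zero by auto
  then show ?thesis unfolding curve_h_def by (rule Y_pos)
qed

end

text \<open>The component of p in the complement of \<Gamma> cannot meet the frontier of W, so by
  connectedness it stays in W and is bounded.\<close>

lemma open_disconnects_inside:
  fixes \<Gamma> W :: "'a::real_normed_vector set"
  assumes "bounded W" "p \<in> W" "p \<notin> \<Gamma>" "frontier W \<subseteq> \<Gamma>"
  shows "p \<in> inside \<Gamma>"
proof -
  let ?K = "connected_component_set (- \<Gamma>) p"
  have p: "p \<in> ?K" using assms(3) by simp
  have "?K \<inter> frontier W = {}" using assms(4) connected_component_subset[of "- \<Gamma>" p] by blast
  then have "?K \<subseteq> W"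
    using connected_Int_frontier[OF connected_connected_component, of "- \<Gamma>" p W] p assms(2) by blast
  then have "bounded ?K" using assms(1) bounded_subset by blast
  then show ?thesis using assms(3) by (simp add: inside_def)
qed

lemma powr_lower_bound:
  fixes u l :: real
  assumes "1/2 \<le> u" "u \<le> 2"
  shows "(1/2) powr \<bar>l\<bar> \<le> u powr l"
proof (cases "0 \<le> l")
  case True
  then show ?thesis using assms by (auto intro: powr_mono2)
next
  case False
  have "(1/2) powr \<bar>l\<bar> = 2 powr l" using False by (simp add: powr_divide powr_minus_divide)
  also have "\<dots> \<le> u powr l" using False assms by (intro powr_mono2') auto
  finally show ?thesis .
qed

section \<open>Polar coordinates around the origin and the closed ovals\<close>

context chart_pair
begin

text \<open>Both half planes are folded onto v \<ge> 0, so a point above and a point below the line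
  may share radius and angle. The two formulas agree on y = 0, where (1 - y)^l = 1 and both charts
  give v = 0.\<close>

definition z_of :: "real \<times> real \<Rightarrow> real" where
  "z_of q = (if snd q \<le> 0 then (1 - snd q) powr l2 * fst q else (1 - snd q) powr l1 * fst q)"

definition v_of :: "real \<times> real \<Rightarrow> real" where
  "v_of q = (if snd q \<le> 0 then B.V (- snd q) else A.V (snd q))"

definition rad_of :: "real \<times> real \<Rightarrow> real" where "rad_of q = sqrt ((z_of q)\<^sup>2 + (v_of q)\<^sup>2)"

definition ang_of :: "real \<times> real \<Rightarrow> real" where "ang_of q = arccos (z_of q / rad_of q)"

definition strip :: "real \<Rightarrow> (real \<times> real) set" where
  "strip w = {q. - Y2 w < snd q \<and> snd q < Y1 w}"

text \<open>The unfolded form of the curve radius = r(angle): one function r describes the part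
  above and the part below the line.\<close>

definition oval :: "(real \<Rightarrow> real) \<Rightarrow> (real \<times> real) set" where
  "oval r = (\<lambda>\<phi>. (A.curve_x r \<phi>, A.curve_h r \<phi>)) ` {0..pi} \<union> (\<lambda>\<phi>. (B.curve_x r \<phi>, - B.curve_h r \<phi>)) ` {0..pi}"

lemma oval_is_orbit:
  assumes tm: "tame w B f" and w: "w < d1" "w < d2" and sol: "polar_solution f w r"
    and f: "\<And>v. 0 \<le> v \<Longrightarrow> v \<le> w \<Longrightarrow> f v = m1 * v * A.psi v"
      "\<And>v. 0 \<le> v \<Longrightarrow> v \<le> w \<Longrightarrow> f v = m2 * v * B.psi v"
  shows "crossing_periodic_orbit (quad_field l1 m1 n1) (quad_field l2 m2 n2) (oval r)"
proof -
  let ?F1 = "quad_field l1 m1 n1" and ?F2 = "quad_field l2 m2 n2"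
  have rpos: "0 < r 0" "0 < r pi" using sol by (auto simp: polar_solution_def)
  obtain \<kappa> where k: "continuous_on {0..pi} \<kappa>" "\<And>\<phi>. \<phi> \<in> {0..pi} \<Longrightarrow> 0 < \<kappa> \<phi>"
    "\<And>\<phi>. \<phi> \<in> {0..pi} \<Longrightarrow> (A.curve_x r has_real_derivative \<kappa> \<phi> *
       (- A.curve_h r \<phi> + 1 * l1 * (A.curve_x r \<phi>)\<^sup>2 + m1 * A.curve_x r \<phi> * A.curve_h r \<phi> + 1 * n1 * (A.curve_h r \<phi>)\<^sup>2)) (at \<phi> within {0..pi})"
    "\<And>\<phi>. \<phi> \<in> {0..pi} \<Longrightarrow> (A.curve_h r has_real_derivative \<kappa> \<phi> * (A.curve_x r \<phi> * (1 - 1 * A.curve_h r \<phi>))) (at \<phi> within {0..pi})"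
    by (rule A.pulled_back_curve[OF tm w(1) sol f(1)], assumption, assumption, rule that)
  obtain \<mu> where u: "continuous_on {0..pi} \<mu>" "\<And>\<phi>. \<phi> \<in> {0..pi} \<Longrightarrow> 0 < \<mu> \<phi>"
    "\<And>\<phi>. \<phi> \<in> {0..pi} \<Longrightarrow> (B.curve_x r has_real_derivative \<mu> \<phi> *
       (- B.curve_h r \<phi> + -1 * l2 * (B.curve_x r \<phi>)\<^sup>2 + m2 * B.curve_x r \<phi> * B.curve_h r \<phi> + -1 * n2 * (B.curve_h r \<phi>)\<^sup>2)) (at \<phi> within {0..pi})"
    "\<And>\<phi>. \<phi> \<in> {0..pi} \<Longrightarrow> (B.curve_h r has_real_derivative \<mu> \<phi> * (B.curve_x r \<phi> * (1 - -1 * B.curve_h r \<phi>))) (at \<phi> within {0..pi})"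
    by (rule B.pulled_back_curve[OF tm w(2) sol f(2)], assumption, assumption, rule that)
  define c1 where "c1 = (\<lambda>\<phi>. (A.curve_x r \<phi>, A.curve_h r \<phi>))"
  \<comment> \<open>The lower part is traversed from angle pi down to 0, because the folded
    coordinates reverse time in the lower half plane.\<close>
  define c2 where "c2 = (\<lambda>\<phi>. (B.curve_x r (pi - \<phi>), - B.curve_h r (pi - \<phi>)))"
  have d1: "(c1 has_vector_derivative \<kappa> \<phi> *\<^sub>R ?F1 (c1 \<phi>)) (at \<phi> within {0..pi})" if p: "\<phi> \<in> {0..pi}" for \<phi>
  proof -
    have "(c1 has_vector_derivative (\<kappa> \<phi> *
       (- A.curve_h r \<phi> + 1 * l1 * (A.curve_x r \<phi>)\<^sup>2 + m1 * A.curve_x r \<phi> * A.curve_h r \<phi> + 1 * n1 * (A.curve_h r \<phi>)\<^sup>2),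
       \<kappa> \<phi> * (A.curve_x r \<phi> * (1 - 1 * A.curve_h r \<phi>)))) (at \<phi> within {0..pi})"
      unfolding c1_def by (intro has_vector_derivative_Pair)
        (use k(3,4)[OF p] in \<open>simp_all only: has_real_derivative_iff_has_vector_derivative\<close>)
    then show ?thesis by (simp add: c1_def quad_field_def)
  qed
  have d2: "(c2 has_vector_derivative \<mu> (pi - \<phi>) *\<^sub>R ?F2 (c2 \<phi>)) (at \<phi> within {0..pi})" if p: "\<phi> \<in> {0..pi}" for \<phi>
  proof -
    have p': "pi - \<phi> \<in> {0..pi}" using p by auto
    have img: "(\<lambda>\<phi>. pi - \<phi>) ` {0..pi} \<subseteq> {0..pi}" by auto
    have i: "((\<lambda>\<phi>. pi - \<phi>) has_real_derivative -1) (at \<phi> within {0..pi})"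
      by (auto intro!: derivative_eq_intros)
    note chX = DERIV_image_chain[OF DERIV_subset[OF u(3)[OF p'] img] i, unfolded o_def]
    note chH = DERIV_image_chain[OF DERIV_subset[OF u(4)[OF p'] img] i, unfolded o_def]
    have "(c2 has_vector_derivative (\<mu> (pi - \<phi>) *
       (- B.curve_h r (pi - \<phi>) + -1 * l2 * (B.curve_x r (pi - \<phi>))\<^sup>2 + m2 * B.curve_x r (pi - \<phi>) * B.curve_h r (pi - \<phi>) +
         -1 * n2 * (B.curve_h r (pi - \<phi>))\<^sup>2) * -1,
       - (\<mu> (pi - \<phi>) * (B.curve_x r (pi - \<phi>) * (1 - -1 * B.curve_h r (pi - \<phi>))) * -1))) (at \<phi> within {0..pi})"
      unfolding c2_def by (intro has_vector_derivative_Pair)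
        (use chX DERIV_minus[OF chH] in \<open>simp_all only: has_real_derivative_iff_has_vector_derivative\<close>)
    then show ?thesis by (simp add: c2_def quad_field_def algebra_simps)
  qed
  have cu: "continuous_on {0..pi} (\<lambda>\<phi>. \<mu> (pi - \<phi>))"
    by (rule continuous_on_compose2[OF u(1)]) (auto intro!: continuous_intros)
  have pu: "0 < \<mu> (pi - \<phi>)" if "\<phi> \<in> {0..pi}" for \<phi> using u(2)[of "pi - \<phi>"] that by simp
  obtain T1 \<gamma>1 where g1: "0 < T1" "\<And>t. t \<in> {0..T1} \<Longrightarrow> (\<gamma>1 has_vector_derivative ?F1 (\<gamma>1 t)) (at t within {0..T1})"
    "\<gamma>1 0 = c1 0" "\<gamma>1 T1 = c1 pi" "\<gamma>1 ` {0..T1} = c1 ` {0..pi}" "\<gamma>1 ` {0<..<T1} = c1 ` {0<..<pi}"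
    by (rule time_reparametrization[OF pi_gt_zero k(1,2) d1], assumption, assumption, rule that)
  obtain T2 \<gamma>2 where g2: "0 < T2" "\<And>t. t \<in> {0..T2} \<Longrightarrow> (\<gamma>2 has_vector_derivative ?F2 (\<gamma>2 t)) (at t within {0..T2})"
    "\<gamma>2 0 = c2 0" "\<gamma>2 T2 = c2 pi" "\<gamma>2 ` {0..T2} = c2 ` {0..pi}" "\<gamma>2 ` {0<..<T2} = c2 ` {0<..<pi}"
    by (rule time_reparametrization[OF pi_gt_zero cu pu d2], assumption, assumption, rule that)
  have e1: "c1 0 = (r 0, 0)" "c1 pi = (- r pi, 0)" by (simp_all add: c1_def A.curve_ends)
  have e2: "c2 0 = (- r pi, 0)" "c2 pi = (r 0, 0)" by (simp_all add: c2_def B.curve_ends)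
  have "c1 ` {0<..<pi} \<subseteq> upper_half"
    using A.curve_h_pos[OF sol w(1)] by (auto simp: c1_def upper_half_def)
  then have "\<gamma>1 t \<in> upper_half" if "t \<in> {0<..<T1}" for t using imageI[OF that, of \<gamma>1] g1(6) by blast
  then have a1: "orbit_arc ?F1 upper_half \<gamma>1 0 T1"
    unfolding orbit_arc_def using g1 e1 by (auto simp: separation_line_def)
  have "c2 ` {0<..<pi} \<subseteq> lower_half"
    using B.curve_h_pos[OF sol w(2)] by (auto simp: c2_def lower_half_def)
  then have "\<gamma>2 t \<in> lower_half" if "t \<in> {0<..<T2}" for t using imageI[OF that, of \<gamma>2] g2(6) by blast
  then have a2: "orbit_arc ?F2 lower_half \<gamma>2 0 T2"
    unfolding orbit_arc_def using g2 e2 by (auto simp: separation_line_def)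
  have "crossing_periodic_orbit ?F1 ?F2 (\<gamma>1 ` {0..T1} \<union> \<gamma>2 ` {0..T2})"
    by (rule two_arcs_crossing_periodic_orbit[OF a1 a2])
       (use g1 g2 e1 e2 rpos in \<open>auto simp: crossing_point_def separation_line_def quad_field_def\<close>)
  moreover have "c2 ` {0..pi} = (\<lambda>\<phi>. (B.curve_x r \<phi>, - B.curve_h r \<phi>)) ` {0..pi}"
  proof -
    have "c2 ` {0..pi} = (\<lambda>\<phi>. (B.curve_x r \<phi>, - B.curve_h r \<phi>)) ` ((\<lambda>\<phi>. pi - \<phi>) ` {0..pi})"
      by (simp only: c2_def image_image)
    also have "(\<lambda>\<phi>. pi - \<phi>) ` {0..pi} = {0..pi}" by simp
    finally show ?thesis .
  qed
  ultimately show ?thesis unfolding oval_def g1(5) g2(5) c1_def by simp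
qed

lemma strip_coordinates:
  assumes w: "0 < w" "w < d1" "w < d2" and q: "q \<in> strip w"
  shows "0 \<le> v_of q" "v_of q \<le> w" "snd q \<le> 0 \<Longrightarrow> Y2 (v_of q) = - snd q" "0 \<le> snd q \<Longrightarrow> Y1 (v_of q) = snd q"
    "rad_of q = 0 \<longleftrightarrow> q = (0, 0)" "\<bar>fst q\<bar> \<le> rad_of q * (2 powr \<bar>l1\<bar> + 2 powr \<bar>l2\<bar>)"
    "z_of q = rad_of q * cos (ang_of q)" "v_of q = rad_of q * sin (ang_of q)" "0 \<le> ang_of q" "ang_of q \<le> pi"
    "snd q \<le> 0 \<Longrightarrow> 1/2 \<le> 1 - snd q" "0 \<le> snd q \<Longrightarrow> 1/2 \<le> 1 - snd q"
proof -
  have y: "snd q < Y1 w" "- snd q < Y2 w" using q by (auto simp: strip_def)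
  have V0: "A.V 0 = 0" "B.V 0 = 0" using A.V_Y[of 0] B.V_Y[of 0] A.d B.d A.Y0 B.Y0 by auto
  have vB: "v_of q = B.V (- snd q) \<and> 0 \<le> v_of q \<and> v_of q \<le> w \<and> Y2 (v_of q) = - snd q" if "snd q \<le> 0"
    using B.V_range[OF w(1,3), of "- snd q"] that y by (auto simp: v_of_def)
  have vA: "v_of q = A.V (snd q) \<and> 0 \<le> v_of q \<and> v_of q \<le> w \<and> Y1 (v_of q) = snd q" if "0 \<le> snd q"
    using A.V_range[OF w(1,2), of "snd q"] that y V0 by (cases "snd q = 0") (auto simp: v_of_def A.Y0)
  show v: "0 \<le> v_of q" "v_of q \<le> w" using vA vB by linarith+
  show "snd q \<le> 0 \<Longrightarrow> Y2 (v_of q) = - snd q" "0 \<le> snd q \<Longrightarrow> Y1 (v_of q) = snd q" using vA vB by auto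
  have yb: "\<bar>snd q\<bar> \<le> 1/2"
  proof (cases "snd q \<le> 0")
    case True
    then show ?thesis using vB[OF True] B.Y_small[of "v_of q"] w by auto
  next
    case False
    then show ?thesis using vA A.Y_small[of "v_of q"] w by auto
  qed
  then have fac: "1/2 \<le> 1 - snd q" "1 - snd q \<le> 2" by auto
  show "snd q \<le> 0 \<Longrightarrow> 1/2 \<le> 1 - snd q" "0 \<le> snd q \<Longrightarrow> 1/2 \<le> 1 - snd q" using fac by auto
  \<comment> \<open>From 1/2 \<le> 1 - y \<le> 2 the power in z is at least 2^(- |l|), which bounds
    |x| by |z|. The sum of the two constants covers both half planes at once.\<close>
  have zb: "\<bar>fst q\<bar> \<le> \<bar>z_of q\<bar> * (2 powr \<bar>l1\<bar> + 2 powr \<bar>l2\<bar>)"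
  proof -
    have "\<bar>fst q\<bar> \<le> (1 - snd q) powr l * \<bar>fst q\<bar> * 2 powr \<bar>l\<bar>" for l
    proof -
      have "1 = (1/2) powr \<bar>l\<bar> * 2 powr \<bar>l\<bar>" by (simp add: powr_mult[symmetric])
      also have "\<dots> \<le> (1 - snd q) powr l * 2 powr \<bar>l\<bar>"
        using powr_lower_bound[OF fac] by (intro mult_right_mono) auto
      finally have "1 * \<bar>fst q\<bar> \<le> (1 - snd q) powr l * 2 powr \<bar>l\<bar> * \<bar>fst q\<bar>" by (intro mult_right_mono) auto
      then show ?thesis by (simp add: mult_ac)
    qed
    then have "\<bar>fst q\<bar> \<le> \<bar>z_of q\<bar> * 2 powr \<bar>l1\<bar> \<or> \<bar>fst q\<bar> \<le> \<bar>z_of q\<bar> * 2 powr \<bar>l2\<bar>"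
      by (auto simp: z_of_def abs_mult)
    moreover have "\<bar>z_of q\<bar> * 2 powr \<bar>l1\<bar> \<le> \<bar>z_of q\<bar> * (2 powr \<bar>l1\<bar> + 2 powr \<bar>l2\<bar>)"
      "\<bar>z_of q\<bar> * 2 powr \<bar>l2\<bar> \<le> \<bar>z_of q\<bar> * (2 powr \<bar>l1\<bar> + 2 powr \<bar>l2\<bar>)"
      by (auto intro!: mult_left_mono)
    ultimately show ?thesis by linarith
  qed
  have zR: "\<bar>z_of q\<bar> \<le> rad_of q" unfolding rad_of_def by (rule real_sqrt_ge_abs1)
  have "\<bar>z_of q\<bar> * (2 powr \<bar>l1\<bar> + 2 powr \<bar>l2\<bar>) \<le> rad_of q * (2 powr \<bar>l1\<bar> + 2 powr \<bar>l2\<bar>)"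
    using zR by (intro mult_right_mono) auto
  then show fb: "\<bar>fst q\<bar> \<le> rad_of q * (2 powr \<bar>l1\<bar> + 2 powr \<bar>l2\<bar>)" using zb by linarith
  show R0: "rad_of q = 0 \<longleftrightarrow> q = (0, 0)"
  proof
    assume R: "rad_of q = 0"
    then have "fst q = 0" using fb by simp
    moreover have "v_of q = 0" using R by (simp add: rad_of_def)
    then have "snd q = 0" using vA vB A.Y0 B.Y0 by (cases "snd q \<le> 0") auto
    ultimately show "q = (0, 0)" by (simp add: prod_eq_iff)
  qed (simp add: rad_of_def z_of_def v_of_def V0)
  have Rn: "0 \<le> rad_of q" by (simp add: rad_of_def)
  have cs: "z_of q = rad_of q * cos (ang_of q) \<and> v_of q = rad_of q * sin (ang_of q) \<and> 0 \<le> ang_of q \<and> ang_of q \<le> pi"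
  proof (cases "rad_of q = 0")
    case True
    then have "z_of q = 0" "v_of q = 0" by (auto simp: rad_of_def)
    then show ?thesis using True by (simp add: ang_of_def)
  next
    case False
    then have Rp: "0 < rad_of q" using Rn by simp
    have sq: "(rad_of q)\<^sup>2 = (z_of q)\<^sup>2 + (v_of q)\<^sup>2" by (simp add: rad_of_def)
    have b: "- 1 \<le> z_of q / rad_of q" "z_of q / rad_of q \<le> 1" using zR Rp by (auto simp: field_simps)
    have c: "cos (ang_of q) = z_of q / rad_of q" unfolding ang_of_def by (rule cos_arccos[OF b])
    have "1 - (z_of q / rad_of q)\<^sup>2 = (v_of q / rad_of q)\<^sup>2"
    proof -
      have "(z_of q / rad_of q)\<^sup>2 + (v_of q / rad_of q)\<^sup>2 = 1"
        unfolding power_divide add_divide_distrib[symmetric] sq[symmetric] using Rp by simp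
      then show ?thesis by simp
    qed
    moreover have "\<bar>z_of q / rad_of q\<bar> \<le> 1" unfolding abs_le_iff using b by linarith
    ultimately have "sin (ang_of q) = sqrt ((v_of q / rad_of q)\<^sup>2)" unfolding ang_of_def by (simp only: sin_arccos_abs)
    then have "sin (ang_of q) = v_of q / rad_of q" using v Rp by simp
    then show ?thesis using c Rp arccos_lbound[OF b] arccos_ubound[OF b] by (simp add: ang_of_def)
  qed
  then show "z_of q = rad_of q * cos (ang_of q)" "v_of q = rad_of q * sin (ang_of q)" "0 \<le> ang_of q" "ang_of q \<le> pi" by auto
qed

lemma strip_open: "open (strip w)"
proof -
  have "strip w = {q. - Y2 w < snd q} \<inter> {q. snd q < Y1 w}" by (auto simp: strip_def)
  then show ?thesis by (auto intro!: open_Int open_Collect_less continuous_intros)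
qed

lemma strip_continuous:
  assumes w: "0 < w" "w < d1" "w < d2"
  shows "continuous_on (strip w) rad_of" "continuous_on (strip w - {(0, 0)}) ang_of"
proof -
  have V0: "A.V 0 = 0" "B.V 0 = 0" using A.V_Y[of 0] B.V_Y[of 0] A.d B.d A.Y0 B.Y0 by auto
  have fac: "1 - snd q \<noteq> 0" if "q \<in> strip w" for q
    using strip_coordinates(11,12)[OF w that] by force
  have cz: "continuous_on (strip w) z_of"
    unfolding z_of_def[abs_def]
    by (rule continuous_on_cases_le[where h = snd and a = 0])
       (use fac in \<open>auto intro!: continuous_intros\<close>)
  have cv: "continuous_on (strip w) v_of"
    unfolding v_of_def[abs_def]
  proof (rule continuous_on_cases_le[where h = snd and a = 0])
    show "continuous_on {t \<in> strip w. snd t \<le> 0} (\<lambda>q. B.V (- snd q))"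
      by (rule continuous_on_compose2[OF B.V_continuous[OF w(1,3)]])
         (auto intro!: continuous_intros simp: strip_def)
    show "continuous_on {t \<in> strip w. 0 \<le> snd t} (\<lambda>q. A.V (snd q))"
      by (rule continuous_on_compose2[OF A.V_continuous[OF w(1,2)]])
         (auto intro!: continuous_intros simp: strip_def)
  qed (auto intro!: continuous_intros simp: V0)
  show cR: "continuous_on (strip w) rad_of" unfolding rad_of_def[abs_def] by (intro continuous_intros cz cv)
  have b: "- 1 \<le> z_of q / rad_of q \<and> z_of q / rad_of q \<le> 1" if "q \<in> strip w - {(0, 0)}" for q
  proof -
    have "rad_of q \<noteq> 0" using strip_coordinates(5)[OF w] that by auto
    moreover have "0 \<le> rad_of q" by (simp add: rad_of_def)
    ultimately have "0 < rad_of q" by simp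
    moreover have "\<bar>z_of q\<bar> \<le> rad_of q" unfolding rad_of_def by (rule real_sqrt_ge_abs1)
    ultimately show ?thesis by (auto simp: field_simps)
  qed
  show "continuous_on (strip w - {(0, 0)}) ang_of"
    unfolding ang_of_def[abs_def]
  proof (rule continuous_on_arccos)
    show "continuous_on (strip w - {(0, 0)}) (\<lambda>q. z_of q / rad_of q)"
      by (intro continuous_on_divide continuous_on_subset[OF cz] continuous_on_subset[OF cR])
         (use strip_coordinates(5)[OF w] in auto)
  qed (use b in auto)
qed

lemma mem_oval:
  assumes w: "0 < w" "w < d1" "w < d2" and q: "q \<in> strip w" and eq: "rad_of q = r (ang_of q)"
  shows "q \<in> oval r"
proof -
  note S = strip_coordinates[OF w q]
  have v: "r (ang_of q) * sin (ang_of q) = v_of q" "r (ang_of q) * cos (ang_of q) = z_of q" using S(7,8) eq by auto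
  have a: "ang_of q \<in> {0..pi}" using S(9,10) by simp
  have inv: "u powr l * x * u powr (- l) = x" if "1/2 \<le> u" for u l x :: real
    using that by (simp add: powr_minus)
  show ?thesis
  proof (cases "snd q \<le> 0")
    case True
    have "B.curve_x r (ang_of q) = fst q"
      unfolding B.curve_x_def v S(3)[OF True] using inv[OF S(11)[OF True]] True by (simp add: z_of_def)
    moreover have "B.curve_h r (ang_of q) = - snd q" unfolding B.curve_h_def v S(3)[OF True] ..
    ultimately have "q = (B.curve_x r (ang_of q), - B.curve_h r (ang_of q))" by (simp add: prod_eq_iff)
    then show ?thesis unfolding oval_def using a by blast
  next
    case False
    then have y: "0 \<le> snd q" by simp
    have "A.curve_x r (ang_of q) = fst q"
      unfolding A.curve_x_def v S(4)[OF y] using inv[OF S(12)[OF y]] False by (simp add: z_of_def)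
    moreover have "A.curve_h r (ang_of q) = snd q" unfolding A.curve_h_def v S(4)[OF y] ..
    ultimately have "q = (A.curve_x r (ang_of q), A.curve_h r (ang_of q))" by (simp add: prod_eq_iff)
    then show ?thesis unfolding oval_def using a by blast
  qed
qed

lemma origin_inside_oval:
  assumes w: "0 < w" "w < d1" "w < d2" and r: "continuous_on {0..pi} r"
    and bounds: "0 < r0" "M < w" "\<And>\<phi>. \<phi> \<in> {0..pi} \<Longrightarrow> r0 \<le> r \<phi> \<and> r \<phi> \<le> M"
  shows "(0, 0) \<in> inside (oval r)"
proof -
  let ?O = "strip w - {(0::real, 0::real)}"
  have oO: "open ?O" using strip_open by (simp add: open_delete)
  have cA: "continuous_on ?O (\<lambda>q. r (ang_of q))"
    by (rule continuous_on_compose2[OF r strip_continuous(2)[OF w]]) (use strip_coordinates(9,10)[OF w] in auto)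
  have cR: "continuous_on ?O rad_of" by (rule continuous_on_subset[OF strip_continuous(1)[OF w]]) auto
  \<comment> \<open>The angle is not continuous at the origin, so openness of radius < r(angle) is
    available off the origin only. The disc radius < r0 is open too and, as r0 \<le> r, it adds just
    the origin.\<close>
  define W where "W = {q \<in> strip w. rad_of q < r0} \<union> {q \<in> ?O. rad_of q < r (ang_of q)}"
  have oS: "open {q \<in> strip w. rad_of q < r0}"
    using continuous_open_preimage[OF strip_continuous(1)[OF w] strip_open open_lessThan[of r0]]
    by (simp add: vimage_def Int_def)
  have op: "open {q \<in> ?O. 0 < g q}" if "continuous_on ?O g" for g :: "real \<times> real \<Rightarrow> real"
    using continuous_open_preimage[OF that oO open_greaterThan[of 0]] by (simp add: vimage_def Int_def)
  have oT: "open {q \<in> ?O. rad_of q < r (ang_of q)}"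
    using op[of "\<lambda>q. r (ang_of q) - rad_of q"] cA cR by (simp add: continuous_on_diff)
  have oC: "open {q \<in> ?O. r (ang_of q) < rad_of q}"
    using op[of "\<lambda>q. rad_of q - r (ang_of q)"] cA cR by (simp add: continuous_on_diff)
  have oW: "open W" unfolding W_def by (intro open_Un oS oT)
  have a: "ang_of q \<in> {0..pi}" if "q \<in> strip w" for q using strip_coordinates(9,10)[OF w that] by simp
  have r0M: "r0 \<le> M" using bounds(3)[of 0] by force
  have WM: "q \<in> strip w \<and> rad_of q < M" if "q \<in> W" for q
    using that bounds(3)[OF a[of q]] r0M unfolding W_def by auto
  have ORIG: "(0, 0) \<in> strip w" using A.Y_pos[OF w(1,2)] B.Y_pos[OF w(1,3)] by (simp add: strip_def)
  have R00: "rad_of (0, 0) = 0" using strip_coordinates(5)[OF w ORIG] by simp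
  have zW: "(0, 0) \<in> W" using ORIG R00 bounds(1) by (simp add: W_def)
  have M0: "0 < M" using r0M bounds(1) by simp
  \<comment> \<open>M < w leaves room: W lies in a closed strip contained in the open one, so the
    frontier of W stays where the coordinates are continuous.\<close>
  define S where "S = {q :: real \<times> real. - Y2 M \<le> snd q \<and> snd q \<le> Y1 M}"
  have WS: "W \<subseteq> S"
  proof
    fix q assume "q \<in> W"
    then have q: "q \<in> strip w" "rad_of q < M" using WM by auto
    note C = strip_coordinates[OF w q(1)]
    have "v_of q \<le> rad_of q" unfolding rad_of_def by (rule order_trans[OF abs_ge_self real_sqrt_ge_abs2])
    then have v: "v_of q < M" using q(2) by simp
    have "Y1 (v_of q) < Y1 M" "Y2 (v_of q) < Y2 M" using A.Y_mono[of "v_of q" M] B.Y_mono[of "v_of q" M] C(1) v w bounds(2) A.d B.d by auto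
    moreover have "0 < Y1 M" "0 < Y2 M" using A.Y_pos[of M] B.Y_pos[of M] M0 bounds(2) w by auto
    ultimately show "q \<in> S" using C(3,4) unfolding S_def by (cases "snd q \<le> 0") auto
  qed
  have clS: "closed S"
  proof -
    have "S = {q. - Y2 M \<le> snd q} \<inter> {q. snd q \<le> Y1 M}" by (auto simp: S_def)
    then show ?thesis by (auto intro!: closed_Int closed_Collect_le continuous_intros)
  qed
  have Ssub: "S \<subseteq> strip w"
    using A.Y_mono[of M w] B.Y_mono[of M w] M0 bounds(2) w A.d B.d unfolding S_def strip_def by auto
  have clW: "closure W \<subseteq> strip w" using closure_minimal[OF WS clS] Ssub by blast
  have "frontier W \<subseteq> oval r"
  proof
    fix q assume "q \<in> frontier W"
    then have q: "q \<in> closure W" "q \<notin> W" using oW by (auto simp: frontier_def interior_open)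
    have qs: "q \<in> strip w" using q(1) clW by blast
    have q0: "q \<noteq> (0, 0)" using q(2) zW by auto
    have ge: "r (ang_of q) \<le> rad_of q" using q(2) qs q0 by (auto simp: W_def)
    have "\<not> r (ang_of q) < rad_of q"
    proof
      assume "r (ang_of q) < rad_of q"
      then have "q \<in> {q \<in> ?O. r (ang_of q) < rad_of q}" using qs q0 by simp
      moreover have "{q \<in> ?O. r (ang_of q) < rad_of q} \<inter> W = {}"
        using bounds(3) a unfolding W_def by fastforce
      ultimately show False using q(1) oC open_Int_closure_eq_empty by blast
    qed
    then show "q \<in> oval r" using mem_oval[OF w qs] ge by simp
  qed
  moreover have "bounded W"
  proof -
    let ?K = "M * (2 powr \<bar>l1\<bar> + 2 powr \<bar>l2\<bar>)"
    have "W \<subseteq> {- ?K..?K} \<times> {- Y2 M..Y1 M}"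
    proof
      fix q assume q: "q \<in> W"
      have "\<bar>fst q\<bar> \<le> rad_of q * (2 powr \<bar>l1\<bar> + 2 powr \<bar>l2\<bar>)" using strip_coordinates(6)[OF w] WM[OF q] by blast
      also have "\<dots> \<le> ?K" using WM[OF q] by (intro mult_right_mono) auto
      finally show "q \<in> {- ?K..?K} \<times> {- Y2 M..Y1 M}"
        using WS q by (auto simp: S_def mem_Times_iff abs_le_iff)
    qed
    then show ?thesis by (rule bounded_subset[rotated]) (intro bounded_Times bounded_closed_interval)
  qed
  moreover have "(0, 0) \<notin> oval r"
  proof
    assume "(0, 0) \<in> oval r"
    then obtain \<phi> where p: "\<phi> \<in> {0..pi}"
      and "(A.curve_x r \<phi> = 0 \<and> A.curve_h r \<phi> = 0) \<or> (B.curve_x r \<phi> = 0 \<and> B.curve_h r \<phi> = 0)"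
      by (auto simp: oval_def)
    moreover have rp: "0 < r \<phi>" "r \<phi> < w" using bounds p by force+
    have v: "0 \<le> r \<phi> * sin \<phi>" "r \<phi> * sin \<phi> < w"
    proof -
      have "0 \<le> r \<phi>" "0 \<le> \<phi>" "\<phi> \<le> pi" using rp p by auto
      from mult_sin_range(1)[OF this(1) order_refl this(2,3)] mult_sin_range(3)[OF this(1) order_refl this(2,3)]
      show "0 \<le> r \<phi> * sin \<phi>" "r \<phi> * sin \<phi> < w" using rp by linarith+
    qed
    have "0 < 1 - 1 * Y1 (r \<phi> * sin \<phi>)" "0 < 1 - -1 * Y2 (r \<phi> * sin \<phi>)"
      using A.factors_pos(1)[of "r \<phi> * sin \<phi>"] B.factors_pos(1)[of "r \<phi> * sin \<phi>"] v w by auto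
    ultimately have "cos \<phi> = 0" "Y1 (r \<phi> * sin \<phi>) = 0 \<or> Y2 (r \<phi> * sin \<phi>) = 0"
      using rp by (auto simp: A.curve_x_def B.curve_x_def A.curve_h_def B.curve_h_def)
    then have "r \<phi> * sin \<phi> = 0" using A.Y_pos[of "r \<phi> * sin \<phi>"] B.Y_pos[of "r \<phi> * sin \<phi>"] v w by force
    then have "sin \<phi> = 0" using rp by simp
    then show False using \<open>cos \<phi> = 0\<close> sin_cos_squared_add[of \<phi>] by simp
  qed
  ultimately show ?thesis using zW by (intro open_disconnects_inside)
qed

text \<open>With the same f on both sides, the upper and the lower arc obtained from one polar
  solution meet at both ends, so every polar solution closes up.\<close>

lemma center_of_equal_lienard:
  assumes e: "0 < e" and eq: "\<And>v. 0 < v \<Longrightarrow> v < e \<Longrightarrow> m1 * A.psi v = m2 * B.psi v"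
  shows "origin_is_center (quad_field l1 m1 n1) (quad_field l2 m2 n2)"
proof -
  let ?F1 = "quad_field l1 m1 n1" and ?F2 = "quad_field l2 m2 n2"
  define f where "f = (\<lambda>v. m1 * v * A.psi v)"
  obtain B w0 where w0: "0 < w0" "w0 < d1" "\<And>u. 0 < u \<Longrightarrow> u \<le> w0 \<Longrightarrow> tame u B f"
    unfolding f_def using A.tame_lienard by blast
  define w where "w = Min {w0, e / 2, d2 / 2}"
  have w: "0 < w" "w \<le> w0" "w < e" "w < d1" "w < d2" using w0 e B.d by (auto simp: w_def)
  have tm: "tame w B f" by (rule w0(3)[OF w(1,2)])
  have f2: "f v = m2 * v * B.psi v" if "0 \<le> v" "v \<le> w" for v
  proof (cases "v = 0")
    case False
    have "f v = v * (m1 * A.psi v)" by (simp add: f_def)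
    also have "\<dots> = v * (m2 * B.psi v)" using eq[of v] False that w by simp
    finally show ?thesis by simp
  qed (simp add: f_def)
  note S = strip_coordinates[OF w(1,4,5)]
  have ORIG: "(0, 0) \<in> strip w" using A.Y_pos[OF w(1,4)] B.Y_pos[OF w(1,5)] by (simp add: strip_def)
  have through: "\<exists>\<Gamma>. crossing_periodic_orbit ?F1 ?F2 \<Gamma> \<and> (0, 0) \<in> inside \<Gamma> \<and> p \<in> \<Gamma>"
    if p: "p \<in> strip w" "p \<noteq> (0, 0)" "rad_of p < w / 2" for p
  proof -
    have "0 \<le> rad_of p" by (simp add: rad_of_def)
    then have R0: "0 < rad_of p" "rad_of p \<le> w / 2" using S(5)[OF p(1)] p by auto
    \<comment> \<open>The equation is solved from the angle of p in both directions, over all of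
      [0, pi]; rad_of p < w / 2 keeps the solution below 3/4 w.\<close>
    obtain r where r: "polar_solution f w r" "r (ang_of p) = rad_of p"
      "\<And>\<phi>. \<phi> \<in> {0..pi} \<Longrightarrow> rad_of p / 2 \<le> r \<phi>" "\<And>\<phi>. \<phi> \<in> {0..pi} \<Longrightarrow> r \<phi> \<le> 3 / 2 * rad_of p"
      by (rule polar_solution_exists[OF tm R0 S(9,10)[OF p(1)]]) (rule that)
    have "crossing_periodic_orbit ?F1 ?F2 (oval r)"
      by (rule oval_is_orbit[OF tm w(4,5) r(1) _ f2]) (simp_all add: f_def)
    moreover have "(0, 0) \<in> inside (oval r)"
      by (rule origin_inside_oval[OF w(1,4,5) polar_solution_continuous[OF r(1)], of "rad_of p / 2" "3 / 2 * rad_of p"])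
         (use r R0 p(3) in auto)
    moreover have "p \<in> oval r" by (rule mem_oval[OF w(1,4,5) p(1)]) (use r(2) in simp)
    ultimately show ?thesis by blast
  qed
  define N where "N = {q \<in> strip w. rad_of q < w / 2}"
  have "open N"
    unfolding N_def
    using continuous_open_preimage[OF strip_continuous(1)[OF w(1,4,5)] strip_open open_lessThan[of "w / 2"]]
    by (simp add: vimage_def Int_def)
  moreover have "(0, 0) \<in> N" using ORIG S(5)[OF ORIG] w by (simp add: N_def)
  \<comment> \<open>As the union of all crossing periodic orbits around the origin, U contains with
    each point the whole orbit through it. The open set N shows that U is a neighborhood.\<close>
  moreover define U where "U = insert (0, 0) (\<Union>{\<Gamma>. crossing_periodic_orbit ?F1 ?F2 \<Gamma> \<and> (0, 0) \<in> inside \<Gamma>})"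
  have "N \<subseteq> U"
  proof
    fix q assume "q \<in> N"
    then show "q \<in> U" using through[of q] by (cases "q = (0, 0)") (auto simp: N_def U_def)
  qed
  ultimately have "(0, 0) \<in> interior U" using interior_maximal[of N U] by blast
  moreover have "\<exists>\<Gamma>. crossing_periodic_orbit ?F1 ?F2 \<Gamma> \<and> (0, 0) \<in> inside \<Gamma> \<and> p \<in> \<Gamma> \<and> \<Gamma> \<subseteq> U - {(0, 0)}"
    if p: "p \<in> U - {(0, 0)}" for p
  proof -
    obtain \<Gamma> where G: "crossing_periodic_orbit ?F1 ?F2 \<Gamma>" "(0, 0) \<in> inside \<Gamma>" "p \<in> \<Gamma>"
      using p by (auto simp: U_def)
    have "(0, 0) \<notin> \<Gamma>" using G(2) inside_no_overlap[of \<Gamma>] by blast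
    then have "\<Gamma> \<subseteq> U - {(0, 0)}" using G by (auto simp: U_def)
    then show ?thesis using G by blast
  qed
  ultimately show ?thesis unfolding origin_is_center_def by blast
qed

end

lemma center_conditions_sufficient:
  fixes l1 l2 m1 m2 n1 n2 :: real
  assumes H: "(m1 = 0 \<and> m2 = 0) \<or>
    (l1 - l2 = 0 \<and> m1 - m2 = 0 \<and> l1 + n2 = 0 \<and> l1 + n1 = 0) \<or>
    (l1 + l2 + 1 = 0 \<and> m1 - m2 = 0 \<and> n1 + n2 - 1 = 0)"
  shows "origin_is_center (quad_field l1 m1 n1) (quad_field l2 m2 n2)"
proof -
  obtain d1 Y1 Yd1 where h1: "half_chart 1 l1 n1 d1 Y1 Yd1"
    using half_chart_exists[of 1 l1 n1] by blast
  obtain d2 Y2 Yd2 where h2: "half_chart (-1) l2 n2 d2 Y2 Yd2"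
    using half_chart_exists[of "-1" l2 n2] by blast
  interpret chart_pair l1 n1 d1 Y1 Yd1 l2 n2 d2 Y2 Yd2
    using h1 h2 by (simp add: chart_pair_def)
  from H show ?thesis
  proof (elim disjE conjE)
    assume "m1 = 0" "m2 = 0"
    then show ?thesis by (intro center_of_equal_lienard[of 1]) auto
  next
    assume H: "l1 - l2 = 0" "m1 - m2 = 0" "l1 + n2 = 0" "l1 + n1 = 0"
    then have lv: "l1 = l2" "n1 = - l1" "n2 = - l1" "m1 = m2" by linarith+
    show ?thesis
      by (rule center_of_equal_lienard[of "min d1 d2"])
         (use psi_eq_lotka_volterra[OF lv(1-3)] lv(4) A.d B.d in auto)
  next
    assume H: "l1 + l2 + 1 = 0" "m1 - m2 = 0" "n1 + n2 - 1 = 0"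
    then have inv: "l2 = - 1 - l1" "n2 = 1 - n1" "m1 = m2" by linarith+
    obtain e where e: "0 < e" "\<And>v. 0 < v \<Longrightarrow> v < e \<Longrightarrow> A.psi v = B.psi v"
      using psi_eq_involution[OF inv(1,2)] by blast
    show ?thesis by (rule center_of_equal_lienard[OF e(1)]) (use e(2) inv(3) in auto)
  qed
qed

theorem theorem1p4:
  fixes l1 l2 m1 m2 n1 n2 :: real
  shows "origin_is_center (quad_field l1 m1 n1) (quad_field l2 m2 n2) \<longleftrightarrow>
    (m1 = 0 \<and> m2 = 0) \<or>
    (l1 - l2 = 0 \<and> m1 - m2 = 0 \<and> l1 + n2 = 0 \<and> l1 + n1 = 0) \<or>
    (l1 + l2 + 1 = 0 \<and> m1 - m2 = 0 \<and> n1 + n2 - 1 = 0)"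
  using center_conditions_necessary center_conditions_sufficient by blast

end
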